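(* Let $G$ be a group and suppose that there is an overring $R\supset\mathbb ZG$ such that $R$ is flat as a left $\mathbb ZG$-module and $\mathbb Z\otimes_{\mathbb ZG}R=0$. Let $n$ be a positive integer. If both $H^{n-1}(G,-)$ and $H^{n+1}(G,-)$ are $0$-finitary, then $H^n(G,-)$ is also $0$-finitary.
   Context: Modules are right modules; $\mathbb Z$ denotes the trivial right $\mathbb ZG$-module, and an overring $R\supset\mathbb ZG$ is a ring containing $\mathbb ZG$ as a unital subring. $H^n(G,-)$ is the $n$th cohomology functor from $\mathbb ZG$-modules to abelian groups. An additive functor $F$ between abelian categories is called $0$-finitary if $\varinjlim F(M_\lambda)=0$ whenever $(M_\lambda)$ is a (small) filtered colimit system with $\varinjlim M_\lambda=0$. *)

theory Defs
  imports "HOL-Algebra.Algebra"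
begin

section \<open>Group rings, modules and overrings\<close>

text \<open>The library type \<open>'g \<Rightarrow>\<^sub>0 int\<close> of finitely supported integer functions carries the free abelian
  group on \<^term>\<open>carrier G\<close>; the product is the bilinear extension of the product of \<open>G\<close>, and
  \<^term>\<open>frag_of g\<close> is the group element \<open>g\<close> viewed in the group ring.\<close>

definition group_ring :: "('g, 'b) monoid_scheme \<Rightarrow> ('g \<Rightarrow>\<^sub>0 int) ring"
  where "group_ring G =
    \<lparr>carrier = {c. Poly_Mapping.keys c \<subseteq> carrier G},
     monoid.mult = (\<lambda>x y. frag_extend (\<lambda>g. frag_extend (\<lambda>h. frag_of (g \<otimes>\<^bsub>G\<^esub> h)) y) x),
     one = frag_of \<one>\<^bsub>G\<^esub>,
     ring.zero = 0,
     add = (+)\<rparr>"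

text \<open>The library locale \<^locale>\<open>module\<close> requires a commutative ring of scalars, so modules over an
  arbitrary ring are introduced here. As for the library record \<^typ>\<open>('a, 'b) module\<close>, which is
  reused for left modules, only the additive part of the underlying ring record is relevant.\<close>

record ('s, 'm) rmodule = "'m ring" +
  ract :: "'m \<Rightarrow> 's \<Rightarrow> 'm"

locale right_module = S?: ring S + M?: abelian_group M
  for S :: "('s, 'a) ring_scheme" (structure) and M :: "('s, 'm, 'b) rmodule_scheme" (structure) +
  assumes ract_closed:
      "\<lbrakk>x \<in> carrier M; s \<in> carrier S\<rbrakk> \<Longrightarrow> ract M x s \<in> carrier M"
    and ract_add_left:
      "\<lbrakk>x \<in> carrier M; y \<in> carrier M; s \<in> carrier S\<rbrakk> \<Longrightarrow>
        ract M (x \<oplus>\<^bsub>M\<^esub> y) s = ract M x s \<oplus>\<^bsub>M\<^esub> ract M y s"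
    and ract_add_right:
      "\<lbrakk>x \<in> carrier M; s \<in> carrier S; t \<in> carrier S\<rbrakk> \<Longrightarrow>
        ract M x (s \<oplus>\<^bsub>S\<^esub> t) = ract M x s \<oplus>\<^bsub>M\<^esub> ract M x t"
    and ract_mult:
      "\<lbrakk>x \<in> carrier M; s \<in> carrier S; t \<in> carrier S\<rbrakk> \<Longrightarrow>
        ract M x (s \<otimes>\<^bsub>S\<^esub> t) = ract M (ract M x s) t"
    and ract_one:
      "x \<in> carrier M \<Longrightarrow> ract M x \<one>\<^bsub>S\<^esub> = x"

locale left_module = S?: ring S + N?: abelian_group N
  for S :: "('s, 'a) ring_scheme" (structure) and N :: "('s, 'm, 'b) module_scheme" (structure) +
  assumes smult_closed:
      "\<lbrakk>s \<in> carrier S; x \<in> carrier N\<rbrakk> \<Longrightarrow> s \<odot>\<^bsub>N\<^esub> x \<in> carrier N"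
    and smult_add_right:
      "\<lbrakk>s \<in> carrier S; x \<in> carrier N; y \<in> carrier N\<rbrakk> \<Longrightarrow>
        s \<odot>\<^bsub>N\<^esub> (x \<oplus>\<^bsub>N\<^esub> y) = s \<odot>\<^bsub>N\<^esub> x \<oplus>\<^bsub>N\<^esub> s \<odot>\<^bsub>N\<^esub> y"
    and smult_add_left:
      "\<lbrakk>s \<in> carrier S; t \<in> carrier S; x \<in> carrier N\<rbrakk> \<Longrightarrow>
        (s \<oplus>\<^bsub>S\<^esub> t) \<odot>\<^bsub>N\<^esub> x = s \<odot>\<^bsub>N\<^esub> x \<oplus>\<^bsub>N\<^esub> t \<odot>\<^bsub>N\<^esub> x"
    and smult_mult:
      "\<lbrakk>s \<in> carrier S; t \<in> carrier S; x \<in> carrier N\<rbrakk> \<Longrightarrow>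
        (s \<otimes>\<^bsub>S\<^esub> t) \<odot>\<^bsub>N\<^esub> x = s \<odot>\<^bsub>N\<^esub> (t \<odot>\<^bsub>N\<^esub> x)"
    and smult_one:
      "x \<in> carrier N \<Longrightarrow> \<one>\<^bsub>S\<^esub> \<odot>\<^bsub>N\<^esub> x = x"

definition rmodule_hom ::
  "('s, 'a) ring_scheme \<Rightarrow> ('s, 'm, 'b) rmodule_scheme \<Rightarrow> ('s, 'n, 'c) rmodule_scheme \<Rightarrow> ('m \<Rightarrow> 'n) set"
  where "rmodule_hom S M N =
    {f \<in> hom (add_monoid M) (add_monoid N).
       \<forall>x\<in>carrier M. \<forall>s\<in>carrier S. f (ract M x s) = ract N (f x) s}"

definition trivial_rmodule :: "('g \<Rightarrow>\<^sub>0 int, int) rmodule"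
  where "trivial_rmodule =
    \<lparr>carrier = UNIV, monoid.mult = (*), one = 1, ring.zero = 0, add = (+),
     ract = (\<lambda>k c. k * (\<Sum>g\<in>Poly_Mapping.keys c. Poly_Mapping.lookup c g))\<rparr>"

text \<open>\<open>R\<close> contains \<open>S\<close> as a unital subring, the inclusion being the injection \<open>\<iota>\<close>
  (elements of \<^const>\<open>ring_hom\<close> preserve the unit).\<close>

definition overring :: "('s, 'a) ring_scheme \<Rightarrow> ('r, 'b) ring_scheme \<Rightarrow> ('s \<Rightarrow> 'r) \<Rightarrow> bool"
  where "overring S R \<iota> \<longleftrightarrow>
    ring S \<and> ring R \<and> \<iota> \<in> ring_hom S R \<and> inj_on \<iota> (carrier S)"

definition as_left_module :: "('s \<Rightarrow> 'r) \<Rightarrow> ('r, 'b) ring_scheme \<Rightarrow> ('s, 'r) module"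
  where "as_left_module \<iota> R =
    \<lparr>carrier = carrier R, monoid.mult = monoid.mult R, one = one R, ring.zero = ring.zero R, add = add R,
     smult = (\<lambda>s x. \<iota> s \<otimes>\<^bsub>R\<^esub> x)\<rparr>"


section \<open>Tensor products and flatness\<close>

definition tensor_relations ::
  "('s, 'a) ring_scheme \<Rightarrow> ('s, 'm, 'b) rmodule_scheme \<Rightarrow> ('s, 'n, 'c) module_scheme \<Rightarrow> ('m \<times> 'n \<Rightarrow>\<^sub>0 int) set"
  where "tensor_relations S M N =
      {frag_of (x \<oplus>\<^bsub>M\<^esub> x', y) - frag_of (x, y) - frag_of (x', y) | x x' y.
         x \<in> carrier M \<and> x' \<in> carrier M \<and> y \<in> carrier N}
    \<union> {frag_of (x, y \<oplus>\<^bsub>N\<^esub> y') - frag_of (x, y) - frag_of (x, y') | x y y'.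
         x \<in> carrier M \<and> y \<in> carrier N \<and> y' \<in> carrier N}
    \<union> {frag_of (ract M x s, y) - frag_of (x, s \<odot>\<^bsub>N\<^esub> y) | x s y.
         x \<in> carrier M \<and> s \<in> carrier S \<and> y \<in> carrier N}"

definition tensor_kernel ::
  "('s, 'a) ring_scheme \<Rightarrow> ('s, 'm, 'b) rmodule_scheme \<Rightarrow> ('s, 'n, 'c) module_scheme \<Rightarrow> ('m \<times> 'n \<Rightarrow>\<^sub>0 int) set"
  where "tensor_kernel S M N =
    generate (free_Abelian_group (carrier M \<times> carrier N)) (tensor_relations S M N)"

text \<open>As everywhere in the library, quotient groups, and hence tensor products, are written
  multiplicatively; \<^term>\<open>trivial_group (tensor S M N)\<close> says that the tensor product is zero.\<close>

definition tensor ::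
  "('s, 'a) ring_scheme \<Rightarrow> ('s, 'm, 'b) rmodule_scheme \<Rightarrow> ('s, 'n, 'c) module_scheme \<Rightarrow> ('m \<times> 'n \<Rightarrow>\<^sub>0 int) set monoid"
  where "tensor S M N =
    free_Abelian_group (carrier M \<times> carrier N) Mod tensor_kernel S M N"

text \<open>The map \<open>f \<otimes> id\<close> from \<open>A \<otimes> N\<close> to \<open>B \<otimes> N\<close> induced by \<open>f\<close>. For a coset \<open>K\<close>, all \<open>x \<in> K\<close> contribute the
  same coset to the union.\<close>

definition tensor_map ::
  "('s, 'a) ring_scheme \<Rightarrow> ('s, 'n, 'c) module_scheme \<Rightarrow> ('s, 'm2, 'b) rmodule_scheme \<Rightarrow> ('m1 \<Rightarrow> 'm2) \<Rightarrow>
    ('m1 \<times> 'n \<Rightarrow>\<^sub>0 int) set \<Rightarrow> ('m2 \<times> 'n \<Rightarrow>\<^sub>0 int) set"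
  where "tensor_map S N B f K =
    (\<Union>x\<in>K. r_coset (free_Abelian_group (carrier B \<times> carrier N)) (tensor_kernel S B N)
              (frag_extend (\<lambda>(a, y). frag_of (f a, y)) x))"

text \<open>The functor \<open>- \<otimes> N\<close> preserves injections between right modules. As HOL does not quantify over
  types inside a formula, the type argument \<open>'u\<close> plays the role of the universe in which the right
  modules live. Flatness can be tested on inclusions of right ideals of \<open>S\<close>, so
  this is plain flatness as soon as \<open>S\<close> embeds into \<open>'u\<close>.\<close>

definition flat_left_module ::
  "'u itself \<Rightarrow> ('s, 'a) ring_scheme \<Rightarrow> ('s, 'n, 'c) module_scheme \<Rightarrow> bool"
  where "flat_left_module U S N \<longleftrightarrow> left_module S N \<and>
    (\<forall>(A :: ('s, 'u) rmodule) (B :: ('s, 'u) rmodule) f.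
       right_module S A \<and> right_module S B \<and> f \<in> rmodule_hom S A B \<and> inj_on f (carrier A) \<longrightarrow>
       inj_on (tensor_map S N B f) (carrier (tensor S A N)))"


section \<open>Filtered colimits and 0-finitary functors\<close>

record ('o, 'a) small_category =
  Obj :: "'o set"
  Arr :: "'a set"
  Dom :: "'a \<Rightarrow> 'o"
  Cod :: "'a \<Rightarrow> 'o"
  Ident :: "'o \<Rightarrow> 'a"
  Comp :: "'a \<Rightarrow> 'a \<Rightarrow> 'a"  \<comment> \<open>\<open>Comp J b a\<close> is \<open>b\<close> after \<open>a\<close>\<close>

locale small_category =
  fixes J :: "('o, 'a) small_category"
  assumes Dom_in: "a \<in> Arr J \<Longrightarrow> Dom J a \<in> Obj J"
    and Cod_in: "a \<in> Arr J \<Longrightarrow> Cod J a \<in> Obj J"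
    and Ident_in: "i \<in> Obj J \<Longrightarrow> Ident J i \<in> Arr J \<and> Dom J (Ident J i) = i \<and> Cod J (Ident J i) = i"
    and Comp_in: "\<lbrakk>a \<in> Arr J; b \<in> Arr J; Dom J b = Cod J a\<rbrakk> \<Longrightarrow>
        Comp J b a \<in> Arr J \<and> Dom J (Comp J b a) = Dom J a \<and> Cod J (Comp J b a) = Cod J b"
    and Comp_Ident_right: "a \<in> Arr J \<Longrightarrow> Comp J a (Ident J (Dom J a)) = a"
    and Comp_Ident_left: "a \<in> Arr J \<Longrightarrow> Comp J (Ident J (Cod J a)) a = a"
    and Comp_assoc: "\<lbrakk>a \<in> Arr J; b \<in> Arr J; c \<in> Arr J; Dom J b = Cod J a; Dom J c = Cod J b\<rbrakk> \<Longrightarrow>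
        Comp J c (Comp J b a) = Comp J (Comp J c b) a"

locale filtered_category = small_category J for J :: "('o, 'a) small_category" +
  assumes nonempty: "Obj J \<noteq> {}"
    and upper_bound: "\<lbrakk>i \<in> Obj J; j \<in> Obj J\<rbrakk> \<Longrightarrow>
        \<exists>a\<in>Arr J. \<exists>b\<in>Arr J. Dom J a = i \<and> Dom J b = j \<and> Cod J a = Cod J b"
    and coequalized: "\<lbrakk>a \<in> Arr J; b \<in> Arr J; Dom J a = Dom J b; Cod J a = Cod J b\<rbrakk> \<Longrightarrow>
        \<exists>c\<in>Arr J. Dom J c = Cod J a \<and> Comp J c a = Comp J c b"

locale rmodule_system = small_category J + S?: ring S
  for S :: "('s, 'r) ring_scheme"
    and J :: "('o, 'a) small_category"
    and M :: "'o \<Rightarrow> ('s, 'm) rmodule"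
    and \<phi> :: "'a \<Rightarrow> 'm \<Rightarrow> 'm" +
  assumes M_module: "i \<in> Obj J \<Longrightarrow> right_module S (M i)"
    and \<phi>_hom: "a \<in> Arr J \<Longrightarrow> \<phi> a \<in> rmodule_hom S (M (Dom J a)) (M (Cod J a))"
    and \<phi>_Ident: "\<lbrakk>i \<in> Obj J; x \<in> carrier (M i)\<rbrakk> \<Longrightarrow> \<phi> (Ident J i) x = x"
    and \<phi>_Comp: "\<lbrakk>a \<in> Arr J; b \<in> Arr J; Dom J b = Cod J a; x \<in> carrier (M (Dom J a))\<rbrakk> \<Longrightarrow>
        \<phi> (Comp J b a) x = \<phi> b (\<phi> a x)"

definition sum_inj :: "'o set \<Rightarrow> ('o \<Rightarrow> ('x, 'e) monoid_scheme) \<Rightarrow> 'o \<Rightarrow> 'x \<Rightarrow> 'o \<Rightarrow> 'x"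
  where "sum_inj I A i x = (\<lambda>j\<in>I. if j = i then x else \<one>\<^bsub>A j\<^esub>)"

text \<open>The colimit of a system of (multiplicatively written) abelian groups: the quotient of the direct
  sum by the subgroup generated by the differences between \<open>x\<close> in the summand \<open>Dom a\<close> and \<open>\<alpha> a x\<close> in
  the summand \<open>Cod a\<close>. The colimit of a system of right modules is the same group, made from the
  underlying additive groups, with the evident action (the subgroup is then a submodule). So the
  colimit module vanishes iff this group is trivial.\<close>

definition colim ::
  "('o, 'a) small_category \<Rightarrow> ('o \<Rightarrow> ('x, 'e) monoid_scheme) \<Rightarrow> ('a \<Rightarrow> 'x \<Rightarrow> 'x) \<Rightarrow> ('o \<Rightarrow> 'x) set monoid"
  where "colim J A \<alpha> =
    (let D = sum_group (Obj J) A in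
     D Mod generate D
       {sum_inj (Obj J) A (Dom J a) x \<otimes>\<^bsub>D\<^esub> inv\<^bsub>D\<^esub> (sum_inj (Obj J) A (Cod J a) (\<alpha> a x)) | a x.
          a \<in> Arr J \<and> x \<in> carrier (A (Dom J a))})"

text \<open>A functor from right modules to (multiplicatively written) abelian groups is given by its
  action on objects and its action on morphisms; the latter takes source and target as arguments.\<close>

type_synonym ('s, 'u, 'x) rmodule_functor =
  "(('s, 'u) rmodule \<Rightarrow> 'x monoid) \<times> (('s, 'u) rmodule \<Rightarrow> ('s, 'u) rmodule \<Rightarrow> ('u \<Rightarrow> 'u) \<Rightarrow> 'x \<Rightarrow> 'x)"

text \<open>The type \<open>'u\<close> is the universe: modules, and objects and arrows of the index categories, are
  taken in \<open>'u\<close>, which gives meaning to ``small''. Being 0-finitary in the usual sense is this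
  property for all \<open>'u\<close>.\<close>

definition zero_finitary :: "('s, 'a) ring_scheme \<Rightarrow> ('s, 'u, 'x) rmodule_functor \<Rightarrow> bool"
  where "zero_finitary S F \<longleftrightarrow>
    (\<forall>(J :: ('u, 'u) small_category) (M :: 'u \<Rightarrow> ('s, 'u) rmodule) \<phi>.
       filtered_category J \<and> rmodule_system S J M \<phi> \<and>
       trivial_group (colim J (\<lambda>i. add_monoid (M i)) \<phi>) \<longrightarrow>
       trivial_group (colim J (\<lambda>i. fst F (M i)) (\<lambda>a. snd F (M (Dom J a)) (M (Cod J a)) (\<phi> a))))"


section \<open>Group cohomology\<close>

text \<open>Inhomogeneous cochains. For \<open>M\<close> a right module they form \<open>Hom(B\<^sub>n, M)\<close>, where \<open>B\<^sub>n\<close> is the free right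
  \<open>\<int>G\<close>-module on the symbols \<open>[g\<^sub>1|...|g\<^sub>n]\<close> and the bar resolution of \<open>\<int>\<close> by right modules has
  boundary \<open>[g\<^sub>2|...|g\<^sub>n] + (\<Sum>i=1..n-1. (-1)\<^sup>i [g\<^sub>1|...|g\<^sub>ig\<^sub>i\<^sub>+\<^sub>1|...|g\<^sub>n]) + (-1)\<^sup>n [g\<^sub>1|...|g\<^sub>n\<^sub>-\<^sub>1]g\<^sub>n\<close>.\<close>

definition bar_cells :: "('g, 'b) monoid_scheme \<Rightarrow> nat \<Rightarrow> 'g list set"
  where "bar_cells G n = {xs. length xs = n \<and> set xs \<subseteq> carrier G}"

definition cochains ::
  "('g, 'b) monoid_scheme \<Rightarrow> nat \<Rightarrow> ('s, 'm, 'c) rmodule_scheme \<Rightarrow> ('g list \<Rightarrow> 'm) monoid"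
  where "cochains G n M = product_group (bar_cells G n) (\<lambda>_. add_monoid M)"

definition coboundary ::
  "('g, 'b) monoid_scheme \<Rightarrow> nat \<Rightarrow> ('g \<Rightarrow>\<^sub>0 int, 'm, 'c) rmodule_scheme \<Rightarrow> ('g list \<Rightarrow> 'm) \<Rightarrow> 'g list \<Rightarrow> 'm"
  where "coboundary G n M f =
    (\<lambda>xs\<in>bar_cells G (Suc n).
       f (tl xs)
       \<oplus>\<^bsub>M\<^esub> (\<Oplus>\<^bsub>M\<^esub> i\<in>{1..n}. add_pow M ((- 1 :: int) ^ i)
              (f (take (i - 1) xs @ (xs ! (i - 1) \<otimes>\<^bsub>G\<^esub> xs ! i) # drop (i + 1) xs)))
       \<oplus>\<^bsub>M\<^esub> add_pow M ((- 1 :: int) ^ Suc n) (ract M (f (butlast xs)) (frag_of (last xs))))"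

definition cocycles ::
  "('g, 'b) monoid_scheme \<Rightarrow> nat \<Rightarrow> ('g \<Rightarrow>\<^sub>0 int, 'm, 'c) rmodule_scheme \<Rightarrow> ('g list \<Rightarrow> 'm) set"
  where "cocycles G n M = kernel (cochains G n M) (cochains G (Suc n) M) (coboundary G n M)"

definition coboundaries ::
  "('g, 'b) monoid_scheme \<Rightarrow> nat \<Rightarrow> ('g \<Rightarrow>\<^sub>0 int, 'm, 'c) rmodule_scheme \<Rightarrow> ('g list \<Rightarrow> 'm) set"
  where "coboundaries G n M =
    (case n of 0 \<Rightarrow> {\<one>\<^bsub>cochains G 0 M\<^esub>}
     | Suc m \<Rightarrow> coboundary G m M ` carrier (cochains G m M))"

definition cohomology_group ::
  "('g, 'b) monoid_scheme \<Rightarrow> nat \<Rightarrow> ('g \<Rightarrow>\<^sub>0 int, 'm, 'c) rmodule_scheme \<Rightarrow> ('g list \<Rightarrow> 'm) set monoid"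
  where "cohomology_group G n M =
    (cochains G n M)\<lparr>carrier := cocycles G n M\<rparr> Mod coboundaries G n M"

text \<open>The map sending the class of a cocycle \<open>c\<close> to the class of \<open>f \<circ> c\<close>; all \<open>c\<close> in one class \<open>K\<close>
  contribute the same class to the union.\<close>

definition cohomology_map ::
  "('g, 'b) monoid_scheme \<Rightarrow> nat \<Rightarrow> ('g \<Rightarrow>\<^sub>0 int, 'm, 'c) rmodule_scheme \<Rightarrow> ('g \<Rightarrow>\<^sub>0 int, 'k, 'd) rmodule_scheme \<Rightarrow>
    ('m \<Rightarrow> 'k) \<Rightarrow> ('g list \<Rightarrow> 'm) set \<Rightarrow> ('g list \<Rightarrow> 'k) set"
  where "cohomology_map G n M N f K =
    (\<Union>c\<in>K. r_coset (cochains G n N) (coboundaries G n N) (\<lambda>xs\<in>bar_cells G n. f (c xs)))"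

text \<open>\<open>H\<^sup>n(G, -)\<close> on the right \<open>\<int>G\<close>-modules in the universe \<open>'u\<close>.\<close>

definition cohomology ::
  "'u itself \<Rightarrow> ('g, 'b) monoid_scheme \<Rightarrow> nat \<Rightarrow> ('g \<Rightarrow>\<^sub>0 int, 'u, ('g list \<Rightarrow> 'u) set) rmodule_functor"
  where "cohomology U G n = (cohomology_group G n, cohomology_map G n)"

end

theory Submission
  imports Defs
begin

text \<open>Let \<open>(M i)\<close> be a system with colimit \<open>0\<close>, and let \<open>F i\<close> be the free \<open>\<int>G\<close>-module on the nonzero elements of
  \<open>M i\<close>, which is functorial in \<open>i\<close>. As every generator dies in the system, \<open>(F i)\<close> has colimit \<open>0\<close> as well, and
  so have the kernels \<open>\<Omega> i\<close> of \<open>F i \<rightarrow> M i\<close>, the modules \<open>E i = F i \<otimes> R\<close> and the quotients \<open>C i = E i / F i\<close>.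

  Tensoring the bar resolution with the flat module \<open>R\<close> yields a resolution of \<open>\<int> \<otimes> R = 0\<close> by free \<open>R\<close>-modules. It
  splits, so the cohomology of \<open>G\<close> with coefficients in an \<open>R\<close>-module vanishes in positive degrees. Hence
  \<open>H\<^sup>n\<^sup>-\<^sup>1(G, C i) \<rightarrow> H\<^sup>n(G, F i)\<close> is surjective, while \<open>H\<^sup>n(G, F i) \<rightarrow> H\<^sup>n(G, M i) \<rightarrow> H\<^sup>n\<^sup>+\<^sup>1(G, \<Omega> i)\<close> is exact, and the
  hypotheses on the degrees \<open>n - 1\<close> and \<open>n + 1\<close> apply to the systems \<open>(C i)\<close> and \<open>(\<Omega> i)\<close>.\<close>

section \<open>Homomorphisms and direct sums of modules\<close>

text \<open>Free modules are used because \<open>M i\<close> cannot be compared with an R-module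
  directly: the map from a module to its tensor product with R need not be injective, and for the
  trivial module it is zero. For \<open>F i\<close> this map is \<iota> in every coordinate. The
  price is one degree on either side: the kernel \<Omega> pushes the obstruction up to n + 1, the
  quotient C pushes it down to n - 1. Flatness and the vanishing of the tensor product serve only to
  make the bar complex over R exact, in positive degrees and in degree 0 respectively. The modules
  so constructed consist of functions, while the hypotheses and flatness speak of modules inside the
  type 'u. But \<iota> embeds an infinite ring into 'u, and finitely supported functions on a subset
  of 'u are no more numerous than 'u, so copies of all of them exist in 'u. No long exact sequence
  is constructed. A filtered colimit vanishes iff every element dies along some arrow, so exactness
  becomes a chase on cochains in which each appeal to a hypothesis moves along one more
  arrow.\<close>

lemma (in abelian_group) add_minus_add:
  "\<lbrakk>x \<in> carrier G; y \<in> carrier G; p \<in> carrier G; q \<in> carrier G\<rbrakk> \<Longrightarrow>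
    (x \<oplus> p) \<ominus> (y \<oplus> q) = (x \<ominus> y) \<oplus> (p \<ominus> q)"
  by (simp add: a_minus_def minus_add a_ac)

lemma (in abelian_group) minus_add_minus:
  "\<lbrakk>x \<in> carrier G; y \<in> carrier G; z \<in> carrier G\<rbrakk> \<Longrightarrow> (x \<ominus> y) \<oplus> (y \<ominus> z) = x \<ominus> z"
  by (simp add: a_minus_def a_assoc r_neg1)

lemma (in abelian_group) a_inv_minus:
  "\<lbrakk>x \<in> carrier G; y \<in> carrier G\<rbrakk> \<Longrightarrow> \<ominus> (x \<ominus> y) = y \<ominus> x"
  by (simp add: a_minus_def minus_add a_comm)

lemma (in abelian_group) minus_minus_minus:
  "\<lbrakk>x \<in> carrier G; y \<in> carrier G; p \<in> carrier G; q \<in> carrier G\<rbrakk> \<Longrightarrow>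
    (x \<ominus> y) \<ominus> (p \<ominus> q) = (x \<ominus> p) \<ominus> (y \<ominus> q)"
  by (simp add: a_minus_def minus_add a_ac)

lemma (in abelian_group) add_minus_cancel:
  assumes "x \<in> carrier G" "y \<in> carrier G"
  shows "(x \<oplus> y) \<ominus> x = y" "(x \<oplus> y) \<ominus> x \<ominus> y = \<zero>"
proof -
  show "(x \<oplus> y) \<ominus> x = y"
    using assms by (simp add: a_minus_def a_comm[of x y] a_assoc r_neg)
  then show "(x \<oplus> y) \<ominus> x \<ominus> y = \<zero>" using assms by (simp add: a_minus_def r_neg)
qed

lemma (in abelian_group) minus_minus_cancel:
  "\<lbrakk>x \<in> carrier G; y \<in> carrier G\<rbrakk> \<Longrightarrow> x \<ominus> (x \<ominus> y) = y"
  by (simp add: a_minus_def minus_add r_neg2)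

lemma (in abelian_group) minus_eq_zero:
  assumes "x \<in> carrier G" "y \<in> carrier G" "x \<ominus> y = \<zero>"
  shows "x = y"
proof -
  have "x = (x \<ominus> y) \<oplus> y" using assms(1,2) by (simp add: a_minus_def a_assoc l_neg)
  then show ?thesis using assms by simp
qed

lemma (in abelian_group) minus_zero_right: "x \<in> carrier G \<Longrightarrow> x \<ominus> \<zero> = x"
  by (simp add: a_minus_def)

lemma add_pow_int_0: "add_pow G (0 :: int) x = \<zero>\<^bsub>G\<^esub>"
  by (simp add: add_pow_def)

lemma (in abelian_group_hom) hom_minus:
  "\<lbrakk>x \<in> carrier G; y \<in> carrier G\<rbrakk> \<Longrightarrow> h (x \<ominus>\<^bsub>G\<^esub> y) = h x \<ominus>\<^bsub>H\<^esub> h y"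
  by (simp add: G.minus_eq H.minus_eq)

lemma (in abelian_group_hom) hom_finsum:
  "g \<in> A \<rightarrow> carrier G \<Longrightarrow> h (\<Oplus>\<^bsub>G\<^esub>i\<in>A. g i) = (\<Oplus>\<^bsub>H\<^esub>i\<in>A. h (g i))"
proof (induction A rule: infinite_finite_induct)
  case (insert x F)
  then show ?case by (simp add: G.finsum_insert H.finsum_insert Pi_def)
qed simp_all

lemma (in abelian_group_hom) hom_add_pow:
  "x \<in> carrier G \<Longrightarrow> h (add_pow G (k :: int) x) = add_pow H k (h x)"
proof -
  assume x: "x \<in> carrier G"
  interpret gh: group_hom "add_monoid G" "add_monoid H" h
    by (rule a_group_hom)
  show ?thesis
    using gh.hom_int_pow[of x k] x by (simp add: add_pow_def)
qed

lemma abelian_group_homI':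
  assumes "abelian_group M" "abelian_group N"
    and "\<And>x. x \<in> carrier M \<Longrightarrow> f x \<in> carrier N"
    and "\<And>x y. \<lbrakk>x \<in> carrier M; y \<in> carrier M\<rbrakk> \<Longrightarrow> f (x \<oplus>\<^bsub>M\<^esub> y) = f x \<oplus>\<^bsub>N\<^esub> f y"
  shows "abelian_group_hom M N f"
  using assms by (intro abelian_group_homI)
    (auto simp: group_hom_def group_hom_axioms_def hom_def intro: abelian_group.a_group)

lemma (in abelian_group) add_pow_hom: "abelian_group_hom G G (add_pow G (k :: int))"
  by (intro abelian_group_homI' abelian_group_axioms) (auto simp: add.int_pow_distrib)

lemma abelian_group_hom_comp:
  assumes "abelian_group_hom M N f" "abelian_group_hom N P g"
  shows "abelian_group_hom M P (\<lambda>x. g (f x))"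
proof -
  interpret f: abelian_group_hom M N f by fact
  interpret g: abelian_group_hom N P g by fact
  show ?thesis
    by (rule abelian_group_homI') (auto simp: f.G.abelian_group_axioms g.H.abelian_group_axioms)
qed

locale right_module_hom = M: right_module S M + N: right_module S N
  for S :: "('s, 'a) ring_scheme" (structure) and M :: "('s, 'm, 'b) rmodule_scheme"
    and N :: "('s, 'n, 'c) rmodule_scheme" and f +
  assumes f: "f \<in> rmodule_hom S M N"

sublocale right_module_hom \<subseteq> ah: abelian_group_hom M N f
  using f by (auto intro!: abelian_group_homI M.abelian_group_axioms N.abelian_group_axioms
      simp: rmodule_hom_def group_hom_def group_hom_axioms_def M.a_group N.a_group)

lemma (in right_module_hom) hom_ract:
  "\<lbrakk>x \<in> carrier M; s \<in> carrier S\<rbrakk> \<Longrightarrow> f (ract M x s) = ract N (f x) s"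
  using f by (auto simp: rmodule_hom_def)

lemma right_module_homI:
  assumes "right_module S M" "right_module S N"
    and "\<And>x. x \<in> carrier M \<Longrightarrow> f x \<in> carrier N"
    and "\<And>x y. \<lbrakk>x \<in> carrier M; y \<in> carrier M\<rbrakk> \<Longrightarrow> f (x \<oplus>\<^bsub>M\<^esub> y) = f x \<oplus>\<^bsub>N\<^esub> f y"
    and "\<And>x s. \<lbrakk>x \<in> carrier M; s \<in> carrier S\<rbrakk> \<Longrightarrow> f (ract M x s) = ract N (f x) s"
  shows "right_module_hom S M N f"
  using assms
  by (auto simp: right_module_hom_def right_module_hom_axioms_def rmodule_hom_def hom_def)

lemma right_module_hom_comp:
  assumes "right_module_hom S M N f" "right_module_hom S N P g"
  shows "right_module_hom S M P (\<lambda>x. g (f x))"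
proof -
  interpret f: right_module_hom S M N f by fact
  interpret g: right_module_hom S N P g by fact
  show ?thesis
    by (rule right_module_homI)
      (simp_all add: f.M.right_module_axioms g.N.right_module_axioms f.hom_ract g.hom_ract)
qed

context right_module
begin

lemma ract_zero_left: "s \<in> carrier S \<Longrightarrow> ract M \<zero>\<^bsub>M\<^esub> s = \<zero>\<^bsub>M\<^esub>"
proof -
  assume s: "s \<in> carrier S"
  have "ract M \<zero>\<^bsub>M\<^esub> s \<oplus>\<^bsub>M\<^esub> ract M \<zero>\<^bsub>M\<^esub> s = ract M \<zero>\<^bsub>M\<^esub> s"
    using ract_add_left[of "\<zero>\<^bsub>M\<^esub>" "\<zero>\<^bsub>M\<^esub>" s] s by simp
  then show ?thesis
    using s by (simp add: ract_closed)
qed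

lemma abelian_group_hom_ract: "s \<in> carrier S \<Longrightarrow> abelian_group_hom M M (\<lambda>x. ract M x s)"
  by (intro abelian_group_homI M.abelian_group_axioms)
    (auto simp: group_hom_def group_hom_axioms_def M.a_group hom_def ract_closed ract_add_left)

lemma abelian_group_hom_ract_right: "x \<in> carrier M \<Longrightarrow> abelian_group_hom S M (ract M x)"
  by (intro abelian_group_homI M.abelian_group_axioms S.abelian_group_axioms)
    (auto simp: group_hom_def group_hom_axioms_def M.a_group S.a_group hom_def ract_closed ract_add_right)

lemma ract_zero_right: "x \<in> carrier M \<Longrightarrow> ract M x \<zero>\<^bsub>S\<^esub> = \<zero>\<^bsub>M\<^esub>"
  using abelian_group_hom.hom_zero[OF abelian_group_hom_ract_right] .

lemma ract_minus: "\<lbrakk>x \<in> carrier M; y \<in> carrier M; s \<in> carrier S\<rbrakk> \<Longrightarrow>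
    ract M (x \<ominus>\<^bsub>M\<^esub> y) s = ract M x s \<ominus>\<^bsub>M\<^esub> ract M y s"
  using abelian_group_hom.hom_minus[OF abelian_group_hom_ract] .

end

section \<open>Restriction of scalars and direct sums of right modules\<close>

lemma right_moduleI:
  assumes "ring S" "abelian_group M"
    and "\<And>x s. \<lbrakk>x \<in> carrier M; s \<in> carrier S\<rbrakk> \<Longrightarrow> ract M x s \<in> carrier M"
    and "\<And>x y s. \<lbrakk>x \<in> carrier M; y \<in> carrier M; s \<in> carrier S\<rbrakk> \<Longrightarrow>
        ract M (x \<oplus>\<^bsub>M\<^esub> y) s = ract M x s \<oplus>\<^bsub>M\<^esub> ract M y s"
    and "\<And>x s t. \<lbrakk>x \<in> carrier M; s \<in> carrier S; t \<in> carrier S\<rbrakk> \<Longrightarrow>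
        ract M x (s \<oplus>\<^bsub>S\<^esub> t) = ract M x s \<oplus>\<^bsub>M\<^esub> ract M x t"
    and "\<And>x s t. \<lbrakk>x \<in> carrier M; s \<in> carrier S; t \<in> carrier S\<rbrakk> \<Longrightarrow>
        ract M x (s \<otimes>\<^bsub>S\<^esub> t) = ract M (ract M x s) t"
    and "\<And>x. x \<in> carrier M \<Longrightarrow> ract M x \<one>\<^bsub>S\<^esub> = x"
  shows "right_module S M"
  using assms by (auto simp: right_module_def right_module_axioms_def)

definition regular_rmodule :: "('s, 'a) ring_scheme \<Rightarrow> ('s, 's) rmodule"
  where "regular_rmodule S =
    \<lparr>carrier = carrier S, monoid.mult = monoid.mult S, one = one S, ring.zero = ring.zero S, add = add S,
     ract = monoid.mult S\<rparr>"

definition restrict_scalars ::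
  "('t \<Rightarrow> 's) \<Rightarrow> ('s, 'm, 'b) rmodule_scheme \<Rightarrow> ('t, 'm) rmodule"
  where "restrict_scalars j M =
    \<lparr>carrier = carrier M, monoid.mult = monoid.mult M, one = one M, ring.zero = ring.zero M, add = add M,
     ract = (\<lambda>x t. ract M x (j t))\<rparr>"

text \<open>Values outside I are zero instead of \<open>undefined\<close>, so the operations are
  pointwise on the whole index type and supports are plain sets of indices.\<close>

definition direct_sum :: "'i set \<Rightarrow> ('s, 'm, 'b) rmodule_scheme \<Rightarrow> ('s, 'i \<Rightarrow> 'm) rmodule"
  where "direct_sum I V =
    \<lparr>carrier = {f. (\<forall>i. f i \<in> carrier V) \<and> (\<forall>i. i \<notin> I \<longrightarrow> f i = \<zero>\<^bsub>V\<^esub>) \<and> finite {i. f i \<noteq> \<zero>\<^bsub>V\<^esub>}},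
     monoid.mult = undefined, one = undefined, ring.zero = (\<lambda>i. \<zero>\<^bsub>V\<^esub>), add = (\<lambda>f g i. f i \<oplus>\<^bsub>V\<^esub> g i),
     ract = (\<lambda>f s i. ract V (f i) s)\<rparr>"

lemma regular_rmodule_simps [simp]:
  "carrier (regular_rmodule S) = carrier S"
  "\<zero>\<^bsub>regular_rmodule S\<^esub> = \<zero>\<^bsub>S\<^esub>"
  "x \<oplus>\<^bsub>regular_rmodule S\<^esub> y = x \<oplus>\<^bsub>S\<^esub> y"
  "ract (regular_rmodule S) x s = x \<otimes>\<^bsub>S\<^esub> s"
  by (simp_all add: regular_rmodule_def)

lemma restrict_scalars_simps [simp]:
  "carrier (restrict_scalars j M) = carrier M"
  "\<zero>\<^bsub>restrict_scalars j M\<^esub> = \<zero>\<^bsub>M\<^esub>"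
  "x \<oplus>\<^bsub>restrict_scalars j M\<^esub> y = x \<oplus>\<^bsub>M\<^esub> y"
  "ract (restrict_scalars j M) x t = ract M x (j t)"
  by (simp_all add: restrict_scalars_def)

lemma direct_sum_simps [simp]:
  "\<zero>\<^bsub>direct_sum I V\<^esub> = (\<lambda>i. \<zero>\<^bsub>V\<^esub>)"
  "f \<oplus>\<^bsub>direct_sum I V\<^esub> g = (\<lambda>i. f i \<oplus>\<^bsub>V\<^esub> g i)"
  "ract (direct_sum I V) f s = (\<lambda>i. ract V (f i) s)"
  by (simp_all add: direct_sum_def)

lemma carrier_direct_sum:
  "carrier (direct_sum I V) =
    {f. (\<forall>i. f i \<in> carrier V) \<and> (\<forall>i. i \<notin> I \<longrightarrow> f i = \<zero>\<^bsub>V\<^esub>) \<and> finite {i. f i \<noteq> \<zero>\<^bsub>V\<^esub>}}"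
  by (simp add: direct_sum_def)

lemma (in ring) right_module_regular: "right_module R (regular_rmodule R)"
  by (intro right_moduleI ring_axioms abelian_groupI)
    (auto simp: a_ac l_distr r_distr m_assoc intro: bexI[of _ "\<ominus> x" for x] l_neg)

lemma right_module_restrict_scalars:
  assumes "ring T" "j \<in> ring_hom T S" "right_module S M"
  shows "right_module T (restrict_scalars j M)"
proof -
  interpret right_module S M by fact
  interpret T: ring T by fact
  have "\<exists>y\<in>carrier M. y \<oplus>\<^bsub>M\<^esub> x = \<zero>\<^bsub>M\<^esub>" if "x \<in> carrier M" for x
    using that by (intro bexI[of _ "\<ominus>\<^bsub>M\<^esub> x"]) (auto simp: M.l_neg)
  then show ?thesis
    using assms(2) ring_hom_closed[OF assms(2)] ring_hom_mult[OF assms(2)] ring_hom_add[OF assms(2)]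
      ring_hom_one[OF assms(2)]
    by (intro right_moduleI abelian_groupI assms)
      (auto simp: M.a_ac ract_closed ract_add_left ract_add_right ract_mult ract_one)
qed

lemma right_module_hom_restrict_scalars:
  assumes "ring T" "j \<in> ring_hom T S" "right_module_hom S M N f"
  shows "right_module_hom T (restrict_scalars j M) (restrict_scalars j N) f"
proof -
  interpret right_module_hom S M N f by fact
  show ?thesis
    using ring_hom_closed[OF assms(2)]
    by (intro right_module_homI right_module_restrict_scalars[OF assms(1,2)])
      (auto simp: M.right_module_axioms N.right_module_axioms hom_ract)
qed

lemma right_module_direct_sum:
  assumes "right_module S V"
  shows "right_module S (direct_sum I V)"
proof -
  interpret right_module S V by fact
  show ?thesis
  proof (intro right_moduleI abelian_groupI)
    fix f g assume fg: "f \<in> carrier (direct_sum I V)" "g \<in> carrier (direct_sum I V)"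
    have "{i. f i \<oplus>\<^bsub>V\<^esub> g i \<noteq> \<zero>\<^bsub>V\<^esub>} \<subseteq> {i. f i \<noteq> \<zero>\<^bsub>V\<^esub>} \<union> {i. g i \<noteq> \<zero>\<^bsub>V\<^esub>}"
      by auto
    then show "f \<oplus>\<^bsub>direct_sum I V\<^esub> g \<in> carrier (direct_sum I V)"
      using fg by (auto simp: carrier_direct_sum elim: finite_subset)
  next
    fix f s assume f: "f \<in> carrier (direct_sum I V)" "s \<in> carrier S"
    have "{i. ract V (f i) s \<noteq> \<zero>\<^bsub>V\<^esub>} \<subseteq> {i. f i \<noteq> \<zero>\<^bsub>V\<^esub>}"
      using f by (auto simp: ract_zero_left)
    then show "ract (direct_sum I V) f s \<in> carrier (direct_sum I V)"
      using f by (auto simp: carrier_direct_sum ract_closed ract_zero_left elim: finite_subset)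
  next
    fix f assume f: "f \<in> carrier (direct_sum I V)"
    have "{i. \<ominus>\<^bsub>V\<^esub> f i \<noteq> \<zero>\<^bsub>V\<^esub>} \<subseteq> {i. f i \<noteq> \<zero>\<^bsub>V\<^esub>}"
      by auto
    then show "\<exists>g\<in>carrier (direct_sum I V). g \<oplus>\<^bsub>direct_sum I V\<^esub> f = \<zero>\<^bsub>direct_sum I V\<^esub>"
      using f by (intro bexI[of _ "\<lambda>i. \<ominus>\<^bsub>V\<^esub> f i"])
        (auto simp: carrier_direct_sum M.l_neg elim: finite_subset)
  qed (auto simp: carrier_direct_sum S.ring_axioms M.a_ac ract_add_left ract_add_right ract_mult ract_one)
qed

definition single :: "('s, 'm, 'b) rmodule_scheme \<Rightarrow> 'i \<Rightarrow> 'm \<Rightarrow> 'i \<Rightarrow> 'm"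
  where "single V i x = (\<lambda>j. if j = i then x else \<zero>\<^bsub>V\<^esub>)"

lemma (in right_module) single_closed:
  assumes "i \<in> I" "x \<in> carrier M"
  shows "single M i x \<in> carrier (direct_sum I M)"
proof -
  have "{j. single M i x j \<noteq> \<zero>\<^bsub>M\<^esub>} \<subseteq> {i}" by (auto simp: single_def)
  then show ?thesis
    using assms by (auto simp: carrier_direct_sum single_def elim: finite_subset)
qed

text \<open>Induction on the finite support: resetting one nonzero value of f to zero shrinks the
  support and splits off a \<open>single\<close>.\<close>

lemma (in right_module) direct_sum_induct [consumes 1, case_names zero single add]:
  assumes "f \<in> carrier (direct_sum I M)"
    and "P (\<lambda>i. \<zero>\<^bsub>M\<^esub>)"
    and "\<And>i x. \<lbrakk>i \<in> I; x \<in> carrier M\<rbrakk> \<Longrightarrow> P (single M i x)"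
    and "\<And>f g. \<lbrakk>f \<in> carrier (direct_sum I M); g \<in> carrier (direct_sum I M); P f; P g\<rbrakk> \<Longrightarrow>
        P (\<lambda>i. f i \<oplus>\<^bsub>M\<^esub> g i)"
  shows "P f"
proof -
  have "finite A \<Longrightarrow> \<forall>f\<in>carrier (direct_sum I M). {i. f i \<noteq> \<zero>\<^bsub>M\<^esub>} = A \<longrightarrow> P f" for A
  proof (induction A rule: finite_induct)
    case empty
    have "f = (\<lambda>i. \<zero>\<^bsub>M\<^esub>)" if "{i. f i \<noteq> \<zero>\<^bsub>M\<^esub>} = {}" for f :: "'d \<Rightarrow> 'm"
      using that by auto
    then show ?case using assms(2) by simp
  next
    case (insert a A)
    show ?case
    proof (intro ballI impI)
      fix f assume f: "f \<in> carrier (direct_sum I M)" and supp: "{i. f i \<noteq> \<zero>\<^bsub>M\<^esub>} = insert a A"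
      let ?g = "f(a := \<zero>\<^bsub>M\<^esub>)"
      have g: "{i. ?g i \<noteq> \<zero>\<^bsub>M\<^esub>} = A" using supp insert.hyps by auto
      have gc: "?g \<in> carrier (direct_sum I M)"
        using f insert.hyps unfolding carrier_direct_sum mem_Collect_eq g by auto
      have fa: "a \<in> I" "f a \<in> carrier M" using f supp by (auto simp: carrier_direct_sum)
      have "P ?g" using insert.IH gc g by blast
      then have "P (\<lambda>i. ?g i \<oplus>\<^bsub>M\<^esub> single M a (f a) i)"
        using gc fa by (intro assms(4) assms(3) single_closed)
      moreover have "(\<lambda>i. ?g i \<oplus>\<^bsub>M\<^esub> single M a (f a) i) = f"
        using f by (auto simp: carrier_direct_sum single_def)
      ultimately show "P f" by simp
    qed
  qed
  then show ?thesis
    using assms(1) by (auto simp: carrier_direct_sum)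
qed

text \<open>The homomorphism out of a direct sum with the components u i. Summing over the support
  only keeps the sum finite when I is infinite.\<close>

definition direct_sum_ext ::
  "('s, 'm, 'b) rmodule_scheme \<Rightarrow> ('s, 'n, 'c) rmodule_scheme \<Rightarrow> ('i \<Rightarrow> 'm \<Rightarrow> 'n) \<Rightarrow> ('i \<Rightarrow> 'm) \<Rightarrow> 'n"
  where "direct_sum_ext V N u f = (\<Oplus>\<^bsub>N\<^esub>i\<in>{i. f i \<noteq> \<zero>\<^bsub>V\<^esub>}. u i (f i))"

lemma direct_sum_ext_hom:
  assumes V: "right_module S V" and N: "right_module S N"
    and u: "\<And>i. i \<in> I \<Longrightarrow> right_module_hom S V N (u i)"
  shows "right_module_hom S (direct_sum I V) N (direct_sum_ext V N u)"
proof -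
  interpret V: right_module S V by fact
  interpret N: right_module S N by fact
  interpret D: right_module S "direct_sum I V" by (rule right_module_direct_sum) fact
  have closed: "u i x \<in> carrier N" if "i \<in> I" "x \<in> carrier V" for i x
  proof -
    interpret right_module_hom S V N "u i" using u that by blast
    show ?thesis using that by simp
  qed
  have zero: "u i \<zero>\<^bsub>V\<^esub> = \<zero>\<^bsub>N\<^esub>" if "i \<in> I" for i
  proof -
    interpret right_module_hom S V N "u i" using u that .
    show ?thesis by simp
  qed
  \<comment> \<open>The supports of f, g and their sum differ, so the sums are compared over one
    finite set containing them; the additional terms are u i applied to zero.\<close>
  have superset: "direct_sum_ext V N u f = (\<Oplus>\<^bsub>N\<^esub>i\<in>A. u i (f i))"
    if f: "f \<in> carrier (direct_sum I V)" and A: "finite A" "{i. f i \<noteq> \<zero>\<^bsub>V\<^esub>} \<subseteq> A" "A \<subseteq> I" for f A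
    unfolding direct_sum_ext_def
    using f A closed zero
    by (intro N.add.finprod_mono_neutral_cong_left) (auto simp: carrier_direct_sum)
  show ?thesis
  proof (rule right_module_homI)
    show "right_module S (direct_sum I V)" by (rule D.right_module_axioms)
    fix f assume f: "f \<in> carrier (direct_sum I V)"
    have fI: "i \<in> I" if "f i \<noteq> \<zero>\<^bsub>V\<^esub>" for i using f that by (auto simp: carrier_direct_sum)
    show "direct_sum_ext V N u f \<in> carrier N"
      unfolding direct_sum_ext_def using f fI
      by (intro N.finsum_closed) (auto simp: carrier_direct_sum closed)
    show "direct_sum_ext V N u (ract (direct_sum I V) f s) = ract N (direct_sum_ext V N u f) s"
      if s: "s \<in> carrier S" for s
    proof -
      interpret r: abelian_group_hom N N "\<lambda>x. ract N x s" using s by (rule N.abelian_group_hom_ract)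
      have fs: "ract (direct_sum I V) f s \<in> carrier (direct_sum I V)"
        using f s by (rule D.ract_closed)
      have "direct_sum_ext V N u (ract (direct_sum I V) f s)
          = (\<Oplus>\<^bsub>N\<^esub>i\<in>{i. f i \<noteq> \<zero>\<^bsub>V\<^esub>}. u i (ract (direct_sum I V) f s i))"
        using f fs s fI by (intro superset) (auto simp: carrier_direct_sum V.ract_zero_left)
      also have "\<dots> = (\<Oplus>\<^bsub>N\<^esub>i\<in>{i. f i \<noteq> \<zero>\<^bsub>V\<^esub>}. ract N (u i (f i)) s)"
        using f s fI right_module_hom.hom_ract[OF u]
        by (intro N.finsum_cong') (auto simp: carrier_direct_sum closed N.ract_closed)
      also have "\<dots> = ract N (direct_sum_ext V N u f) s"
        unfolding direct_sum_ext_def using f fI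
        by (intro r.hom_finsum[symmetric]) (auto simp: carrier_direct_sum closed)
      finally show ?thesis .
    qed
    fix g assume g: "g \<in> carrier (direct_sum I V)"
    let ?A = "{i. f i \<noteq> \<zero>\<^bsub>V\<^esub>} \<union> {i. g i \<noteq> \<zero>\<^bsub>V\<^esub>}"
    have A: "finite ?A" "?A \<subseteq> I" using f g by (auto simp: carrier_direct_sum)
    have fg: "f \<oplus>\<^bsub>direct_sum I V\<^esub> g \<in> carrier (direct_sum I V)"
      using f g by (rule D.a_closed)
    have "direct_sum_ext V N u (f \<oplus>\<^bsub>direct_sum I V\<^esub> g)
        = (\<Oplus>\<^bsub>N\<^esub>i\<in>?A. u i ((f \<oplus>\<^bsub>direct_sum I V\<^esub> g) i))"
      using A f g fg by (intro superset) (auto simp: carrier_direct_sum)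
    also have "\<dots> = (\<Oplus>\<^bsub>N\<^esub>i\<in>?A. u i (f i) \<oplus>\<^bsub>N\<^esub> u i (g i))"
    proof (rule N.finsum_cong')
      show "(\<lambda>i. u i (f i) \<oplus>\<^bsub>N\<^esub> u i (g i)) \<in> ?A \<rightarrow> carrier N"
        using A(2) f g closed by (auto simp: carrier_direct_sum)
      fix i assume "i \<in> ?A"
      then interpret ui: right_module_hom S V N "u i" using u A(2) by blast
      show "u i ((f \<oplus>\<^bsub>direct_sum I V\<^esub> g) i) = u i (f i) \<oplus>\<^bsub>N\<^esub> u i (g i)"
        using f g by (auto simp: carrier_direct_sum)
    qed simp
    also have "\<dots> = (\<Oplus>\<^bsub>N\<^esub>i\<in>?A. u i (f i)) \<oplus>\<^bsub>N\<^esub> (\<Oplus>\<^bsub>N\<^esub>i\<in>?A. u i (g i))"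
      using A f g by (intro N.finsum_addf) (auto simp: carrier_direct_sum closed)
    also have "\<dots> = direct_sum_ext V N u f \<oplus>\<^bsub>N\<^esub> direct_sum_ext V N u g"
      using superset[OF f A(1) _ A(2)] superset[OF g A(1) _ A(2)] by simp
    finally show "direct_sum_ext V N u (f \<oplus>\<^bsub>direct_sum I V\<^esub> g)
      = direct_sum_ext V N u f \<oplus>\<^bsub>N\<^esub> direct_sum_ext V N u g" .
  qed fact
qed

lemma direct_sum_ext_single:
  assumes "right_module_hom S V N (u i)" "x \<in> carrier V"
  shows "direct_sum_ext V N u (single V i x) = u i x"
proof -
  interpret right_module_hom S V N "u i" by fact
  show ?thesis
  proof (cases "x = \<zero>\<^bsub>V\<^esub>")
    case False
    then have "{j. single V i x j \<noteq> \<zero>\<^bsub>V\<^esub>} = {i}" by (auto simp: single_def)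
    then show ?thesis using assms(2) by (simp add: direct_sum_ext_def single_def)
  qed (simp add: direct_sum_ext_def single_def)
qed

lemma direct_sum_hom_eqI:
  assumes "right_module_hom S (direct_sum I V) N f" "right_module_hom S (direct_sum I V) N g"
    and "right_module S V"
    and "\<And>i x. \<lbrakk>i \<in> I; x \<in> carrier V\<rbrakk> \<Longrightarrow> f (single V i x) = g (single V i x)"
    and "z \<in> carrier (direct_sum I V)"
  shows "f z = g z"
proof -
  interpret f: right_module_hom S "direct_sum I V" N f by fact
  interpret g: right_module_hom S "direct_sum I V" N g by fact
  interpret V: right_module S V by fact
  from assms(5) show ?thesis
  proof (induction rule: V.direct_sum_induct)
    case zero
    then show ?case using f.ah.hom_zero g.ah.hom_zero by simp
  next
    case (add h k)
    then show ?case using f.ah.hom_add[of h k] g.ah.hom_add[of h k] by simp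
  qed (use assms in auto)
qed

section \<open>Inhomogeneous cochains\<close>

text \<open>The i-th inner face of a bar cell, with i counted from 1: the entries multiplied are the
  i-th and the next one.\<close>

definition merge :: "('g, 'b) monoid_scheme \<Rightarrow> nat \<Rightarrow> 'g list \<Rightarrow> 'g list"
  where "merge G i xs = take (i - 1) xs @ (xs ! (i - 1) \<otimes>\<^bsub>G\<^esub> xs ! i) # drop (i + 1) xs"

lemma group_ring_simps [simp]:
  "carrier (group_ring G) = {c. Poly_Mapping.keys c \<subseteq> carrier G}"
  "\<zero>\<^bsub>group_ring G\<^esub> = 0"
  "\<one>\<^bsub>group_ring G\<^esub> = frag_of \<one>\<^bsub>G\<^esub>"
  "c \<oplus>\<^bsub>group_ring G\<^esub> d = c + d"
  "frag_of g \<otimes>\<^bsub>group_ring G\<^esub> frag_of h = frag_of (g \<otimes>\<^bsub>G\<^esub> h)"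
  by (simp_all add: group_ring_def)

lemma bar_cells_0: "bar_cells G 0 = {[]}"
  by (auto simp: bar_cells_def)

lemma Nil_in_bar_cells [simp]: "[] \<in> bar_cells G k \<longleftrightarrow> k = 0"
  by (auto simp: bar_cells_def)

lemma bar_cells_append [simp]:
  "xs \<in> bar_cells G k \<Longrightarrow> xs @ [g] \<in> bar_cells G (Suc k) \<longleftrightarrow> g \<in> carrier G"
  by (auto simp: bar_cells_def)

lemma bar_cells_tl: "xs \<in> bar_cells G (Suc k) \<Longrightarrow> tl xs \<in> bar_cells G k"
  by (auto simp: bar_cells_def dest: list.set_sel(2)[rotated])

lemma bar_cells_butlast: "xs \<in> bar_cells G (Suc k) \<Longrightarrow> butlast xs \<in> bar_cells G k"
  by (auto simp: bar_cells_def dest: in_set_butlastD)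

lemma bar_cells_last: "xs \<in> bar_cells G (Suc k) \<Longrightarrow> last xs \<in> carrier G"
  by (cases xs rule: rev_cases) (auto simp: bar_cells_def)

locale group_module = G?: group G + right_module "group_ring G" M
  for G :: "('g, 'b) monoid_scheme" (structure) and M :: "('g \<Rightarrow>\<^sub>0 int, 'm, 'c) rmodule_scheme"

lemma (in group) bar_cells_merge:
  assumes "xs \<in> bar_cells G (Suc k)" "i \<in> {1..k}"
  shows "merge G i xs \<in> bar_cells G k"
proof -
  have "set xs \<subseteq> carrier G" "length xs = Suc k" using assms by (auto simp: bar_cells_def)
  then show ?thesis using assms(2) set_take_subset[of "i - 1" xs] set_drop_subset[of "i + 1" xs]
    by (auto simp: bar_cells_def merge_def subset_iff)
qed

lemma coboundary_apply:
  "xs \<in> bar_cells G (Suc k) \<Longrightarrow> coboundary G k M f xs =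
     f (tl xs) \<oplus>\<^bsub>M\<^esub> (\<Oplus>\<^bsub>M\<^esub>i\<in>{1..k}. add_pow M ((- 1 :: int) ^ i) (f (merge G i xs)))
       \<oplus>\<^bsub>M\<^esub> add_pow M ((- 1 :: int) ^ Suc k) (ract M (f (butlast xs)) (frag_of (last xs)))"
  by (simp add: coboundary_def merge_def)

lemma carrier_cochains: "carrier (cochains G k M) = bar_cells G k \<rightarrow>\<^sub>E carrier M"
  by (simp add: cochains_def)

lemma cochain_closed:
  "\<lbrakk>f \<in> carrier (cochains G k M); xs \<in> bar_cells G k\<rbrakk> \<Longrightarrow> f xs \<in> carrier M"
  unfolding carrier_cochains by (rule PiE_mem)

lemma one_cochains: "\<one>\<^bsub>cochains G k M\<^esub> = (\<lambda>xs\<in>bar_cells G k. \<zero>\<^bsub>M\<^esub>)"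
  by (simp add: cochains_def)

lemma mult_cochains:
  "c \<otimes>\<^bsub>cochains G k M\<^esub> d = (\<lambda>xs\<in>bar_cells G k. c xs \<oplus>\<^bsub>M\<^esub> d xs)"
  by (simp add: cochains_def)

lemma (in right_module) comm_group_cochains: "comm_group (cochains G k M)"
proof (rule group.group_comm_groupI)
  show "group (cochains G k M)" by (simp add: cochains_def M.a_group)
qed (auto simp: mult_cochains intro!: restrict_ext M.a_comm cochain_closed)

lemma (in right_module) inv_cochains:
  "c \<in> carrier (cochains G k M) \<Longrightarrow> inv\<^bsub>cochains G k M\<^esub> c = (\<lambda>xs\<in>bar_cells G k. \<ominus>\<^bsub>M\<^esub> c xs)"
  using inv_product_group[of c "bar_cells G k" "\<lambda>_. add_monoid M"]
  by (simp add: cochains_def M.a_group a_inv_def)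

context group_module
begin

lemma coboundary_term_closed:
  assumes "f \<in> carrier (cochains G k M)" "xs \<in> bar_cells G (Suc k)"
  shows "f (tl xs) \<in> carrier M" "i \<in> {1..k} \<Longrightarrow> f (merge G i xs) \<in> carrier M"
    "ract M (f (butlast xs)) (frag_of (last xs)) \<in> carrier M"
  using bar_cells_last[OF assms(2)]
  by (auto intro!: ract_closed cochain_closed[OF assms(1)] bar_cells_tl[OF assms(2)]
      bar_cells_butlast[OF assms(2)] bar_cells_merge[OF assms(2)])

lemma coboundary_closed:
  assumes "f \<in> carrier (cochains G k M)"
  shows "coboundary G k M f \<in> carrier (cochains G (Suc k) M)"
  unfolding carrier_cochains
proof (rule PiE_I)
  fix xs assume xs: "xs \<in> bar_cells G (Suc k)"
  then show "coboundary G k M f xs \<in> carrier M"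
    using coboundary_term_closed[OF assms xs] by (simp add: coboundary_apply Pi_def)
qed (simp add: coboundary_def)

lemma coboundary_hom: "coboundary G k M \<in> hom (cochains G k M) (cochains G (Suc k) M)"
proof (rule homI)
  fix f g assume f: "f \<in> carrier (cochains G k M)" and g: "g \<in> carrier (cochains G k M)"
  show "coboundary G k M (f \<otimes>\<^bsub>cochains G k M\<^esub> g)
      = coboundary G k M f \<otimes>\<^bsub>cochains G (Suc k) M\<^esub> coboundary G k M g" (is "?l = ?r")
  proof
    fix xs
    show "?l xs = ?r xs"
    proof (cases "xs \<in> bar_cells G (Suc k)")
      case xs: True
      note cf = coboundary_term_closed[OF f xs] and cg = coboundary_term_closed[OF g xs]
      let ?e = "(- 1 :: int)"
      have m: "(f \<otimes>\<^bsub>cochains G k M\<^esub> g) ys = f ys \<oplus>\<^bsub>M\<^esub> g ys" if "ys \<in> bar_cells G k" for ys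
        using that by (simp add: mult_cochains)
      have sum: "(\<Oplus>\<^bsub>M\<^esub>i\<in>{1..k}. add_pow M (?e ^ i) ((f \<otimes>\<^bsub>cochains G k M\<^esub> g) (merge G i xs)))
          = (\<Oplus>\<^bsub>M\<^esub>i\<in>{1..k}. add_pow M (?e ^ i) (f (merge G i xs)))
            \<oplus>\<^bsub>M\<^esub> (\<Oplus>\<^bsub>M\<^esub>i\<in>{1..k}. add_pow M (?e ^ i) (g (merge G i xs)))"
      proof -
        have "(\<Oplus>\<^bsub>M\<^esub>i\<in>{1..k}. add_pow M (?e ^ i) ((f \<otimes>\<^bsub>cochains G k M\<^esub> g) (merge G i xs)))
            = (\<Oplus>\<^bsub>M\<^esub>i\<in>{1..k}. add_pow M (?e ^ i) (f (merge G i xs)) \<oplus>\<^bsub>M\<^esub> add_pow M (?e ^ i) (g (merge G i xs)))"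
          using cf(2) cg(2)
          by (intro M.finsum_cong') (auto simp: m[OF bar_cells_merge[OF xs]] M.add.int_pow_distrib)
        then show ?thesis using cf(2) cg(2) by (simp add: M.finsum_addf Pi_def)
      qed
      have last: "ract M (f (butlast xs) \<oplus>\<^bsub>M\<^esub> g (butlast xs)) (frag_of (last xs))
          = ract M (f (butlast xs)) (frag_of (last xs)) \<oplus>\<^bsub>M\<^esub> ract M (g (butlast xs)) (frag_of (last xs))"
        using bar_cells_last[OF xs]
        by (auto intro!: ract_add_left cochain_closed[OF f] cochain_closed[OF g] bar_cells_butlast[OF xs])
      have fin: "(\<Oplus>\<^bsub>M\<^esub>i\<in>{1..k}. add_pow M (?e ^ i) (f (merge G i xs))) \<in> carrier M"
        "(\<Oplus>\<^bsub>M\<^esub>i\<in>{1..k}. add_pow M (?e ^ i) (g (merge G i xs))) \<in> carrier M"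
        using cf cg by (auto simp: Pi_def)
      have r: "?r xs = coboundary G k M f xs \<oplus>\<^bsub>M\<^esub> coboundary G k M g xs"
        using xs by (simp add: mult_cochains)
      show ?thesis
        unfolding r coboundary_apply[OF xs] sum m[OF bar_cells_tl[OF xs]] m[OF bar_cells_butlast[OF xs]] last
        using cf(1,3) cg(1,3) fin by (simp add: M.a_ac M.add.int_pow_distrib)
    qed (simp_all add: coboundary_def mult_cochains)
  qed
qed (rule coboundary_closed)

lemma group_hom_coboundary:
  "group_hom (cochains G k M) (cochains G (Suc k) M) (coboundary G k M)"
  by (simp add: group_hom_def group_hom_axioms_def coboundary_hom
      comm_group.axioms(2)[OF comm_group_cochains])

end

lemma compose_cochain_closed:
  assumes "right_module_hom S M N h" "f \<in> carrier (cochains G k M)"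
  shows "compose (bar_cells G k) h f \<in> carrier (cochains G k N)"
proof -
  interpret right_module_hom S M N h by fact
  show ?thesis using cochain_closed[OF assms(2)] by (auto simp: carrier_cochains compose_def)
qed

text \<open>Every term of the coboundary is built from additions and the action, so it commutes with
  a module homomorphism. Besides making cohomology functorial, this carries facts about one
  universal cochain over to all cochains, see \<open>linear_ext_bd\<close>.\<close>

lemma coboundary_compose:
  assumes "group G" "right_module_hom (group_ring G) M N h" "f \<in> carrier (cochains G k M)"
  shows "coboundary G k N (compose (bar_cells G k) h f)
    = compose (bar_cells G (Suc k)) h (coboundary G k M f)"
proof
  fix xs
  interpret right_module_hom "group_ring G" M N h by fact
  interpret G: group G by fact
  interpret M: group_module G M by unfold_locales
  show "coboundary G k N (compose (bar_cells G k) h f) xs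
      = compose (bar_cells G (Suc k)) h (coboundary G k M f) xs"
  proof (cases "xs \<in> bar_cells G (Suc k)")
    case xs: True
    note c = M.coboundary_term_closed[OF assms(3) xs]
    have "(\<Oplus>\<^bsub>N\<^esub>i\<in>{1..k}. add_pow N ((- 1 :: int) ^ i) (compose (bar_cells G k) h f (merge G i xs)))
        = (\<Oplus>\<^bsub>N\<^esub>i\<in>{1..k}. h (add_pow M ((- 1 :: int) ^ i) (f (merge G i xs))))"
      using c(2) xs
      by (intro N.finsum_cong') (auto simp: ah.hom_add_pow compose_eq[OF G.bar_cells_merge[OF xs]])
    also have "\<dots> = h (\<Oplus>\<^bsub>M\<^esub>i\<in>{1..k}. add_pow M ((- 1 :: int) ^ i) (f (merge G i xs)))"
      using c(2) by (intro ah.hom_finsum[symmetric]) auto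
    finally have sum: "(\<Oplus>\<^bsub>N\<^esub>i\<in>{1..k}. add_pow N ((- 1 :: int) ^ i) (compose (bar_cells G k) h f (merge G i xs))) = \<dots>" .
    have fb: "f (butlast xs) \<in> carrier M" "frag_of (last xs) \<in> carrier (group_ring G)"
      using bar_cells_last[OF xs] cochain_closed[OF assms(3) bar_cells_butlast[OF xs]] by auto
    have fin: "(\<Oplus>\<^bsub>M\<^esub>i\<in>{1..k}. add_pow M ((- 1 :: int) ^ i) (f (merge G i xs))) \<in> carrier M"
      using c by auto
    have r: "compose (bar_cells G (Suc k)) h (coboundary G k M f) xs = h (coboundary G k M f xs)"
      using xs by (simp add: compose_eq)
    show ?thesis
      unfolding r coboundary_apply[OF xs] sum compose_eq[OF bar_cells_tl[OF xs]]
        compose_eq[OF bar_cells_butlast[OF xs]] hom_ract[OF fb, symmetric]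
      using c(1,3) fin by (simp add: ah.hom_add_pow)
  qed (simp add: coboundary_def compose_def)
qed


text \<open>The integral bar complex is the instance of \<open>group_ring_extension\<close> at the
  identity, which wraps the coefficients in \<open>restrict_scalars\<close>. Naturality for the
  identity map removes the wrapping.\<close>

lemma (in group_module) coboundary_restrict_id:
  assumes "f \<in> carrier (cochains G k M)"
  shows "coboundary G k (restrict_scalars (\<lambda>c. c) M) f = coboundary G k M f"
proof -
  have "right_module_hom (group_ring G) M (restrict_scalars (\<lambda>c. c) M) (\<lambda>x. x)"
    by (intro right_module_homI right_module_restrict_scalars[OF S.ring_axioms _ right_module_axioms]
        right_module_axioms) (auto simp: ring_hom_def)
  from coboundary_compose[OF group_axioms this assms]
  have "coboundary G k (restrict_scalars (\<lambda>c. c) M) (restrict f (bar_cells G k))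
      = restrict (coboundary G k M f) (bar_cells G (Suc k))"
    by (simp add: compose_def restrict_def cong: if_cong)
  moreover have "restrict f (bar_cells G k) = f"
    using assms by (simp add: carrier_cochains PiE_restrict)
  moreover have "restrict (coboundary G k M f) (bar_cells G (Suc k)) = coboundary G k M f"
    using coboundary_closed[OF assms] by (simp add: carrier_cochains PiE_restrict)
  ultimately show ?thesis by simp
qed

section \<open>The bar resolution over an extension of the group ring\<close>

definition free_rmodule :: "('s, 'a) ring_scheme \<Rightarrow> 'i set \<Rightarrow> ('s, 'i \<Rightarrow> 's) rmodule"
  where "free_rmodule S I = direct_sum I (regular_rmodule S)"

definition basis :: "('s, 'a) ring_scheme \<Rightarrow> 'i \<Rightarrow> 'i \<Rightarrow> 's"
  where "basis S i = single (regular_rmodule S) i \<one>\<^bsub>S\<^esub>"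

definition linear_ext ::
  "('s, 'a) ring_scheme \<Rightarrow> ('s, 'm, 'b) rmodule_scheme \<Rightarrow> ('i \<Rightarrow> 'm) \<Rightarrow> ('i \<Rightarrow> 's) \<Rightarrow> 'm"
  where "linear_ext S M c = direct_sum_ext (regular_rmodule S) M (\<lambda>i. ract M (c i))"

lemma (in ring) right_module_free: "right_module R (free_rmodule R I)"
  unfolding free_rmodule_def by (intro right_module_direct_sum right_module_regular)

lemma (in ring) basis_closed: "i \<in> I \<Longrightarrow> basis R i \<in> carrier (free_rmodule R I)"
  unfolding free_rmodule_def basis_def
  by (intro right_module.single_closed[OF right_module_regular]) auto

lemma (in ring) single_eq_ract_basis:
  "s \<in> carrier R \<Longrightarrow> single (regular_rmodule R) i s = ract (free_rmodule R I) (basis R i) s"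
  by (auto simp: free_rmodule_def basis_def single_def)

lemma (in right_module) right_module_hom_ract:
  "x \<in> carrier M \<Longrightarrow> right_module_hom S (regular_rmodule S) M (ract M x)"
  by (intro right_module_homI S.right_module_regular right_module_axioms)
    (auto simp: ract_closed ract_add_right ract_mult)

lemma (in right_module) linear_ext_hom:
  "(\<And>i. i \<in> I \<Longrightarrow> c i \<in> carrier M) \<Longrightarrow> right_module_hom S (free_rmodule S I) M (linear_ext S M c)"
  unfolding free_rmodule_def linear_ext_def
  by (intro direct_sum_ext_hom S.right_module_regular right_module_axioms right_module_hom_ract)

lemma (in right_module) linear_ext_basis: "c i \<in> carrier M \<Longrightarrow> linear_ext S M c (basis S i) = c i"
  using direct_sum_ext_single[where u = "\<lambda>i. ract M (c i)", OF right_module_hom_ract, of i "\<one>\<^bsub>S\<^esub>"]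
  by (simp add: linear_ext_def basis_def ract_one)

lemma (in right_module) linear_ext_cochain:
  "\<lbrakk>c \<in> carrier (cochains G k M); xs \<in> bar_cells G k\<rbrakk> \<Longrightarrow> linear_ext S M c (basis S xs) = c xs"
  by (intro linear_ext_basis cochain_closed)

lemma free_rmodule_hom_eqI:
  assumes "right_module_hom S (free_rmodule S I) N f" "right_module_hom S (free_rmodule S I) N g"
    and "\<And>i. i \<in> I \<Longrightarrow> f (basis S i) = g (basis S i)"
    and "z \<in> carrier (free_rmodule S I)"
  shows "f z = g z"
proof -
  interpret f: right_module_hom S "free_rmodule S I" N f by fact
  interpret g: right_module_hom S "free_rmodule S I" N g by fact
  show ?thesis
  proof (rule direct_sum_hom_eqI[where I = I, OF _ _ f.M.S.right_module_regular])
    fix i s assume "i \<in> I" "s \<in> carrier (regular_rmodule S)"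
    then show "f (single (regular_rmodule S) i s) = g (single (regular_rmodule S) i s)"
      using assms(3)[of i] f.M.S.basis_closed[of i I]
      by (simp add: f.M.S.single_eq_ract_basis[of s _ I] f.hom_ract g.hom_ract)
  qed (use assms in \<open>auto simp: free_rmodule_def\<close>)
qed

lemma right_module_hom_zero:
  assumes "right_module S M" "right_module S N"
  shows "right_module_hom S M N (\<lambda>_. \<zero>\<^bsub>N\<^esub>)"
proof -
  interpret N: right_module S N by fact
  show ?thesis using assms by (intro right_module_homI) (auto simp: N.ract_zero_left)
qed

lemma right_module_hom_id: "right_module S M \<Longrightarrow> right_module_hom S M M (\<lambda>x. x)"
  by (intro right_module_homI) auto

text \<open>The universal cochain. Cochains with values in M correspond to homomorphisms from the
  free module on the bar cells to M, and this cochain corresponds to the identity of the free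
  module.\<close>

definition basis_cochain :: "('g, 'b) monoid_scheme \<Rightarrow> ('s, 'a) ring_scheme \<Rightarrow> nat \<Rightarrow> 'g list \<Rightarrow> 'g list \<Rightarrow> 's"
  where "basis_cochain G S k = (\<lambda>xs\<in>bar_cells G k. basis S xs)"

text \<open>As in the Yoneda lemma, the boundary is the coboundary of the universal cochain,
  extended linearly. So the bar complex needs no formula of its own, and its relation to
  \<open>coboundary\<close> follows from naturality.\<close>

definition bar_boundary ::
  "('g, 'b) monoid_scheme \<Rightarrow> ('s, 'a) ring_scheme \<Rightarrow> (('g \<Rightarrow>\<^sub>0 int) \<Rightarrow> 's) \<Rightarrow> nat \<Rightarrow> ('g list \<Rightarrow> 's) \<Rightarrow> 'g list \<Rightarrow> 's"
  where "bar_boundary G S j k =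
    linear_ext S (free_rmodule S (bar_cells G k))
      (coboundary G k (restrict_scalars j (free_rmodule S (bar_cells G k))) (basis_cochain G S k))"

text \<open>Used twice: with S the group ring and j the identity, where \<open>P\<close> is the bar
  resolution, and with S = R and j = \<iota>, where \<open>P\<close> is its base change.\<close>

locale group_ring_extension = G?: group G + ZG: ring "group_ring G" + S: ring S
  for G :: "('g, 'b) monoid_scheme" (structure) and S :: "('s, 'a) ring_scheme"
    and j :: "('g \<Rightarrow>\<^sub>0 int) \<Rightarrow> 's" +
  assumes j_hom: "j \<in> ring_hom (group_ring G) S"
begin

abbreviation P :: "nat \<Rightarrow> ('s, 'g list \<Rightarrow> 's) rmodule"
  where "P k \<equiv> free_rmodule S (bar_cells G k)"

abbreviation bd :: "nat \<Rightarrow> ('g list \<Rightarrow> 's) \<Rightarrow> 'g list \<Rightarrow> 's"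
  where "bd \<equiv> bar_boundary G S j"

lemma restrict_module:
  assumes "right_module S M" shows "group_module G (restrict_scalars j M)"
proof -
  interpret right_module "group_ring G" "restrict_scalars j M"
    by (intro right_module_restrict_scalars[OF _ j_hom] ZG.ring_axioms assms)
  show ?thesis by unfold_locales
qed

lemma restrict_hom:
  "right_module_hom S M N f \<Longrightarrow>
    right_module_hom (group_ring G) (restrict_scalars j M) (restrict_scalars j N) f"
  by (intro right_module_hom_restrict_scalars[OF _ j_hom] ZG.ring_axioms)

lemma coboundary_restrict_closed:
  "\<lbrakk>right_module S M; c \<in> carrier (cochains G k M)\<rbrakk> \<Longrightarrow>
    coboundary G k (restrict_scalars j M) c \<in> carrier (cochains G (Suc k) M)"
  using group_module.coboundary_closed[OF restrict_module, of M c k] by (simp add: carrier_cochains)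

lemma basis_cochain_closed: "basis_cochain G S k \<in> carrier (cochains G k (P k))"
  by (simp add: carrier_cochains basis_cochain_def S.basis_closed)

lemma coboundary_basis_closed:
  "coboundary G k (restrict_scalars j (P k)) (basis_cochain G S k) \<in> carrier (cochains G (Suc k) (P k))"
  using coboundary_restrict_closed[OF S.right_module_free basis_cochain_closed] .

lemma bd_hom: "right_module_hom S (P (Suc k)) (P k) (bd k)"
  unfolding bar_boundary_def
  by (intro right_module.linear_ext_hom S.right_module_free cochain_closed[OF coboundary_basis_closed])

lemma bd_closed: "z \<in> carrier (P (Suc k)) \<Longrightarrow> bd k z \<in> carrier (P k)"
proof -
  interpret right_module_hom S "P (Suc k)" "P k" "bd k" by (rule bd_hom)
  show "z \<in> carrier (P (Suc k)) \<Longrightarrow> bd k z \<in> carrier (P k)" by simp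
qed

lemma bd_basis:
  "xs \<in> bar_cells G (Suc k) \<Longrightarrow>
    bd k (basis S xs) = coboundary G k (restrict_scalars j (P k)) (basis_cochain G S k) xs"
  unfolding bar_boundary_def
  by (intro right_module.linear_ext_basis S.right_module_free cochain_closed[OF coboundary_basis_closed])

text \<open>\<open>linear_ext\<close> of c carries the universal cochain to c, hence by naturality
  the coboundary of the universal cochain to that of c. Thus composing with \<open>bd\<close> on
  homomorphisms is \<open>coboundary\<close> on cochains.\<close>

lemma linear_ext_bd:
  assumes M: "right_module S M" and c: "c \<in> carrier (cochains G k M)" and z: "z \<in> carrier (P (Suc k))"
  shows "linear_ext S M c (bd k z) = linear_ext S M (coboundary G k (restrict_scalars j M) c) z"
proof -
  interpret M: right_module S M by fact
  interpret l: right_module_hom S "P k" M "linear_ext S M c"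
    by (intro M.linear_ext_hom cochain_closed[OF c])
  have dc: "coboundary G k (restrict_scalars j M) c \<in> carrier (cochains G (Suc k) M)"
    by (rule coboundary_restrict_closed[OF M c])
  have "compose (bar_cells G k) (linear_ext S M c) (basis_cochain G S k) = c"
  proof
    fix xs
    show "compose (bar_cells G k) (linear_ext S M c) (basis_cochain G S k) xs = c xs"
    proof (cases "xs \<in> bar_cells G k")
      case True
      then show ?thesis
        by (simp add: compose_eq basis_cochain_def M.linear_ext_cochain[OF c])
    next
      case False
      then show ?thesis
        using c PiE_arb[of c "bar_cells G k" _ xs] by (simp add: compose_def carrier_cochains)
    qed
  qed
  then have eq: "coboundary G k (restrict_scalars j M) c =
      compose (bar_cells G (Suc k)) (linear_ext S M c)
        (coboundary G k (restrict_scalars j (P k)) (basis_cochain G S k))"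
    using coboundary_compose[OF G.group_axioms restrict_hom[OF l.right_module_hom_axioms],
        of "basis_cochain G S k" k] basis_cochain_closed[of k]
    by (simp add: carrier_cochains)
  show ?thesis
  proof (rule free_rmodule_hom_eqI[OF right_module_hom_comp[OF bd_hom l.right_module_hom_axioms] _ _ z])
    show "right_module_hom S (P (Suc k)) M (linear_ext S M (coboundary G k (restrict_scalars j M) c))"
      by (intro M.linear_ext_hom cochain_closed[OF dc])
    fix xs assume xs: "xs \<in> bar_cells G (Suc k)"
    show "linear_ext S M c (bd k (basis S xs))
        = linear_ext S M (coboundary G k (restrict_scalars j M) c) (basis S xs)"
      using M.linear_ext_cochain[OF dc xs] xs
      by (simp add: bd_basis eq compose_eq)
  qed
qed

end

section \<open>Exactness of the integral bar resolution\<close>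

definition augmentation :: "('g \<Rightarrow>\<^sub>0 int) \<Rightarrow> int"
  where "augmentation c = (\<Sum>g\<in>Poly_Mapping.keys c. Poly_Mapping.lookup c g)"

lemma augmentation_superset:
  "\<lbrakk>finite A; Poly_Mapping.keys c \<subseteq> A\<rbrakk> \<Longrightarrow> augmentation c = (\<Sum>g\<in>A. Poly_Mapping.lookup c g)"
  unfolding augmentation_def by (rule sum.mono_neutral_left) (auto simp: in_keys_iff)

lemma augmentation_simps [simp]:
  "augmentation 0 = 0" "augmentation (frag_of g) = 1" "augmentation (- c) = - augmentation c"
  by (simp_all add: augmentation_def sum_negf)

lemma augmentation_add [simp]: "augmentation (c + d) = augmentation c + augmentation d"
proof -
  let ?A = "Poly_Mapping.keys c \<union> Poly_Mapping.keys d"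
  have "augmentation (c + d) = (\<Sum>g\<in>?A. Poly_Mapping.lookup (c + d) g)"
    by (rule augmentation_superset) (auto dest: subsetD[OF Poly_Mapping.keys_add])
  also have "\<dots> = (\<Sum>g\<in>?A. Poly_Mapping.lookup c g) + (\<Sum>g\<in>?A. Poly_Mapping.lookup d g)"
    by (simp add: lookup_add sum.distrib)
  also have "\<dots> = augmentation c + augmentation d"
    by (simp add: augmentation_superset[symmetric])
  finally show ?thesis .
qed

lemma augmentation_diff [simp]: "augmentation (c - d) = augmentation c - augmentation d"
  using augmentation_add[of c "- d"] by simp

lemma merge_append:
  "\<lbrakk>length xs = k; 1 \<le> i; i < k\<rbrakk> \<Longrightarrow> merge G i (xs @ [g]) = merge G i xs @ [g]"
  by (auto simp: merge_def nth_append)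

lemma merge_append_last:
  "\<lbrakk>length xs = k; 1 \<le> k\<rbrakk> \<Longrightarrow> merge G k (xs @ [g]) = butlast xs @ [last xs \<otimes>\<^bsub>G\<^esub> g]"
  by (cases xs rule: rev_cases) (auto simp: merge_def nth_append)

locale integral_bar = G?: group G + ZG: ring "group_ring G" for G :: "('g, 'b) monoid_scheme" (structure)

sublocale integral_bar \<subseteq> group_ring_extension G "group_ring G" "\<lambda>c. c"
  by unfold_locales (auto simp: ring_hom_def)

context integral_bar
begin

lemma add_B [simp]: "b \<oplus>\<^bsub>P k\<^esub> c = (\<lambda>xs. b xs + c xs)"
  by (simp add: free_rmodule_def)

lemma zero_B [simp]: "\<zero>\<^bsub>P k\<^esub> = (\<lambda>xs. 0)"
  by (simp add: free_rmodule_def)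

lemma carrier_B:
  "carrier (P k) = {b. (\<forall>xs. Poly_Mapping.keys (b xs) \<subseteq> carrier G) \<and> (\<forall>xs. xs \<notin> bar_cells G k \<longrightarrow> b xs = 0)
    \<and> finite {xs. b xs \<noteq> 0}}"
  by (simp add: free_rmodule_def carrier_direct_sum)

lemma right_module_P: "right_module (group_ring G) (P k)"
  by (rule ZG.right_module_free)

lemma basis_B: "basis (group_ring G) xs = (\<lambda>ys. if ys = xs then frag_of \<one> else 0)"
  unfolding basis_def single_def regular_rmodule_simps group_ring_simps ..

lemma ract_basis_B:
  "g \<in> carrier G \<Longrightarrow>
    ract (P k) (basis (group_ring G) xs) (frag_of g) = (\<lambda>ys. if ys = xs then frag_of g else 0)"
  using ZG.single_eq_ract_basis[of "frag_of g" xs "bar_cells G k"]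
  unfolding single_def regular_rmodule_simps group_ring_simps by simp

lemma minus_B: "\<lbrakk>b \<in> carrier (P k); c \<in> carrier (P k)\<rbrakk> \<Longrightarrow> b \<ominus>\<^bsub>P k\<^esub> c = (\<lambda>xs. b xs - c xs)"
proof -
  assume b: "b \<in> carrier (P k)" and c: "c \<in> carrier (P k)"
  interpret right_module "group_ring G" "P k" by (rule right_module_P)
  have "(\<lambda>xs. - c xs) \<in> carrier (P k)" using c by (simp add: carrier_B)
  then have "\<ominus>\<^bsub>P k\<^esub> c = (\<lambda>xs. - c xs)"
    using c by (intro M.minus_equality) auto
  then show ?thesis by (simp add: a_minus_def)
qed

text \<open>The additive contraction sending the generator \<open>[g\<^sub>1|...|g\<^sub>k]g\<close> to \<open>[g\<^sub>1|...|g\<^sub>k|g]\<close>. The usual sign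
  \<open>(-1)\<^sup>k\<^sup>+\<^sup>1\<close> is left out; it reappears in \<open>boundary_contraction\<close>.\<close>

definition contraction :: "nat \<Rightarrow> ('g list \<Rightarrow> 'g \<Rightarrow>\<^sub>0 int) \<Rightarrow> 'g list \<Rightarrow> 'g \<Rightarrow>\<^sub>0 int"
  where "contraction k b =
    (\<lambda>ys. if ys \<in> bar_cells G (Suc k)
          then frag_cmul (Poly_Mapping.lookup (b (butlast ys)) (last ys)) (frag_of \<one>) else 0)"

lemma contraction_closed:
  assumes "b \<in> carrier (P k)" shows "contraction k b \<in> carrier (P (Suc k))"
proof -
  have "{ys. contraction k b ys \<noteq> 0}
      \<subseteq> (\<Union>xs\<in>{xs. b xs \<noteq> 0}. (\<lambda>g. xs @ [g]) ` Poly_Mapping.keys (b xs))"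
  proof
    fix ys assume "ys \<in> {ys. contraction k b ys \<noteq> 0}"
    then have ys: "ys \<in> bar_cells G (Suc k)" "Poly_Mapping.lookup (b (butlast ys)) (last ys) \<noteq> 0"
      by (auto simp: contraction_def split: if_splits)
    then have "ys = butlast ys @ [last ys]"
      by (metis Nil_in_bar_cells append_butlast_last_id nat.distinct(1))
    moreover have "last ys \<in> Poly_Mapping.keys (b (butlast ys))" "b (butlast ys) \<noteq> 0"
      using ys(2) by (auto simp: in_keys_iff)
    ultimately show "ys \<in> (\<Union>xs\<in>{xs. b xs \<noteq> 0}. (\<lambda>g. xs @ [g]) ` Poly_Mapping.keys (b xs))"
      by blast
  qed
  moreover have "finite \<dots>" using assms by (auto simp: carrier_B)
  ultimately have "finite {ys. contraction k b ys \<noteq> 0}" by (rule finite_subset)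
  then show ?thesis
    by (auto simp: carrier_B contraction_def dest!: subsetD[OF keys_cmul])
qed

lemma contraction_hom: "abelian_group_hom (P k) (P (Suc k)) (contraction k)"
proof -
  interpret A: right_module "group_ring G" "P k" by (rule right_module_P)
  interpret B: right_module "group_ring G" "P (Suc k)" by (rule right_module_P)
  show ?thesis
    by (intro abelian_group_homI' A.M.abelian_group_axioms B.M.abelian_group_axioms contraction_closed)
      (auto simp: contraction_def lookup_add frag_cmul_distrib fun_eq_iff)
qed

lemma contraction_single:
  assumes "xs \<in> bar_cells G k" "g \<in> carrier G"
  shows "contraction k (ract (P k) (basis (group_ring G) xs) (frag_of g)) = basis (group_ring G) (xs @ [g])"
proof
  fix ys
  show "contraction k (ract (P k) (basis (group_ring G) xs) (frag_of g)) ys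
      = basis (group_ring G) (xs @ [g]) ys"
    unfolding ract_basis_B[OF assms(2)] unfolding basis_B using assms
    by (cases ys rule: rev_cases) (auto simp: contraction_def bar_cells_def lookup_single when_def)
qed

text \<open>Additively \<open>P k\<close> is free on the elements [xs]g. The contraction is additive
  but not linear over the group ring, so statements about it must be checked on these elements and
  not only on the basis. The step is for differences because coefficients may be negative.\<close>

lemma P_induct [consumes 1, case_names zero generator minus]:
  assumes "b \<in> carrier (P k)"
    and "Q (\<lambda>_. 0)"
    and "\<And>xs g. \<lbrakk>xs \<in> bar_cells G k; g \<in> carrier G\<rbrakk> \<Longrightarrow> Q (ract (P k) (basis (group_ring G) xs) (frag_of g))"
    and "\<And>b c. \<lbrakk>b \<in> carrier (P k); c \<in> carrier (P k); Q b; Q c\<rbrakk> \<Longrightarrow> Q (b \<ominus>\<^bsub>P k\<^esub> c)"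
  shows "Q b"
proof -
  interpret right_module "group_ring G" "P k" by (rule right_module_P)
  have Q_add: "Q (\<lambda>xs. b xs + c xs)" if "b \<in> carrier (P k)" "c \<in> carrier (P k)" "Q b" "Q c" for b c
  proof -
    have z: "(\<lambda>_. 0) \<in> carrier (P k)" using M.zero_closed by simp
    have n: "(\<lambda>_. 0) \<ominus>\<^bsub>P k\<^esub> c \<in> carrier (P k)" using z that by simp
    have "Q (b \<ominus>\<^bsub>P k\<^esub> ((\<lambda>_. 0) \<ominus>\<^bsub>P k\<^esub> c))"
      using that by (intro assms(4)[OF that(1) n that(3)] assms(4)[OF z that(2) assms(2)])
    then show ?thesis unfolding minus_B[OF that(1) n] unfolding minus_B[OF z that(2)] by simp
  qed
  interpret R: right_module "group_ring G" "regular_rmodule (group_ring G)"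
    by (rule ZG.right_module_regular)
  have "b \<in> carrier (direct_sum (bar_cells G k) (regular_rmodule (group_ring G)))"
    using assms(1) by (simp add: free_rmodule_def)
  then show ?thesis
  proof (induction rule: R.direct_sum_induct)
    case (single xs c)
    have "Poly_Mapping.keys c \<subseteq> carrier G" using single by simp
    then have "Poly_Mapping.keys c \<subseteq> carrier G \<and> Q (single (regular_rmodule (group_ring G)) xs c)"
    proof (induction c rule: frag_induction)
      case zero
      then show ?case
        using assms(2) unfolding single_def regular_rmodule_simps group_ring_simps by simp
    next
      case (one g)
      then show ?case
        using assms(3)[OF single(1) one] ZG.single_eq_ract_basis[of "frag_of g" xs "bar_cells G k"] by simp
    next
      case (diff a c)
      then have ac: "single (regular_rmodule (group_ring G)) xs a \<in> carrier (P k)"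
        "single (regular_rmodule (group_ring G)) xs c \<in> carrier (P k)"
        using single(1) unfolding free_rmodule_def by (auto intro!: R.single_closed)
      have "single (regular_rmodule (group_ring G)) xs (a - c) =
          single (regular_rmodule (group_ring G)) xs a \<ominus>\<^bsub>P k\<^esub> single (regular_rmodule (group_ring G)) xs c"
        unfolding minus_B[OF ac] by (auto simp: single_def)
      then show ?case
        using diff assms(4)[OF ac] by (auto dest: subsetD[OF keys_diff])
    qed
    then show ?case ..
  qed (use assms(2) Q_add in \<open>auto simp: free_rmodule_def\<close>)
qed

lemma group_module_P: "group_module G (P k)"
  unfolding group_module_def using right_module_P G.group_axioms by blast

lemma boundary_basis:
  "xs \<in> bar_cells G (Suc k) \<Longrightarrow>
    bd k (basis (group_ring G) xs) = coboundary G k (P k) (basis_cochain G (group_ring G) k) xs"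
  using group_module.coboundary_restrict_id[OF group_module_P basis_cochain_closed] by (simp add: bd_basis)

text \<open>The contraction of [xs]g is [xs|g]. Its faces, except the last, are the faces of xs with
  g appended, where the last face of xs, which carries the coefficient \<open>last xs\<close>,
  becomes the cell ending in the product of \<open>last xs\<close> and g. These make up the
  contraction of the boundary of [xs]g. The last face of [xs|g] is [xs]g itself, with sign
  (-1)^(k+2).\<close>

lemma boundary_contraction_generator:
  assumes xs: "xs \<in> bar_cells G (Suc k)" and g: "g \<in> carrier G"
  defines "b \<equiv> ract (P (Suc k)) (basis (group_ring G) xs) (frag_of g)"
  shows "bd (Suc k) (contraction (Suc k) b)
    = contraction k (bd k b) \<oplus>\<^bsub>P (Suc k)\<^esub> add_pow (P (Suc k)) ((- 1 :: int) ^ k) b"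
proof -
  let ?n = "Suc k"
  let ?e = "- 1 :: int"
  let ?B = "\<lambda>ys. basis (group_ring G) ys"
  interpret Q: group_module G "P k" by (rule group_module_P)
  interpret Qn: group_module G "P ?n" by (rule group_module_P)
  have g': "frag_of g \<in> carrier (group_ring G)" using g by simp
  \<comment> \<open>\<open>T\<close> appends g to a cell: it sends [ys] to [ys|g]. It is only
    additive.\<close>
  define T where "T = (\<lambda>y. contraction k (ract (P k) y (frag_of g)))"
  interpret T: abelian_group_hom "P k" "P ?n" T
    unfolding T_def
    by (intro abelian_group_hom_comp[OF Q.abelian_group_hom_ract contraction_hom] g')
  interpret bd: right_module_hom "group_ring G" "P ?n" "P k" "bd k" by (rule bd_hom)
  have T_basis: "T (?B ys) = ?B (ys @ [g])" if "ys \<in> bar_cells G k" for ys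
    unfolding T_def using that g by (rule contraction_single)
  have bl: "butlast xs \<in> bar_cells G k" "last xs \<in> carrier G" "tl xs \<in> bar_cells G k"
    using xs by (simp_all add: bar_cells_butlast bar_cells_last bar_cells_tl)
  have mg: "merge G i xs \<in> bar_cells G k" if "i \<in> {1..k}" for i
    using bar_cells_merge[OF xs that] .
  have len: "length xs = ?n" using xs by (simp add: bar_cells_def)
  then have ne: "xs \<noteq> []" by auto
  have xsg: "xs @ [g] \<in> bar_cells G (Suc ?n)" using xs g by simp
  have tlB: "?B (tl xs @ [g]) \<in> carrier (P ?n)" using bl g by (intro ZG.basis_closed) simp
  have mB: "?B (merge G i xs @ [g]) \<in> carrier (P ?n)" if "i \<in> {1..k}" for i
    using mg[OF that] g by (intro ZG.basis_closed) simp
  have lB: "?B (butlast xs @ [last xs \<otimes> g]) \<in> carrier (P ?n)" using bl g by (intro ZG.basis_closed) simp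
  have bB: "b \<in> carrier (P ?n)" unfolding b_def using xs g' by (intro Qn.ract_closed ZG.basis_closed)
  have T_last: "T (ract (P k) (?B (butlast xs)) (frag_of (last xs))) = ?B (butlast xs @ [last xs \<otimes> g])"
  proof -
    have "ract (P k) (ract (P k) (?B (butlast xs)) (frag_of (last xs))) (frag_of g)
        = ract (P k) (?B (butlast xs)) (frag_of (last xs \<otimes> g))"
      using bl g by (subst Q.ract_mult[symmetric]) (auto intro: ZG.basis_closed)
    then show ?thesis unfolding T_def using bl g by (simp only: contraction_single G.m_closed)
  qed
  have lhs: "bd ?n (contraction ?n b) = ?B (tl xs @ [g]) \<oplus>\<^bsub>P ?n\<^esub>
      (\<Oplus>\<^bsub>P ?n\<^esub>i\<in>{1..?n}. add_pow (P ?n) (?e ^ i) (basis_cochain G (group_ring G) ?n (merge G i (xs @ [g]))))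
      \<oplus>\<^bsub>P ?n\<^esub> add_pow (P ?n) (?e ^ Suc ?n) b"
    using xs g xsg bl ne
    unfolding b_def contraction_single[OF xs g] boundary_basis[OF xsg] coboundary_apply[OF xsg]
    by (simp add: basis_cochain_def tl_append_if del: add_B power_Suc)
  have sum: "(\<Oplus>\<^bsub>P ?n\<^esub>i\<in>{1..?n}. add_pow (P ?n) (?e ^ i) (basis_cochain G (group_ring G) ?n (merge G i (xs @ [g]))))
    = (\<Oplus>\<^bsub>P ?n\<^esub>i\<in>{1..k}. add_pow (P ?n) (?e ^ i) (?B (merge G i xs @ [g])))
      \<oplus>\<^bsub>P ?n\<^esub> add_pow (P ?n) (?e ^ ?n) (?B (butlast xs @ [last xs \<otimes> g]))"
    (is "finsum _ ?f _ = ?s \<oplus>\<^bsub>_\<^esub> ?l")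
  proof -
    have "merge G ?n (xs @ [g]) = butlast xs @ [last xs \<otimes> g]" by (rule merge_append_last[OF len]) simp
    then have fl: "?f ?n = ?l"
      using bl g by (simp add: basis_cochain_def del: power_Suc)
    have fi: "?f i = add_pow (P ?n) (?e ^ i) (?B (merge G i xs @ [g]))" if "i \<in> {1..k}" for i
    proof -
      have "merge G i (xs @ [g]) = merge G i xs @ [g]" by (rule merge_append[OF len]) (use that in auto)
      then show ?thesis using mg[OF that] g by (simp add: basis_cochain_def)
    qed
    have "finsum (P ?n) ?f {1..?n} = finsum (P ?n) ?f (insert ?n {1..k})"
      by (simp add: atLeastAtMostSuc_conv)
    also have "\<dots> = ?f ?n \<oplus>\<^bsub>P ?n\<^esub> finsum (P ?n) ?f {1..k}"
    proof (rule Qn.M.finsum_insert)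
      show "?f ?n \<in> carrier (P ?n)" unfolding fl using lB by (rule Qn.M.add.int_pow_closed)
    qed (use mB in \<open>auto simp: fi\<close>)
    also have "finsum (P ?n) ?f {1..k} = ?s"
      using mB by (intro Qn.M.finsum_cong') (auto simp: fi)
    finally show ?thesis
      unfolding fl using lB mB by (simp add: Qn.M.a_comm Pi_def del: add_B power_Suc)
  qed
  have "contraction k (bd k b) = T (bd k (?B xs))"
    unfolding b_def T_def using xs g' by (simp add: bd.hom_ract ZG.basis_closed)
  also have "\<dots> = T (?B (tl xs)) \<oplus>\<^bsub>P ?n\<^esub> (\<Oplus>\<^bsub>P ?n\<^esub>i\<in>{1..k}. add_pow (P ?n) (?e ^ i) (T (?B (merge G i xs))))
      \<oplus>\<^bsub>P ?n\<^esub> add_pow (P ?n) (?e ^ ?n) (T (ract (P k) (?B (butlast xs)) (frag_of (last xs))))"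
  proof -
    have c: "?B ys \<in> carrier (P k)" if "ys \<in> bar_cells G k" for ys using that by (rule ZG.basis_closed)
    have "bd k (?B xs) = ?B (tl xs) \<oplus>\<^bsub>P k\<^esub> (\<Oplus>\<^bsub>P k\<^esub>i\<in>{1..k}. add_pow (P k) (?e ^ i) (?B (merge G i xs)))
      \<oplus>\<^bsub>P k\<^esub> add_pow (P k) (?e ^ ?n) (ract (P k) (?B (butlast xs)) (frag_of (last xs)))"
    proof -
      have "(\<Oplus>\<^bsub>P k\<^esub>i\<in>{1..k}. add_pow (P k) (?e ^ i) (basis_cochain G (group_ring G) k (merge G i xs)))
          = (\<Oplus>\<^bsub>P k\<^esub>i\<in>{1..k}. add_pow (P k) (?e ^ i) (?B (merge G i xs)))"
        using mg c by (intro Q.M.finsum_cong') (auto simp: basis_cochain_def)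
      then show ?thesis
        unfolding boundary_basis[OF xs] coboundary_apply[OF xs]
        using bl by (simp add: basis_cochain_def del: add_B power_Suc)
    qed
    moreover have "T (\<Oplus>\<^bsub>P k\<^esub>i\<in>{1..k}. add_pow (P k) (?e ^ i) (?B (merge G i xs)))
        = (\<Oplus>\<^bsub>P ?n\<^esub>i\<in>{1..k}. add_pow (P ?n) (?e ^ i) (T (?B (merge G i xs))))"
      using mg c by (subst T.hom_finsum) (auto simp: T.hom_add_pow intro!: Qn.M.finsum_cong')
    moreover have "ract (P k) (?B (butlast xs)) (frag_of (last xs)) \<in> carrier (P k)"
      using bl c by (intro Q.ract_closed) auto
    moreover have "(\<Oplus>\<^bsub>P k\<^esub>i\<in>{1..k}. add_pow (P k) (?e ^ i) (?B (merge G i xs))) \<in> carrier (P k)"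
      using mg c by auto
    ultimately show ?thesis
      using bl c by (simp add: T.hom_add_pow del: add_B power_Suc)
  qed
  also have "\<dots> = ?B (tl xs @ [g]) \<oplus>\<^bsub>P ?n\<^esub> (\<Oplus>\<^bsub>P ?n\<^esub>i\<in>{1..k}. add_pow (P ?n) (?e ^ i) (?B (merge G i xs @ [g])))
      \<oplus>\<^bsub>P ?n\<^esub> add_pow (P ?n) (?e ^ ?n) (?B (butlast xs @ [last xs \<otimes> g]))"
  proof -
    have "(\<Oplus>\<^bsub>P ?n\<^esub>i\<in>{1..k}. add_pow (P ?n) (?e ^ i) (T (?B (merge G i xs))))
        = (\<Oplus>\<^bsub>P ?n\<^esub>i\<in>{1..k}. add_pow (P ?n) (?e ^ i) (?B (merge G i xs @ [g])))"
      using mg mB by (intro Qn.M.finsum_cong') (auto simp: T_basis)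
    then show ?thesis unfolding T_last T_basis[OF bl(3)] by simp
  qed
  finally have rhs: "contraction k (bd k b) = \<dots>" .
  have sC: "(\<Oplus>\<^bsub>P ?n\<^esub>i\<in>{1..k}. add_pow (P ?n) (?e ^ i) (?B (merge G i xs @ [g]))) \<in> carrier (P ?n)"
    using mB by auto
  show ?thesis
    unfolding lhs sum rhs using tlB sC lB bB by (simp add: Qn.M.a_assoc del: add_B)
qed

lemma boundary_contraction:
  assumes "b \<in> carrier (P (Suc k))"
  shows "bd (Suc k) (contraction (Suc k) b)
    = contraction k (bd k b) \<oplus>\<^bsub>P (Suc k)\<^esub> add_pow (P (Suc k)) ((- 1 :: int) ^ k) b"
proof -
  interpret bd: right_module_hom "group_ring G" "P (Suc k)" "P k" "bd k" by (rule bd_hom)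
  interpret bd': right_module_hom "group_ring G" "P (Suc (Suc k))" "P (Suc k)" "bd (Suc k)" by (rule bd_hom)
  interpret c: abelian_group_hom "P k" "P (Suc k)" "contraction k" by (rule contraction_hom)
  interpret c': abelian_group_hom "P (Suc k)" "P (Suc (Suc k))" "contraction (Suc k)" by (rule contraction_hom)
  interpret p: abelian_group_hom "P (Suc k)" "P (Suc k)" "add_pow (P (Suc k)) ((- 1 :: int) ^ k)"
    by (rule bd.M.add_pow_hom)
  from assms show ?thesis
  proof (induction rule: P_induct)
    case zero
    then show ?case
      using bd.ah.hom_zero bd'.ah.hom_zero c.hom_zero c'.hom_zero p.hom_zero by simp
  next
    case (generator xs g)
    then show ?case by (rule boundary_contraction_generator)
  next
    case (minus b d)
    then show ?case
      by (simp add: bd.ah.hom_minus bd'.ah.hom_minus c.hom_minus c'.hom_minus p.hom_minus bd.M.add_minus_add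
          del: add_B)
  qed
qed

lemma boundary_basis_0:
  assumes "x \<in> carrier G"
  shows "bd 0 (basis (group_ring G) [x])
    = basis (group_ring G) [] \<ominus>\<^bsub>P 0\<^esub> ract (P 0) (basis (group_ring G) []) (frag_of x)"
proof -
  interpret right_module "group_ring G" "P 0" by (rule right_module_P)
  have x: "[x] \<in> bar_cells G (Suc 0)" using assms by (simp add: bar_cells_def)
  have B: "basis (group_ring G) [] \<in> carrier (P 0)" by (rule ZG.basis_closed) simp
  then have "ract (P 0) (basis (group_ring G) []) (frag_of x) \<in> carrier (P 0)"
    using assms by (intro ract_closed) auto
  then show ?thesis
    unfolding boundary_basis[OF x] coboundary_apply[OF x] using B
    by (simp add: basis_cochain_def a_minus_def M.add.int_pow_neg del: add_B zero_B)
qed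

text \<open>The element []g goes to [g], whose boundary is [] - []g. This is the homotopy identity
  in degree 0, with the augmentation in place of a lower boundary.\<close>

lemma boundary_contraction_0:
  assumes "b \<in> carrier (P 0)"
  shows "bd 0 (contraction 0 b) = (\<lambda>xs. if xs = [] then frag_cmul (augmentation (b [])) (frag_of \<one>) - b [] else 0)"
proof -
  interpret bd: right_module_hom "group_ring G" "P (Suc 0)" "P 0" "bd 0" by (rule bd_hom)
  interpret c: abelian_group_hom "P 0" "P (Suc 0)" "contraction 0" by (rule contraction_hom)
  from assms show ?thesis
  proof (induction rule: P_induct)
    case zero
    then show ?case using bd.ah.hom_zero c.hom_zero by (simp add: fun_eq_iff)
  next
    case (generator xs g)
    then have xs: "xs = []" by (simp add: bar_cells_def)
    have B: "basis (group_ring G) [] \<in> carrier (P 0)" by (rule ZG.basis_closed) simp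
    have R: "ract (P 0) (basis (group_ring G) []) (frag_of g) \<in> carrier (P 0)"
      using generator B by (intro bd.N.ract_closed) auto
    have "contraction 0 (ract (P 0) (basis (group_ring G) []) (frag_of g)) = basis (group_ring G) [g]"
      using generator by (subst contraction_single) auto
    then have eq: "bd 0 (contraction 0 (ract (P 0) (basis (group_ring G) []) (frag_of g)))
        = basis (group_ring G) [] \<ominus>\<^bsub>P 0\<^esub> ract (P 0) (basis (group_ring G) []) (frag_of g)"
      using generator by (simp add: boundary_basis_0)
    show ?case
      unfolding xs eq minus_B[OF B R] unfolding ract_basis_B[OF generator(2)] unfolding basis_B
      by auto
  next
    case (minus b d)
    then show ?case
      using minus_B[OF bd.ah.hom_closed bd.ah.hom_closed, OF c.hom_closed c.hom_closed, OF minus(1,2)]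
      by (simp add: bd.ah.hom_minus c.hom_minus) (simp add: minus_B fun_eq_iff frag_cmul_diff_distrib)
  qed
qed

lemma augmentation_boundary:
  assumes "b \<in> carrier (P (Suc 0))" shows "augmentation (bd 0 b []) = 0"
proof -
  interpret bd: right_module_hom "group_ring G" "P (Suc 0)" "P 0" "bd 0" by (rule bd_hom)
  from assms show ?thesis
  proof (induction rule: P_induct)
    case zero
    then show ?case using bd.ah.hom_zero by simp
  next
    case (generator xs g)
    then obtain x where xs: "xs = [x]" "x \<in> carrier G"
      by (auto simp: bar_cells_def length_Suc_conv)
    have B: "basis (group_ring G) [] \<in> carrier (P 0)" by (rule ZG.basis_closed) simp
    have R: "ract (P 0) (basis (group_ring G) []) (frag_of y) \<in> carrier (P 0)" if "y \<in> carrier G" for y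
      using that B by (intro bd.N.ract_closed) auto
    have g: "frag_of g \<in> carrier (group_ring G)" "frag_of x \<in> carrier (group_ring G)"
      using generator xs by auto
    have "bd 0 (ract (P (Suc 0)) (basis (group_ring G) xs) (frag_of g))
        = ract (P 0) (basis (group_ring G) [] \<ominus>\<^bsub>P 0\<^esub> ract (P 0) (basis (group_ring G) []) (frag_of x)) (frag_of g)"
      using generator xs g by (subst bd.hom_ract) (auto simp: boundary_basis_0 intro: ZG.basis_closed)
    also have "\<dots> = ract (P 0) (basis (group_ring G) []) (frag_of g) \<ominus>\<^bsub>P 0\<^esub> ract (P 0) (basis (group_ring G) []) (frag_of (x \<otimes> g))"
      using bd.N.ract_mult[OF B g(2) g(1)] R B g xs(2) by (simp add: bd.N.ract_minus)
    finally have eq: "bd 0 (ract (P (Suc 0)) (basis (group_ring G) xs) (frag_of g)) = \<dots>" .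
    show ?case
      unfolding eq minus_B[OF R[OF generator(2)] R[OF G.m_closed[OF xs(2) generator(2)]]]
      using generator xs by (simp add: ract_basis_B)
  next
    case (minus b d)
    then show ?case by (simp add: bd.ah.hom_minus minus_B[OF bd.ah.hom_closed bd.ah.hom_closed])
  qed
qed

text \<open>This avoids the cancellation of faces in a double sum. Every basis element of degree k +
  2 is the contraction of some y = [ys]g, and its boundary is the contraction of
  \<open>bd k y\<close> plus (-1)^k y. Applying \<open>bd k\<close>, the two terms cancel by
  \<open>contr\<close>.\<close>

lemma boundary_boundary_reduction:
  assumes contr: "\<And>y. y \<in> carrier (P (Suc k)) \<Longrightarrow>
      bd k (contraction k (bd k y)) = add_pow (P k) (- ((- 1 :: int) ^ k)) (bd k y)"
    and b: "b \<in> carrier (P (Suc (Suc k)))"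
  shows "bd k (bd (Suc k) b) = \<zero>\<^bsub>P k\<^esub>"
proof (rule free_rmodule_hom_eqI[OF _ _ _ b])
  interpret bd: right_module_hom "group_ring G" "P (Suc k)" "P k" "bd k" by (rule bd_hom)
  show "right_module_hom (group_ring G) (P (Suc (Suc k))) (P k) (\<lambda>b. bd k (bd (Suc k) b))"
    by (rule right_module_hom_comp[OF bd_hom bd_hom])
  show "right_module_hom (group_ring G) (P (Suc (Suc k))) (P k) (\<lambda>b. \<zero>\<^bsub>P k\<^esub>)"
    by (intro right_module_hom_zero right_module_P)
  fix xs assume "xs \<in> bar_cells G (Suc (Suc k))"
  then obtain ys g where xs: "xs = ys @ [g]" and ys: "ys \<in> bar_cells G (Suc k)" "g \<in> carrier G"
    by (cases xs rule: rev_cases) (auto simp: bar_cells_def)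
  define y where "y = ract (P (Suc k)) (basis (group_ring G) ys) (frag_of g)"
  have y: "y \<in> carrier (P (Suc k))"
    unfolding y_def using ys by (intro bd.M.ract_closed ZG.basis_closed) auto
  have "bd k (bd (Suc k) (basis (group_ring G) xs)) = bd k (bd (Suc k) (contraction (Suc k) y))"
    unfolding xs y_def using ys by (simp add: contraction_single)
  also have "\<dots> = bd k (contraction k (bd k y)) \<oplus>\<^bsub>P k\<^esub> add_pow (P k) ((- 1 :: int) ^ k) (bd k y)"
    using y by (simp add: boundary_contraction bd.ah.hom_add_pow contraction_closed del: add_B)
  also have "\<dots> = add_pow (P k) (- ((- 1 :: int) ^ k) + (- 1) ^ k) (bd k y)"
    using y unfolding contr[OF y] by (subst bd.N.add.int_pow_mult) auto
  finally show "bd k (bd (Suc k) (basis (group_ring G) xs)) = \<zero>\<^bsub>P k\<^esub>"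
    by (simp add: add_pow_int_0)
qed

text \<open>The hypothesis of the reduction in degree k + 1 follows from the homotopy identity once
  the composite vanishes in degree k. In degree 0 it follows because boundaries have augmentation
  zero.\<close>

lemma boundary_boundary:
  assumes "b \<in> carrier (P (Suc (Suc k)))"
  shows "bd k (bd (Suc k) b) = \<zero>\<^bsub>P k\<^esub>"
  using assms
proof (induction k arbitrary: b)
  case (0 b)
  note b = 0
  interpret bd: right_module_hom "group_ring G" "P (Suc 0)" "P 0" "bd 0" by (rule bd_hom)
  show ?case
  proof (rule boundary_boundary_reduction[OF _ b])
    fix y assume y: "y \<in> carrier (P (Suc 0))"
    have z: "bd 0 y \<in> carrier (P 0)" using y by simp
    have "bd 0 y xs = 0" if "xs \<noteq> []" for xs
      using z that unfolding carrier_B by (simp add: bar_cells_0)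
    then show "bd 0 (contraction 0 (bd 0 y)) = add_pow (P 0) (- ((- 1 :: int) ^ 0)) (bd 0 y)"
      using z boundary_contraction_0[OF z] augmentation_boundary[OF y] bd.N.M.zero_closed minus_B[OF bd.N.M.zero_closed z]
      by (auto simp: bd.N.add.int_pow_neg a_minus_def fun_eq_iff)
  qed
next
  case (Suc k b)
  interpret bd: right_module_hom "group_ring G" "P (Suc (Suc k))" "P (Suc k)" "bd (Suc k)" by (rule bd_hom)
  interpret c: abelian_group_hom "P k" "P (Suc k)" "contraction k" by (rule contraction_hom)
  show ?case
  proof (rule boundary_boundary_reduction[OF _ Suc.prems])
    fix y assume y: "y \<in> carrier (P (Suc (Suc k)))"
    then show "bd (Suc k) (contraction (Suc k) (bd (Suc k) y))
        = add_pow (P (Suc k)) (- ((- 1 :: int) ^ Suc k)) (bd (Suc k) y)"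
      using Suc.IH[OF y] c.hom_zero by (simp add: boundary_contraction)
  qed
qed

text \<open>For a cycle the homotopy identity says that the boundary of its contraction is (-1)^k b,
  and this sign is its own inverse.\<close>

lemma bar_exact:
  assumes "b \<in> carrier (P (Suc k))" "bd k b = \<zero>\<^bsub>P k\<^esub>"
  obtains b' where "b' \<in> carrier (P (Suc (Suc k)))" "bd (Suc k) b' = b"
proof
  interpret bd': right_module_hom "group_ring G" "P (Suc (Suc k))" "P (Suc k)" "bd (Suc k)" by (rule bd_hom)
  interpret c: abelian_group_hom "P k" "P (Suc k)" "contraction k" by (rule contraction_hom)
  let ?b = "add_pow (P (Suc (Suc k))) ((- 1 :: int) ^ k) (contraction (Suc k) b)"
  show "?b \<in> carrier (P (Suc (Suc k)))" using assms by (simp add: contraction_closed)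
  have "((- 1 :: int) ^ k) * ((- 1 :: int) ^ k) = 1" by (simp flip: power_add)
  then show "bd (Suc k) ?b = b"
    using assms c.hom_zero boundary_contraction[OF assms(1)]
    by (simp add: bd'.ah.hom_add_pow contraction_closed bd'.N.add.int_pow_pow)
qed

end

section \<open>Submodules, quotients and flatness\<close>

text \<open>Closure under negation comes from the action of -1.\<close>

definition right_submodule :: "('s, 'a) ring_scheme \<Rightarrow> ('s, 'm, 'b) rmodule_scheme \<Rightarrow> 'm set \<Rightarrow> bool"
  where "right_submodule S M K \<longleftrightarrow> K \<subseteq> carrier M \<and> \<zero>\<^bsub>M\<^esub> \<in> K \<and> (\<forall>x\<in>K. \<forall>y\<in>K. x \<oplus>\<^bsub>M\<^esub> y \<in> K)
    \<and> (\<forall>x\<in>K. \<forall>s\<in>carrier S. ract M x s \<in> K)"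

lemma right_submoduleD:
  assumes "right_submodule S M K"
  shows "x \<in> K \<Longrightarrow> x \<in> carrier M" "\<zero>\<^bsub>M\<^esub> \<in> K" "\<lbrakk>x \<in> K; y \<in> K\<rbrakk> \<Longrightarrow> x \<oplus>\<^bsub>M\<^esub> y \<in> K"
    "\<lbrakk>x \<in> K; s \<in> carrier S\<rbrakk> \<Longrightarrow> ract M x s \<in> K"
  using assms by (auto simp: right_submodule_def)

context right_module
begin

lemma right_submodule_a_inv:
  assumes "right_submodule S M K" "x \<in> K" shows "\<ominus>\<^bsub>M\<^esub> x \<in> K"
proof -
  have x: "x \<in> carrier M" using right_submoduleD(1)[OF assms] .
  interpret r: abelian_group_hom S M "ract M x" using x by (rule abelian_group_hom_ract_right)
  have "\<ominus>\<^bsub>M\<^esub> x = ract M x (\<ominus>\<^bsub>S\<^esub> \<one>\<^bsub>S\<^esub>)" using x by (simp add: ract_one)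
  moreover have "\<ominus>\<^bsub>S\<^esub> \<one>\<^bsub>S\<^esub> \<in> carrier S" by simp
  ultimately show ?thesis using right_submoduleD(4)[OF assms] by (simp only:)
qed

lemma right_submodule_minus:
  "\<lbrakk>right_submodule S M K; x \<in> K; y \<in> K\<rbrakk> \<Longrightarrow> x \<ominus>\<^bsub>M\<^esub> y \<in> K"
  unfolding a_minus_def by (blast intro: right_submoduleD right_submodule_a_inv)

lemma right_module_submodule:
  assumes "right_submodule S M K" shows "right_module S (M\<lparr>carrier := K\<rparr>)"
proof (intro right_moduleI abelian_groupI S.ring_axioms)
  fix x assume "x \<in> carrier (M\<lparr>carrier := K\<rparr>)"
  then show "\<exists>y\<in>carrier (M\<lparr>carrier := K\<rparr>). y \<oplus>\<^bsub>M\<lparr>carrier := K\<rparr>\<^esub> x = \<zero>\<^bsub>M\<lparr>carrier := K\<rparr>\<^esub>"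
    using right_submodule_a_inv[OF assms] right_submoduleD(1)[OF assms]
    by (intro bexI[of _ "\<ominus>\<^bsub>M\<^esub> x"]) (auto simp: M.l_neg)
qed (use right_submoduleD[OF assms] in \<open>auto simp: M.a_ac ract_add_left ract_add_right ract_mult ract_one\<close>)

lemma right_module_hom_submodule:
  assumes "right_submodule S M K" shows "right_module_hom S (M\<lparr>carrier := K\<rparr>) M (\<lambda>x. x)"
  using right_submoduleD[OF assms]
  by (intro right_module_homI right_module_submodule right_module_axioms assms) auto

lemma right_submodule_zero: "right_submodule S M {\<zero>\<^bsub>M\<^esub>}"
  by (auto simp: right_submodule_def ract_zero_left)

end

context right_module_hom
begin

lemma right_submodule_image: "right_submodule S N (f ` carrier M)"
  unfolding right_submodule_def
proof (intro conjI ballI)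
  show "\<zero>\<^bsub>N\<^esub> \<in> f ` carrier M" using ah.hom_zero by (metis M.zero_closed image_eqI)
  show "x \<oplus>\<^bsub>N\<^esub> y \<in> f ` carrier M" if "x \<in> f ` carrier M" "y \<in> f ` carrier M" for x y
    using that by (auto simp flip: ah.hom_add)
  show "ract N x s \<in> f ` carrier M" if "x \<in> f ` carrier M" "s \<in> carrier S" for x s
    using that by (auto simp flip: hom_ract intro!: imageI M.ract_closed)
qed auto

lemma right_submodule_kernel: "right_submodule S M {x \<in> carrier M. f x = \<zero>\<^bsub>N\<^esub>}"
  by (auto simp: right_submodule_def hom_ract M.ract_closed N.ract_zero_left)

end

text \<open>The structure induced on the image of a map with additive and scalar-compatible fibres: with an
  injection it transports the module to another type, and it presents a quotient module by a map choosing
  representatives.\<close>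

definition image_rmodule :: "('m \<Rightarrow> 'n) \<Rightarrow> ('s, 'm, 'b) rmodule_scheme \<Rightarrow> ('s, 'n) rmodule"
  where "image_rmodule q M =
    \<lparr>carrier = q ` carrier M, monoid.mult = undefined, one = undefined, ring.zero = q \<zero>\<^bsub>M\<^esub>,
     add = (\<lambda>x y. q (inv_into (carrier M) q x \<oplus>\<^bsub>M\<^esub> inv_into (carrier M) q y)),
     ract = (\<lambda>x s. q (ract M (inv_into (carrier M) q x) s))\<rparr>"

text \<open>M/K, carried by the range of a map whose fibres are the cosets of K instead of by a set
  of cosets. A suitable choice of q thus places the quotient in a prescribed type. For K = 0 the map
  q is an injection and the quotient a copy of M.\<close>

locale rmodule_quotient = right_module S M
  for S :: "('s, 'a) ring_scheme" (structure) and M :: "('s, 'm, 'b) rmodule_scheme" (structure)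
    and K :: "'m set" and q :: "'m \<Rightarrow> 'n" +
  assumes submodule: "right_submodule S M K"
    and q_eq_iff: "\<lbrakk>x \<in> carrier M; y \<in> carrier M\<rbrakk> \<Longrightarrow> q x = q y \<longleftrightarrow> x \<ominus>\<^bsub>M\<^esub> y \<in> K"
begin

lemma inv_q:
  assumes "x \<in> carrier M"
  shows "inv_into (carrier M) q (q x) \<in> carrier M" "inv_into (carrier M) q (q x) \<ominus>\<^bsub>M\<^esub> x \<in> K"
proof -
  show "inv_into (carrier M) q (q x) \<in> carrier M" using assms by (simp add: inv_into_into)
  then show "inv_into (carrier M) q (q x) \<ominus>\<^bsub>M\<^esub> x \<in> K"
    using assms by (simp add: f_inv_into_f flip: q_eq_iff)
qed

lemma carrier_image [simp]: "carrier (image_rmodule q M) = q ` carrier M"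
  by (simp add: image_rmodule_def)

lemma zero_image [simp]: "\<zero>\<^bsub>image_rmodule q M\<^esub> = q \<zero>\<^bsub>M\<^esub>"
  by (simp add: image_rmodule_def)

lemma add_image:
  assumes "x \<in> carrier M" "y \<in> carrier M"
  shows "q x \<oplus>\<^bsub>image_rmodule q M\<^esub> q y = q (x \<oplus>\<^bsub>M\<^esub> y)"
proof -
  have "q (inv_into (carrier M) q (q x) \<oplus>\<^bsub>M\<^esub> inv_into (carrier M) q (q y)) = q (x \<oplus>\<^bsub>M\<^esub> y)"
    using inv_q[OF assms(1)] inv_q[OF assms(2)] assms right_submoduleD(3)[OF submodule]
    by (subst q_eq_iff) (simp_all add: M.add_minus_add)
  then show ?thesis by (simp add: image_rmodule_def)
qed

lemma ract_image:
  assumes "x \<in> carrier M" "s \<in> carrier S"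
  shows "ract (image_rmodule q M) (q x) s = q (ract M x s)"
proof -
  have "q (ract M (inv_into (carrier M) q (q x)) s) = q (ract M x s)"
    using inv_q[OF assms(1)] assms right_submoduleD(4)[OF submodule]
    by (subst q_eq_iff) (simp_all add: ract_closed flip: ract_minus)
  then show ?thesis by (simp add: image_rmodule_def)
qed

lemma right_module_image: "right_module S (image_rmodule q M)"
proof (intro right_moduleI abelian_groupI S.ring_axioms)
  fix x assume "x \<in> carrier (image_rmodule q M)"
  then obtain x' where "x = q x'" "x' \<in> carrier M" by auto
  then show "\<exists>y\<in>carrier (image_rmodule q M). y \<oplus>\<^bsub>image_rmodule q M\<^esub> x = \<zero>\<^bsub>image_rmodule q M\<^esub>"
    by (intro bexI[of _ "q (\<ominus>\<^bsub>M\<^esub> x')"]) (auto simp: add_image M.l_neg)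
qed (auto simp: add_image ract_image M.a_ac ract_closed ract_add_left ract_add_right ract_mult ract_one)

lemma q_hom: "right_module_hom S M (image_rmodule q M) q"
  by (intro right_module_homI right_module_axioms right_module_image) (auto simp: add_image ract_image)

end

lemma rmodule_quotient_inj:
  assumes "right_module S M" "inj_on q (carrier M)"
  shows "rmodule_quotient S M {\<zero>\<^bsub>M\<^esub>} q"
proof -
  interpret right_module S M by fact
  show ?thesis
    by unfold_locales (auto simp: right_submodule_zero inj_on_eq_iff[OF assms(2)] a_minus_def M.r_neg
        dest: M.minus_equality[symmetric] M.add.inv_comm)
qed

text \<open>Congruent elements satisfy the same predicate in \<open>SOME\<close>, so
  \<open>rep\<close> is constant on cosets. Following it by e moves the chosen representatives into
  the target type.\<close>

lemma rmodule_quotient_exists: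
  fixes e :: "'m \<Rightarrow> 'n"
  assumes "right_module S M" "right_submodule S M K" "inj_on e (carrier M)"
  obtains q :: "'m \<Rightarrow> 'n" where "rmodule_quotient S M K q"
proof -
  interpret right_module S M by fact
  define rep where "rep x = (SOME y. y \<in> carrier M \<and> y \<ominus>\<^bsub>M\<^esub> x \<in> K)" for x
  have rep: "rep x \<in> carrier M" "rep x \<ominus>\<^bsub>M\<^esub> x \<in> K" if "x \<in> carrier M" for x
    using that right_submoduleD(2)[OF assms(2)] someI[of "\<lambda>y. y \<in> carrier M \<and> y \<ominus>\<^bsub>M\<^esub> x \<in> K" x]
    by (auto simp: rep_def a_minus_def M.r_neg)
  have iff: "rep x = rep y \<longleftrightarrow> x \<ominus>\<^bsub>M\<^esub> y \<in> K" if xy: "x \<in> carrier M" "y \<in> carrier M" for x y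
  proof
    assume eq: "rep x = rep y"
    have "\<ominus>\<^bsub>M\<^esub> (rep x \<ominus>\<^bsub>M\<^esub> x) \<in> K" using rep xy by (intro right_submodule_a_inv[OF assms(2)])
    then have "x \<ominus>\<^bsub>M\<^esub> rep x \<in> K" using rep(1) xy by (simp add: M.a_inv_minus)
    then have "(x \<ominus>\<^bsub>M\<^esub> rep x) \<oplus>\<^bsub>M\<^esub> (rep x \<ominus>\<^bsub>M\<^esub> y) \<in> K"
      using rep(2)[OF xy(2)] eq right_submoduleD(3)[OF assms(2)] by simp
    then show "x \<ominus>\<^bsub>M\<^esub> y \<in> K" using rep(1) xy by (simp add: M.minus_add_minus)
  next
    assume K: "x \<ominus>\<^bsub>M\<^esub> y \<in> K"
    then have K': "y \<ominus>\<^bsub>M\<^esub> x \<in> K"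
      using right_submodule_a_inv[OF assms(2) K] xy by (simp add: M.a_inv_minus)
    have "z \<ominus>\<^bsub>M\<^esub> x \<in> K \<longleftrightarrow> z \<ominus>\<^bsub>M\<^esub> y \<in> K" if "z \<in> carrier M" for z
      using right_submoduleD(3)[OF assms(2) _ K, of "z \<ominus>\<^bsub>M\<^esub> x"] right_submoduleD(3)[OF assms(2) _ K', of "z \<ominus>\<^bsub>M\<^esub> y"] xy that
      by (auto simp: M.minus_add_minus)
    then show "rep x = rep y" unfolding rep_def by metis
  qed
  have "rmodule_quotient S M K (\<lambda>x. e (rep x))"
    using iff rep(1) by unfold_locales (simp_all add: assms(2) inj_on_eq_iff[OF assms(3)])
  then show ?thesis by (rule that)
qed

lemma right_module_hom_inv:
  assumes "right_module S M" "inj_on q (carrier M)"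
  shows "right_module_hom S (image_rmodule q M) M (inv_into (carrier M) q)"
proof -
  interpret rmodule_quotient S M "{\<zero>\<^bsub>M\<^esub>}" q by (rule rmodule_quotient_inj[OF assms])
  show ?thesis
    by (intro right_module_homI right_module_image right_module_axioms)
      (auto simp: add_image ract_image ract_closed inv_into_f_f[OF assms(2)])
qed

section \<open>Tensor products and flatness in terms of representatives\<close>

lemma tensor_relations_subset:
  assumes "right_module S A" "left_module S N"
  shows "tensor_relations S A N \<subseteq> carrier (free_Abelian_group (carrier A \<times> carrier N))"
proof -
  interpret A: right_module S A by fact
  interpret N: left_module S N by fact
  show ?thesis
    by (auto simp: tensor_relations_def A.ract_closed N.smult_closed dest!: subsetD[OF keys_diff])
qed

lemma tensor_kernel_subgroup:
  assumes "right_module S A" "left_module S N"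
  shows "subgroup (tensor_kernel S A N) (free_Abelian_group (carrier A \<times> carrier N))"
  unfolding tensor_kernel_def
  by (rule group.generate_is_subgroup[OF group_free_Abelian_group tensor_relations_subset[OF assms]])

text \<open>On representatives, \<open>tensor_map\<close> is the map of free abelian groups induced by \<open>f \<times> id\<close>.\<close>

abbreviation (input) free_map :: "('m1 \<Rightarrow> 'm2) \<Rightarrow> ('m1 \<times> 'n \<Rightarrow>\<^sub>0 int) \<Rightarrow> ('m2 \<times> 'n \<Rightarrow>\<^sub>0 int)"
  where "free_map f \<equiv> frag_extend (\<lambda>(a, y). frag_of (f a, y))"

lemma free_map_hom:
  assumes "f ` A \<subseteq> B"
  shows "group_hom (free_Abelian_group (A \<times> N)) (free_Abelian_group (B \<times> N)) (free_map f)"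
proof -
  have "Poly_Mapping.keys (free_map f x) \<subseteq> B \<times> N" if "Poly_Mapping.keys x \<subseteq> A \<times> N" for x
    using assms that by (fastforce dest!: subsetD[OF keys_frag_extend])
  then show ?thesis
    by (auto simp: group_hom_def group_hom_axioms_def hom_def frag_extend_add)
qed

lemma free_map_comp:
  assumes "\<And>a. a \<in> A \<Longrightarrow> g (f a) = h a" "Poly_Mapping.keys x \<subseteq> A \<times> N"
  shows "free_map g (free_map f x) = free_map h x"
  using assms(2) by (induction x rule: frag_induction) (auto simp: assms(1) frag_extend_diff)

lemma free_map_id:
  assumes "\<And>a. a \<in> A \<Longrightarrow> f a = a" "Poly_Mapping.keys x \<subseteq> A \<times> N"
  shows "free_map f x = x"
  using assms(2) by (induction x rule: frag_induction) (auto simp: assms(1) frag_extend_diff)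

lemma free_map_tensor_kernel:
  assumes "right_module_hom S A B f" "left_module S N" "x \<in> tensor_kernel S A N"
  shows "free_map f x \<in> tensor_kernel S B N"
proof -
  interpret f: right_module_hom S A B f by fact
  interpret N: left_module S N by fact
  let ?FA = "free_Abelian_group (carrier A \<times> carrier N)" and ?FB = "free_Abelian_group (carrier B \<times> carrier N)"
  interpret h: group_hom ?FA ?FB "free_map f" by (rule free_map_hom) auto
  have "free_map f ` tensor_relations S A N \<subseteq> tensor_relations S B N"
  proof (rule image_subsetI)
    fix z assume "z \<in> tensor_relations S A N"
    then consider
        (left) x x' y where "z = frag_of (x \<oplus>\<^bsub>A\<^esub> x', y) - frag_of (x, y) - frag_of (x', y)"
          "x \<in> carrier A" "x' \<in> carrier A" "y \<in> carrier N"
      | (right) x y y' where "z = frag_of (x, y \<oplus>\<^bsub>N\<^esub> y') - frag_of (x, y) - frag_of (x, y')"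
          "x \<in> carrier A" "y \<in> carrier N" "y' \<in> carrier N"
      | (middle) x s y where "z = frag_of (ract A x s, y) - frag_of (x, s \<odot>\<^bsub>N\<^esub> y)"
          "x \<in> carrier A" "s \<in> carrier S" "y \<in> carrier N"
      unfolding tensor_relations_def by blast
    then show "free_map f z \<in> tensor_relations S B N"
    proof cases
      case (left x x' y)
      then have "free_map f z = frag_of (f x \<oplus>\<^bsub>B\<^esub> f x', y) - frag_of (f x, y) - frag_of (f x', y)"
        by (simp add: frag_extend_diff)
      then show ?thesis unfolding tensor_relations_def using left(2-4) f.ah.hom_closed by blast
    next
      case (right x y y')
      then have "free_map f z = frag_of (f x, y \<oplus>\<^bsub>N\<^esub> y') - frag_of (f x, y) - frag_of (f x, y')"
        by (simp add: frag_extend_diff)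
      then show ?thesis unfolding tensor_relations_def using right(2-4) f.ah.hom_closed by blast
    next
      case (middle x s y)
      then have "free_map f z = frag_of (ract B (f x) s, y) - frag_of (f x, s \<odot>\<^bsub>N\<^esub> y)"
        by (simp add: frag_extend_diff f.hom_ract)
      then show ?thesis unfolding tensor_relations_def using middle(2-4) f.ah.hom_closed by blast
    qed
  qed
  then have "generate ?FB (free_map f ` tensor_relations S A N) \<subseteq> tensor_kernel S B N"
    unfolding tensor_kernel_def by (rule h.H.mono_generate)
  moreover have "free_map f ` tensor_kernel S A N = generate ?FB (free_map f ` tensor_relations S A N)"
    unfolding tensor_kernel_def
    by (rule h.generate_img[symmetric, OF tensor_relations_subset[OF f.M.right_module_axioms assms(2)]])
  ultimately show ?thesis using assms(3) by blast
qed

text \<open>If the image of x is zero in the tensor product of B and N, then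
  \<open>tensor_map\<close> takes the cosets of x and of 0 to the same coset, and flatness
  identifies these two. This form lets later proofs work with formal sums instead of cosets.\<close>

lemma flat_left_module_kernel:
  fixes A B :: "('s, 'u) rmodule"
  assumes flat: "flat_left_module TYPE('u) S N" and f: "right_module_hom S A B f" "inj_on f (carrier A)"
    and x: "Poly_Mapping.keys x \<subseteq> carrier A \<times> carrier N" "free_map f x \<in> tensor_kernel S B N"
  shows "x \<in> tensor_kernel S A N"
proof -
  interpret f: right_module_hom S A B f by fact
  have N: "left_module S N" using flat by (simp add: flat_left_module_def)
  let ?FA = "free_Abelian_group (carrier A \<times> carrier N)" and ?FB = "free_Abelian_group (carrier B \<times> carrier N)"
  let ?KA = "tensor_kernel S A N" and ?KB = "tensor_kernel S B N"
  interpret FA: group ?FA by simp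
  interpret FB: group ?FB by simp
  interpret h: group_hom ?FA ?FB "free_map f" by (rule free_map_hom) auto
  interpret KA: subgroup ?KA ?FA by (rule tensor_kernel_subgroup[OF f.M.right_module_axioms N])
  interpret KB: subgroup ?KB ?FB by (rule tensor_kernel_subgroup[OF f.N.right_module_axioms N])
  have map: "tensor_map S N B f (?KA #>\<^bsub>?FA\<^esub> z) = ?KB"
    if z: "z \<in> carrier ?FA" "free_map f z \<in> ?KB" for z
  proof -
    have "?KB #>\<^bsub>?FB\<^esub> free_map f y = ?KB" if y: "y \<in> ?KA #>\<^bsub>?FA\<^esub> z" for y
    proof -
      obtain k where k: "k \<in> ?KA" "y = k + z" using y by (auto simp: r_coset_def)
      have "free_map f y \<in> ?KB"
        using KB.m_closed[OF free_map_tensor_kernel[OF f(1) N k(1)] z(2)] by (simp add: k(2) frag_extend_add)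
      then show ?thesis by (intro FB.coset_join2 KB.subgroup_axioms KB.mem_carrier)
    qed
    moreover have "?KA #>\<^bsub>?FA\<^esub> z \<noteq> {}" using KA.one_closed by (auto simp: r_coset_def)
    ultimately show ?thesis by (auto simp: tensor_map_def)
  qed
  have xF: "x \<in> carrier ?FA" using x(1) by simp
  have inj: "inj_on (tensor_map S N B f) (carrier (tensor S A N))"
    using flat f by (auto simp: flat_left_module_def f.M.right_module_axioms f.N.right_module_axioms f.f)
  have coset: "?KA #>\<^bsub>?FA\<^esub> z \<in> carrier (tensor S A N)" if "z \<in> carrier ?FA" for z
    unfolding tensor_def FactGroup_def using FA.rcosetsI[OF KA.subset that] by simp
  have "?KA #>\<^bsub>?FA\<^esub> x = ?KA #>\<^bsub>?FA\<^esub> \<one>\<^bsub>?FA\<^esub>"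
  proof (rule inj_onD[OF inj _ coset[OF xF] coset[OF FA.one_closed]])
    have "free_map f \<one>\<^bsub>?FA\<^esub> \<in> ?KB" using KB.one_closed by simp
    then show "tensor_map S N B f (?KA #>\<^bsub>?FA\<^esub> x) = tensor_map S N B f (?KA #>\<^bsub>?FA\<^esub> \<one>\<^bsub>?FA\<^esub>)"
      using map[OF xF x(2)] map[OF FA.one_closed] by simp
  qed
  also have "\<dots> = ?KA" by (intro FA.coset_join2 KA.subgroup_axioms KA.one_closed FA.one_closed)
  finally show ?thesis by (intro FA.coset_join1[OF _ xF KA.subgroup_axioms])
qed

text \<open>\<open>flat_left_module\<close> ranges over modules inside 'u, while the modules of the
  bar complex consist of functions. The injections d and e carry the question into 'u, and the
  inverse of d carries the answer back.\<close>

lemma flat_left_module_kernel_transport: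
  fixes d :: "'m \<Rightarrow> 'u" and e :: "'n \<Rightarrow> 'u"
  assumes flat: "flat_left_module TYPE('u) S N" and f: "right_module_hom S A B f" "inj_on f (carrier A)"
    and d: "inj_on d (carrier A)" and e: "inj_on e (carrier B)"
    and x: "Poly_Mapping.keys x \<subseteq> carrier A \<times> carrier N" "free_map f x \<in> tensor_kernel S B N"
  shows "x \<in> tensor_kernel S A N"
proof -
  interpret f: right_module_hom S A B f by fact
  interpret d: rmodule_quotient S A "{\<zero>\<^bsub>A\<^esub>}" d by (rule rmodule_quotient_inj[OF f.M.right_module_axioms d])
  interpret e: rmodule_quotient S B "{\<zero>\<^bsub>B\<^esub>}" e by (rule rmodule_quotient_inj[OF f.N.right_module_axioms e])
  have N: "left_module S N" using flat by (simp add: flat_left_module_def)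
  let ?d' = "inv_into (carrier A) d"
  let ?g = "\<lambda>a. e (f (?d' a))"
  have d': "right_module_hom S (image_rmodule d A) A ?d'"
    by (rule right_module_hom_inv[OF f.M.right_module_axioms d])
  have g: "right_module_hom S (image_rmodule d A) (image_rmodule e B) ?g"
    by (rule right_module_hom_comp[OF right_module_hom_comp[OF d' f(1)] e.q_hom])
  have "inj_on ?g (carrier (image_rmodule d A))"
    by (intro inj_onI) (auto simp: inv_into_f_f[OF d] dest!: inj_onD[OF e] inj_onD[OF f(2)])
  moreover have "Poly_Mapping.keys (free_map d x) \<subseteq> carrier (image_rmodule d A) \<times> carrier N"
    using x(1) by (auto dest!: subsetD[OF keys_frag_extend] split: prod.splits)
  moreover have "free_map ?g (free_map d x) = free_map e (free_map f x)"
    using d free_map_comp[where g = ?g and f = d and A = "carrier A" and h = "\<lambda>a. e (f a)" and x = x and N = "carrier N"]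
      free_map_comp[where g = e and f = f and A = "carrier A" and h = "\<lambda>a. e (f a)" and x = x and N = "carrier N"] x(1)
    by simp
  ultimately have "free_map d x \<in> tensor_kernel S (image_rmodule d A) N"
    using flat_left_module_kernel[OF flat g] free_map_tensor_kernel[OF e.q_hom N x(2)] by simp
  from free_map_tensor_kernel[OF d' N this] show ?thesis
    using d x(1) free_map_comp[where g = ?d' and f = d and A = "carrier A" and h = "\<lambda>a. a" and x = x and N = "carrier N"]
      free_map_id[where f = "\<lambda>a. a" and A = "carrier A" and x = x and N = "carrier N"] by simp
qed

text \<open>A finitely supported function is determined by its graph over the support, a finite set
  of pairs of elements of 'u, and an infinite 'u has as many elements as finite sets of
  pairs.\<close>

lemma finite_support_encoding:
  fixes d :: "'i \<Rightarrow> 'u" and k :: "'v \<Rightarrow> 'u"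
  assumes inf: "infinite (UNIV :: 'u set)" and d: "inj_on d I" and k: "inj_on k V"
  obtains e :: "('i \<Rightarrow> 'v) \<Rightarrow> 'u"
  where "inj_on e {f. (\<forall>i. f i \<in> V) \<and> (\<forall>i. i \<notin> I \<longrightarrow> f i = z) \<and> finite {i. f i \<noteq> z}}"
proof -
  let ?F = "{f. (\<forall>i. f i \<in> V) \<and> (\<forall>i. i \<notin> I \<longrightarrow> f i = z) \<and> finite {i. f i \<noteq> z}}"
  have "Fpow (UNIV :: ('u \<times> 'u) set) \<approx> (UNIV :: ('u \<times> 'u) set)"
    using inf by (intro eqpoll_Fpow) (simp add: finite_prod)
  moreover have "(UNIV :: ('u \<times> 'u) set) \<approx> (UNIV :: 'u set)"
    using card_of_Times_same_infinite[OF inf] by (simp add: eqpoll_iff_card_of_ordIso)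
  ultimately have "Fpow (UNIV :: ('u \<times> 'u) set) \<approx> (UNIV :: 'u set)" by (rule eqpoll_trans)
  then obtain p :: "('u \<times> 'u) set \<Rightarrow> 'u" where p: "inj_on p (Fpow UNIV)"
    unfolding eqpoll_def bij_betw_def by blast
  let ?g = "\<lambda>f. (\<lambda>i. (d i, k (f i))) ` {i. f i \<noteq> z}"
  have "inj_on ?g ?F"
  proof (rule inj_onI, rule ext)
    fix f g i assume f: "f \<in> ?F" and g: "g \<in> ?F" and eq: "?g f = ?g g"
    have key: "f i = g i" if f: "f \<in> ?F" and g: "g \<in> ?F" and eq: "?g f = ?g g" and i: "f i \<noteq> z" for f g
    proof -
      have "(d i, k (f i)) \<in> ?g f" using i by (intro image_eqI) auto
      then have "(d i, k (f i)) \<in> ?g g" unfolding eq .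
      then obtain l where l: "g l \<noteq> z" "d i = d l" "k (f i) = k (g l)" by (elim imageE) simp
      have "i \<in> I" "l \<in> I" "f i \<in> V" "g l \<in> V" using f g i l(1) by auto
      then show ?thesis using inj_onD[OF d l(2)] inj_onD[OF k l(3)] by simp
    qed
    show "f i = g i" using key[OF f g eq] key[OF g f eq[symmetric]] by metis
  qed
  moreover have "?g ` ?F \<subseteq> Fpow UNIV" by (auto simp: Fpow_def)
  ultimately have "inj_on (p \<circ> ?g) ?F"
    using p by (intro comp_inj_on) (auto intro: inj_on_subset)
  then show ?thesis by (rule that)
qed

section \<open>Base change of the bar complex\<close>

context group_ring_extension
begin

lemma j_closed: "Poly_Mapping.keys c \<subseteq> carrier G \<Longrightarrow> j c \<in> carrier S"
  using ring_hom_closed[OF j_hom, of c] by simp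

lemma j_zero: "j 0 = \<zero>\<^bsub>S\<^esub>"
  using ring_hom_zero[OF j_hom ZG.ring_axioms S.ring_axioms] by simp

lemma j_one: "j (frag_of \<one>) = \<one>\<^bsub>S\<^esub>"
  using ring_hom_one[OF j_hom] by simp

lemma extend_scalars_hom:
  "right_module_hom (group_ring G) (free_rmodule (group_ring G) I) (restrict_scalars j (free_rmodule S I)) (\<lambda>b i. j (b i))"
proof (rule right_module_homI)
  show "right_module (group_ring G) (free_rmodule (group_ring G) I)" by (rule ZG.right_module_free)
  show "right_module (group_ring G) (restrict_scalars j (free_rmodule S I))"
    by (intro right_module_restrict_scalars[OF ZG.ring_axioms j_hom] S.right_module_free)
  fix b assume b: "b \<in> carrier (free_rmodule (group_ring G) I)"
  then have b': "Poly_Mapping.keys (b i) \<subseteq> carrier G" for i by (simp add: free_rmodule_def carrier_direct_sum)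
  have "{i. j (b i) \<noteq> \<zero>\<^bsub>S\<^esub>} \<subseteq> {i. b i \<noteq> 0}" by (auto simp: j_zero)
  then show "(\<lambda>i. j (b i)) \<in> carrier (restrict_scalars j (free_rmodule S I))"
    using b by (auto simp: free_rmodule_def carrier_direct_sum j_closed j_zero elim: finite_subset)
  show "(\<lambda>i. j (ract (free_rmodule (group_ring G) I) b s i)) =
      ract (restrict_scalars j (free_rmodule S I)) (\<lambda>i. j (b i)) s" if "s \<in> carrier (group_ring G)" for s
    using b' that ring_hom_mult[OF j_hom] by (simp add: free_rmodule_def)
  fix c assume "c \<in> carrier (free_rmodule (group_ring G) I)"
  then have "Poly_Mapping.keys (c i) \<subseteq> carrier G" for i by (simp add: free_rmodule_def carrier_direct_sum)
  then show "(\<lambda>i. j ((b \<oplus>\<^bsub>free_rmodule (group_ring G) I\<^esub> c) i)) =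
      (\<lambda>i. j (b i)) \<oplus>\<^bsub>restrict_scalars j (free_rmodule S I)\<^esub> (\<lambda>i. j (c i))"
    using b' ring_hom_add[OF j_hom] by (simp add: free_rmodule_def)
qed

lemma extend_scalars_basis: "(\<lambda>i. j (basis (group_ring G) x i)) = basis S x"
proof
  fix i show "j (basis (group_ring G) x i) = basis S x i"
    unfolding basis_def single_def regular_rmodule_simps group_ring_simps by (simp add: j_zero j_one)
qed

lemma linear_ext_zero:
  assumes "right_module S M" "z \<in> carrier (free_rmodule S I)" "\<And>i. i \<in> I \<Longrightarrow> c i = \<zero>\<^bsub>M\<^esub>"
  shows "linear_ext S M c z = \<zero>\<^bsub>M\<^esub>"
proof -
  interpret M: right_module S M by fact
  show ?thesis
    using assms(3) by (intro free_rmodule_hom_eqI[OF M.linear_ext_hom right_module_hom_zero _ assms(2)])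
      (auto simp: M.linear_ext_basis S.right_module_free M.right_module_axioms)
qed

end

text \<open>On cells the double coboundary of c is \<open>linear_ext\<close> of c applied to the
  double boundary, so the vanishing for the integral bar complex gives it for all
  coefficients.\<close>

lemma (in group_module) coboundary_coboundary:
  assumes c: "c \<in> carrier (cochains G k M)"
  shows "coboundary G (Suc k) M (coboundary G k M c) = \<one>\<^bsub>cochains G (Suc (Suc k)) M\<^esub>"
proof -
  interpret B: integral_bar G by unfold_locales
  let ?d = "coboundary G k M c"
  have d: "?d \<in> carrier (cochains G (Suc k) M)" by (rule coboundary_closed[OF c])
  have dd: "coboundary G (Suc k) M ?d \<in> carrier (cochains G (Suc (Suc k)) M)" by (rule coboundary_closed[OF d])
  interpret l: right_module_hom "group_ring G" "B.P k" M "linear_ext (group_ring G) M c"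
    by (intro linear_ext_hom cochain_closed[OF c])
  have "coboundary G (Suc k) M ?d xs = \<zero>\<^bsub>M\<^esub>" if xs: "xs \<in> bar_cells G (Suc (Suc k))" for xs
  proof -
    have b: "basis (group_ring G) xs \<in> carrier (B.P (Suc (Suc k)))" using xs by (rule S.basis_closed)
    have "coboundary G (Suc k) M ?d xs
        = linear_ext (group_ring G) M (coboundary G (Suc k) M ?d) (basis (group_ring G) xs)"
      by (rule linear_ext_cochain[OF dd xs, symmetric])
    also have "\<dots> = linear_ext (group_ring G) M ?d (B.bd (Suc k) (basis (group_ring G) xs))"
      by (simp only: B.linear_ext_bd[OF right_module_axioms d b] coboundary_restrict_id[OF d])
    also have "\<dots> = linear_ext (group_ring G) M c (B.bd k (B.bd (Suc k) (basis (group_ring G) xs)))"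
      by (simp only: B.linear_ext_bd[OF right_module_axioms c B.bd_closed[OF b]] coboundary_restrict_id[OF c])
    also have "\<dots> = \<zero>\<^bsub>M\<^esub>"
      by (simp only: B.boundary_boundary[OF b] l.ah.hom_zero)
    finally show ?thesis .
  qed
  then show ?thesis
    unfolding one_cochains using dd unfolding carrier_cochains
    by (intro extensionalityI[where A = "bar_cells G (Suc (Suc k))"]) (simp_all add: PiE_def)
qed

context group_ring_extension
begin

text \<open>The double boundary over S corresponds to the double coboundary of the universal cochain
  with values in \<open>P k\<close>.\<close>

lemma bd_bd:
  assumes "z \<in> carrier (P (Suc (Suc k)))"
  shows "bd k (bd (Suc k) z) = \<zero>\<^bsub>P k\<^esub>"
proof -
  interpret M: group_module G "restrict_scalars j (P k)" by (rule restrict_module[OF S.right_module_free])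
  have b: "basis_cochain G S k \<in> carrier (cochains G k (restrict_scalars j (P k)))"
    using basis_cochain_closed by (simp add: carrier_cochains)
  have "bd k (bd (Suc k) z) = linear_ext S (P k) (coboundary G (Suc k) (restrict_scalars j (P k))
      (coboundary G k (restrict_scalars j (P k)) (basis_cochain G S k))) z"
    unfolding bar_boundary_def[of G S j k]
    by (rule linear_ext_bd[OF S.right_module_free coboundary_basis_closed assms])
  also have "\<dots> = \<zero>\<^bsub>P k\<^esub>"
    using M.coboundary_coboundary[OF b]
    by (intro linear_ext_zero[OF S.right_module_free assms]) (simp add: one_cochains)
  finally show ?thesis .
qed

text \<open>Extension of scalars is a chain map. Both sides are linear over the group ring, so bar
  cells suffice, and there naturality applies: extension of scalars carries one universal cochain to
  the other.\<close>

lemma extend_scalars_bd: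
  assumes "b \<in> carrier (free_rmodule (group_ring G) (bar_cells G (Suc k)))"
  shows "bd k (\<lambda>xs. j (b xs)) = (\<lambda>xs. j (bar_boundary G (group_ring G) (\<lambda>c. c) k b xs))"
proof -
  interpret B: integral_bar G by unfold_locales
  show ?thesis
  proof (rule free_rmodule_hom_eqI[OF right_module_hom_comp[OF extend_scalars_hom restrict_hom[OF bd_hom]]
        right_module_hom_comp[OF B.bd_hom extend_scalars_hom] _ assms])
    fix xs assume xs: "xs \<in> bar_cells G (Suc k)"
    have eq: "compose (bar_cells G k) (\<lambda>b xs. j (b xs)) (basis_cochain G (group_ring G) k) = basis_cochain G S k"
      by (auto simp: compose_def basis_cochain_def extend_scalars_basis restrict_def)
    have "coboundary G k (restrict_scalars j (P k)) (basis_cochain G S k)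
        = compose (bar_cells G (Suc k)) (\<lambda>b xs. j (b xs)) (coboundary G k (B.P k) (basis_cochain G (group_ring G) k))"
      using coboundary_compose[OF G.group_axioms extend_scalars_hom B.basis_cochain_closed, of k] unfolding eq .
    then have "coboundary G k (restrict_scalars j (P k)) (basis_cochain G S k) xs
        = (\<lambda>ys. j (coboundary G k (B.P k) (basis_cochain G (group_ring G) k) xs ys))"
      using xs by (simp add: compose_eq)
    then show "bd k (\<lambda>ys. j (basis (group_ring G) xs ys)) = (\<lambda>ys. j (B.bd k (basis (group_ring G) xs) ys))"
      using xs by (simp add: extend_scalars_basis bd_basis B.boundary_basis)
  qed
qed

end

section \<open>Cohomology of modules over a flat overring\<close>

lemma hom_free_diff:
  assumes "right_module T P" "h \<in> hom (free_Abelian_group A) (add_monoid P)"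
    and "Poly_Mapping.keys a \<subseteq> A" "Poly_Mapping.keys b \<subseteq> A"
  shows "h (a - b) = h a \<ominus>\<^bsub>P\<^esub> h b"
proof -
  interpret P: right_module T P by fact
  interpret h: group_hom "free_Abelian_group A" "add_monoid P" h
    using assms(2) by (simp add: group_hom_def group_hom_axioms_def P.M.a_group)
  have "h (a + - b) = h a \<oplus>\<^bsub>P\<^esub> h (- b)" using h.hom_mult[of a "- b"] assms(3,4) by simp
  moreover have "h (- b) = \<ominus>\<^bsub>P\<^esub> h b" using h.hom_inv[of b] assms(4) by (simp add: a_inv_def)
  ultimately show ?thesis by (simp add: a_minus_def)
qed

text \<open>The universal property of the tensor product, for maps into P/K and without forming this
  quotient: h induces such a map once it sends the defining relations into K.\<close>

lemma hom_tensor_kernel: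
  assumes sub: "tensor_relations S A N \<subseteq> carrier (free_Abelian_group (carrier A \<times> carrier N))"
    and P: "right_module T P" "right_submodule T P K"
    and h: "h \<in> hom (free_Abelian_group (carrier A \<times> carrier N)) (add_monoid P)"
    and rel: "\<And>z. z \<in> tensor_relations S A N \<Longrightarrow> h z \<in> K"
    and x: "x \<in> tensor_kernel S A N"
  shows "h x \<in> K"
proof -
  interpret P: right_module T P by fact
  let ?F = "free_Abelian_group (carrier A \<times> carrier N)"
  interpret h: group_hom ?F "add_monoid P" h
    using h by (simp add: group_hom_def group_hom_axioms_def P.M.a_group)
  from x show ?thesis
    unfolding tensor_kernel_def
  proof (induction rule: generate.induct)
    case one
    then show ?case using h.hom_one right_submoduleD(2)[OF P(2)] by simp
  next
    case (incl z)
    then show ?case by (rule rel)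
  next
    case (inv z)
    then have "z \<in> carrier ?F" using subsetD[OF sub] by simp
    then have "h (inv\<^bsub>?F\<^esub> z) = \<ominus>\<^bsub>P\<^esub> h z"
      unfolding a_inv_def by (rule h.hom_inv)
    then show ?case using rel[OF inv] P.right_submodule_a_inv[OF P(2)] by simp
  next
    case (eng y z)
    then have "y \<in> carrier ?F" "z \<in> carrier ?F" using h.G.generate_in_carrier[OF sub] by blast+
    then have "h (y \<otimes>\<^bsub>?F\<^esub> z) = h y \<oplus>\<^bsub>P\<^esub> h z"
      using h.hom_mult[of y z] by (simp only: monoid.simps)
    then show ?case using eng right_submoduleD(3)[OF P(2)] by simp
  qed
qed

lemma (in right_module) right_submodule_add_pow:
  assumes "right_submodule S M K" "x \<in> K" shows "add_pow M (k :: int) x \<in> K"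
proof -
  have x: "x \<in> carrier M" using right_submoduleD(1)[OF assms] .
  interpret r: abelian_group_hom S M "ract M x" using x by (rule abelian_group_hom_ract_right)
  have k: "add_pow S k \<one>\<^bsub>S\<^esub> \<in> carrier S" by simp
  have "ract M x (add_pow S k \<one>\<^bsub>S\<^esub>) = add_pow M k x"
    using r.hom_add_pow[of "\<one>\<^bsub>S\<^esub>" k] x by (simp add: ract_one)
  then show ?thesis using right_submoduleD(4)[OF assms k] by (simp only:)
qed

lemma restrict_scalars_minus:
  assumes "ring T" "j \<in> ring_hom T S" "right_module S M" "x \<in> carrier M" "y \<in> carrier M"
  shows "x \<ominus>\<^bsub>restrict_scalars j M\<^esub> y = x \<ominus>\<^bsub>M\<^esub> y"
proof -
  interpret M: right_module S M by fact
  interpret N: right_module T "restrict_scalars j M" by (rule right_module_restrict_scalars) fact+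
  interpret abelian_group_hom M "restrict_scalars j M" "\<lambda>x. x"
    by (intro abelian_group_homI' M.M.abelian_group_axioms N.M.abelian_group_axioms) auto
  show ?thesis using hom_minus assms(4,5) by simp
qed

text \<open>The element type of R is the universe 'u. By \<open>inj\<close> the group ring embeds
  into it, which makes it infinite and large enough for copies of the bar complex.\<close>

locale flat_overring = group_ring_extension G R \<iota>
  for G :: "('g, 'b) monoid_scheme" (structure) and R :: "('u, 'c) ring_scheme" and \<iota> +
  assumes inj: "inj_on \<iota> (carrier (group_ring G))"
    and flat: "flat_left_module TYPE('u) (group_ring G) (as_left_module \<iota> R)"
    and tensor_zero: "trivial_group (tensor (group_ring G) trivial_rmodule (as_left_module \<iota> R))"

sublocale flat_overring \<subseteq> B: integral_bar G
  by unfold_locales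

section \<open>Cardinalities, and exactness of the bar complex over R in degree 0\<close>

context flat_overring
begin

abbreviation N :: "('g \<Rightarrow>\<^sub>0 int, 'u) module" where "N \<equiv> as_left_module \<iota> R"

lemma N_simps [simp]:
  "carrier N = carrier R" "x \<oplus>\<^bsub>N\<^esub> y = x \<oplus>\<^bsub>R\<^esub> y" "s \<odot>\<^bsub>N\<^esub> x = \<iota> s \<otimes>\<^bsub>R\<^esub> x"
  by (simp_all add: as_left_module_def)

lemma left_module_N: "left_module (group_ring G) N"
  using flat by (simp add: flat_left_module_def)

lemma infinite_UNIV: "infinite (UNIV :: 'u set)"
proof
  assume "finite (UNIV :: 'u set)"
  then have "finite (carrier (group_ring G))"
    by (rule finite_imageD[OF finite_subset[OF subset_UNIV] inj])
  moreover have "inj (\<lambda>n :: int. frag_cmul n (frag_of \<one>))"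
  proof (rule injI)
    fix m n :: int assume eq: "frag_cmul m (frag_of \<one>) = frag_cmul n (frag_of \<one>)"
    have "Poly_Mapping.lookup (frag_cmul k (frag_of \<one>)) \<one> = k" for k :: int
      unfolding lookup_frag_cmul by (simp only: lookup_frag_of if_True mult_1_right refl)
    then show "m = n" using eq by metis
  qed
  moreover have "range (\<lambda>n :: int. frag_cmul n (frag_of \<one>)) \<subseteq> carrier (group_ring G)"
    by auto
  ultimately have "finite (UNIV :: int set)"
    by (intro finite_imageD[where A = "UNIV :: int set"]) (rule finite_subset)
  then show False by simp
qed

lemma bar_cells_encoding: obtains d :: "'g list \<Rightarrow> 'u" where "inj_on d (bar_cells G k)"
proof -
  have "inj_on (\<lambda>g. \<iota> (frag_of g)) (carrier G)"
    by (rule inj_onI) (auto dest!: inj_onD[OF inj] simp: frag_of_eq)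
  then have "carrier G \<lesssim> (UNIV :: 'u set)" by (auto simp: lepoll_def)
  then have "lists (carrier G) \<lesssim> lists (UNIV :: 'u set)" by (rule lists_lepoll_mono)
  moreover have "lists (UNIV :: 'u set) \<approx> (UNIV :: 'u set)"
    using card_of_lists_infinite[OF infinite_UNIV] by (simp add: eqpoll_iff_card_of_ordIso)
  ultimately have "lists (carrier G) \<lesssim> (UNIV :: 'u set)" by (rule lepoll_trans2)
  then obtain d :: "'g list \<Rightarrow> 'u" where "inj_on d (lists (carrier G))" by (auto simp: lepoll_def)
  moreover have "bar_cells G k \<subseteq> lists (carrier G)" by (auto simp: bar_cells_def)
  ultimately show ?thesis using that inj_on_subset by blast
qed

lemma free_encoding:
  assumes "inj_on (d :: 'i \<Rightarrow> 'u) I"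
  obtains e :: "('i \<Rightarrow> 'g \<Rightarrow>\<^sub>0 int) \<Rightarrow> 'u" where "inj_on e (carrier (free_rmodule (group_ring G) I))"
  using finite_support_encoding[OF infinite_UNIV assms inj, of 0]
  by (auto simp: free_rmodule_def carrier_direct_sum)

lemma scalar_extension_hom:
  "right_module_hom (group_ring G) (B.P k) (restrict_scalars \<iota> (P k)) (\<lambda>b xs. \<iota> (b xs))"
  by (rule extend_scalars_hom)

lemma scalar_extension_closed:
  assumes "b \<in> carrier (B.P k)" shows "(\<lambda>xs. \<iota> (b xs)) \<in> carrier (P k)"
proof -
  interpret E: right_module_hom "group_ring G" "B.P k" "restrict_scalars \<iota> (P k)" "\<lambda>b xs. \<iota> (b xs)"
    by (rule scalar_extension_hom)
  show ?thesis using E.ah.hom_closed[OF assms] by simp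
qed

lemma \<iota>_minus:
  assumes "Poly_Mapping.keys s \<subseteq> carrier G" "Poly_Mapping.keys t \<subseteq> carrier G"
  shows "\<iota> (s - t) = \<iota> s \<ominus>\<^bsub>R\<^esub> \<iota> t"
proof -
  interpret abelian_group_hom "group_ring G" R \<iota>
    using ring_hom_add[OF j_hom]
    by (intro abelian_group_homI' ZG.abelian_group_axioms S.abelian_group_axioms) (auto simp: j_closed)
  have "\<ominus>\<^bsub>group_ring G\<^esub> t = - t" using assms(2) by (intro ZG.minus_equality) auto
  then have "s \<ominus>\<^bsub>group_ring G\<^esub> t = s - t" by (simp add: a_minus_def)
  then show ?thesis using hom_minus[of s t] assms by simp
qed

lemma scalar_extension_minus:
  assumes "b \<in> carrier (B.P k)" "c \<in> carrier (B.P k)"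
  shows "(\<lambda>xs. \<iota> ((b \<ominus>\<^bsub>B.P k\<^esub> c) xs)) = (\<lambda>xs. \<iota> (b xs)) \<ominus>\<^bsub>P k\<^esub> (\<lambda>xs. \<iota> (c xs))"
proof -
  interpret E: right_module_hom "group_ring G" "B.P k" "restrict_scalars \<iota> (P k)" "\<lambda>b xs. \<iota> (b xs)"
    by (rule scalar_extension_hom)
  show ?thesis
    using E.ah.hom_minus[OF assms] restrict_scalars_minus[OF ZG.ring_axioms j_hom S.right_module_free
        scalar_extension_closed[OF assms(1)] scalar_extension_closed[OF assms(2)]] by simp
qed

lemma scalar_extension_ract:
  assumes "b \<in> carrier (B.P k)" "Poly_Mapping.keys s \<subseteq> carrier G"
  shows "(\<lambda>xs. \<iota> (ract (B.P k) b s xs)) = ract (P k) (\<lambda>xs. \<iota> (b xs)) (\<iota> s)"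
proof -
  interpret E: right_module_hom "group_ring G" "B.P k" "restrict_scalars \<iota> (P k)" "\<lambda>b xs. \<iota> (b xs)"
    by (rule scalar_extension_hom)
  show ?thesis using E.hom_ract[of b s] assms by simp
qed

text \<open>Since \<open>P 0 = R\<close>, the cokernel of \<open>P 1 \<rightarrow> P 0\<close> is \<open>\<int> \<otimes> R\<close>.\<close>

lemma bd_surj:
  assumes z: "z \<in> carrier (P 0)"
  shows "z \<in> bd 0 ` carrier (P (Suc 0))"
proof -
  interpret bd: right_module_hom R "P (Suc 0)" "P 0" "bd 0" by (rule bd_hom)
  let ?Im = "bd 0 ` carrier (P (Suc 0))"
  have Im: "right_submodule R (P 0) ?Im" by (rule bd.right_submodule_image)
  let ?T = "trivial_rmodule :: ('g \<Rightarrow>\<^sub>0 int, int) rmodule"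
  let ?F = "free_Abelian_group (carrier ?T \<times> carrier N)"
  let ?K = "tensor_kernel (group_ring G) ?T N"
  have T [simp]: "carrier ?T = UNIV" "x \<oplus>\<^bsub>?T\<^esub> y = x + y" "ract ?T x s = x * augmentation s" for x y s
    by (simp_all add: trivial_rmodule_def augmentation_def)
  \<comment> \<open>The element of \<open>P 0\<close> that corresponds to r when \<open>P 0\<close>
    is identified with R by its only cell [].\<close>
  define gen where "gen r = ract (P 0) (basis R []) r" for r
  have b: "basis R [] \<in> carrier (P 0)" by (rule S.basis_closed) simp
  have gen: "gen r \<in> carrier (P 0)" if "r \<in> carrier R" for r
    unfolding gen_def using b that by (rule bd.N.ract_closed)
  have gen_add: "gen (r \<oplus>\<^bsub>R\<^esub> t) = gen r \<oplus>\<^bsub>P 0\<^esub> gen t" if "r \<in> carrier R" "t \<in> carrier R" for r t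
    unfolding gen_def using b that by (rule bd.N.ract_add_right)
  have "(\<lambda>(m, r). add_pow (P 0) m (gen r)) ` (carrier ?T \<times> carrier N) \<subseteq> carrier (add_monoid (P 0))"
    using gen by auto
  \<comment> \<open>h sends the pair (m, r) to m times \<open>gen r\<close>. It will induce a map
    from the tensor product of the trivial module and R to the cokernel of
    \<open>bd 0\<close>.\<close>
  from comm_group.free_Abelian_group_universal[OF bd.N.M.a_comm_group this]
  obtain h where h: "h \<in> hom ?F (add_monoid (P 0))"
    "\<And>p. p \<in> carrier ?T \<times> carrier N \<Longrightarrow> h (frag_of p) = (case p of (m, r) \<Rightarrow> add_pow (P 0) m (gen r))"
    by blast
  have h_of: "h (frag_of (m, r)) = add_pow (P 0) m (gen r)" if "r \<in> carrier R" for m r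
    using h(2)[of "(m, r)"] that by simp
  \<comment> \<open>Compatibility with the action of s in the middle of a tensor. The expression is
    additive in s, and for a group element g it is \<open>bd 0\<close> of the cell [g], multiplied
    by r.\<close>
  have step: "add_pow (P 0) (augmentation s) (gen r) \<ominus>\<^bsub>P 0\<^esub> gen (\<iota> s \<otimes>\<^bsub>R\<^esub> r) \<in> ?Im"
    if s: "Poly_Mapping.keys s \<subseteq> carrier G" and r: "r \<in> carrier R" for s r
  proof -
    from s have "Poly_Mapping.keys s \<subseteq> carrier G \<and>
      add_pow (P 0) (augmentation s) (gen r) \<ominus>\<^bsub>P 0\<^esub> gen (\<iota> s \<otimes>\<^bsub>R\<^esub> r) \<in> ?Im"
    proof (induction s rule: frag_induction)
      case zero
      have "gen \<zero>\<^bsub>R\<^esub> = \<zero>\<^bsub>P 0\<^esub>" unfolding gen_def using b by (rule bd.N.ract_zero_right)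
      then show ?case
        using right_submoduleD(2)[OF Im] r by (simp add: j_zero add_pow_int_0 bd.N.M.minus_zero_right)
    next
      case (one g)
      have bg: "basis (group_ring G) [] \<in> carrier (B.P 0)" "basis (group_ring G) [g] \<in> carrier (B.P (Suc 0))"
        using one by (auto intro!: ZG.basis_closed simp: bar_cells_def)
      have rg: "ract (B.P 0) (basis (group_ring G) []) (frag_of g) \<in> carrier (B.P 0)"
        using bg(1) one by (intro right_module.ract_closed[OF B.right_module_P]) auto
      have "bd 0 (basis R [g]) = basis R [] \<ominus>\<^bsub>P 0\<^esub> ract (P 0) (basis R []) (\<iota> (frag_of g))"
        using extend_scalars_bd[OF bg(2)] one
        by (simp only: extend_scalars_basis B.boundary_basis_0 scalar_extension_minus[OF bg(1) rg])
          (simp add: scalar_extension_ract[OF bg(1)] extend_scalars_basis)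
      then have "ract (P 0) (bd 0 (basis R [g])) r = gen r \<ominus>\<^bsub>P 0\<^esub> gen (\<iota> (frag_of g) \<otimes>\<^bsub>R\<^esub> r)"
        unfolding gen_def using b one r
        by (simp add: bd.N.ract_minus bd.N.ract_closed j_closed bd.N.ract_mult)
      moreover have "ract (P 0) (bd 0 (basis R [g])) r \<in> ?Im"
        using one r by (intro right_submoduleD(4)[OF Im] imageI S.basis_closed) (auto simp: bar_cells_def)
      ultimately show ?case using one gen[OF r] by simp
    next
      case (diff s t)
      have jm: "\<iota> (s - t) = \<iota> s \<ominus>\<^bsub>R\<^esub> \<iota> t" using diff by (intro \<iota>_minus) auto
      have st: "\<iota> s \<in> carrier R" "\<iota> t \<in> carrier R" using diff by (simp_all add: j_closed)
      have "gen (\<iota> (s - t) \<otimes>\<^bsub>R\<^esub> r) = gen (\<iota> s \<otimes>\<^bsub>R\<^esub> r) \<ominus>\<^bsub>P 0\<^esub> gen (\<iota> t \<otimes>\<^bsub>R\<^esub> r)"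
        using st r abelian_group_hom.hom_minus[OF bd.N.abelian_group_hom_ract_right[OF b]]
        by (simp add: jm gen_def a_minus_def S.l_distr S.l_minus)
      moreover have "add_pow (P 0) (augmentation (s - t)) (gen r)
          = add_pow (P 0) (augmentation s) (gen r) \<ominus>\<^bsub>P 0\<^esub> add_pow (P 0) (augmentation t) (gen r)"
        using gen[OF r] bd.N.M.add.int_pow_diff[of "gen r"] by (simp add: a_minus_def a_inv_def)
      ultimately have "add_pow (P 0) (augmentation (s - t)) (gen r) \<ominus>\<^bsub>P 0\<^esub> gen (\<iota> (s - t) \<otimes>\<^bsub>R\<^esub> r)
        = (add_pow (P 0) (augmentation s) (gen r) \<ominus>\<^bsub>P 0\<^esub> gen (\<iota> s \<otimes>\<^bsub>R\<^esub> r))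
          \<ominus>\<^bsub>P 0\<^esub> (add_pow (P 0) (augmentation t) (gen r) \<ominus>\<^bsub>P 0\<^esub> gen (\<iota> t \<otimes>\<^bsub>R\<^esub> r))"
        using gen st r by (simp add: bd.N.M.minus_minus_minus)
      then show ?case
        using diff bd.N.right_submodule_minus[OF Im] by (auto dest!: subsetD[OF keys_diff])
    qed
    then show ?thesis ..
  qed
  have sub: "tensor_relations (group_ring G) ?T N \<subseteq> carrier ?F"
    by (auto simp: tensor_relations_def j_closed dest!: subsetD[OF keys_diff])
  have h_diff: "h (a - b) = h a \<ominus>\<^bsub>P 0\<^esub> h b"
    if "Poly_Mapping.keys a \<subseteq> UNIV \<times> carrier R" "Poly_Mapping.keys b \<subseteq> UNIV \<times> carrier R" for a b
    using hom_free_diff[OF bd.N.right_module_axioms h(1)] that by simp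
  have rel: "h y \<in> ?Im" if y: "y \<in> tensor_relations (group_ring G) ?T N" for y
  proof -
    from y consider
        (left) m m' r where "y = frag_of (m + m', r) - frag_of (m, r) - frag_of (m', r)" "r \<in> carrier R"
      | (right) m r r' where "y = frag_of (m, r \<oplus>\<^bsub>R\<^esub> r') - frag_of (m, r) - frag_of (m, r')"
          "r \<in> carrier R" "r' \<in> carrier R"
      | (middle) m s r where "y = frag_of (m * augmentation s, r) - frag_of (m, \<iota> s \<otimes>\<^bsub>R\<^esub> r)"
          "Poly_Mapping.keys s \<subseteq> carrier G" "r \<in> carrier R"
      by (auto simp: tensor_relations_def)
    then show ?thesis
    proof cases
      case (left m m' r)
      have "Poly_Mapping.keys (frag_of (m + m', r) - frag_of (m, r)) \<subseteq> UNIV \<times> carrier R"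
        using left by (auto dest!: subsetD[OF keys_diff])
      then have "h y = add_pow (P 0) (m + m') (gen r) \<ominus>\<^bsub>P 0\<^esub> add_pow (P 0) m (gen r) \<ominus>\<^bsub>P 0\<^esub> add_pow (P 0) m' (gen r)"
        using left by (simp add: h_diff h_of)
      also have "\<dots> = \<zero>\<^bsub>P 0\<^esub>"
        using gen[OF left(2)] by (simp add: bd.N.add.int_pow_mult bd.N.M.add_minus_cancel(2))
      finally show ?thesis using right_submoduleD(2)[OF Im] by simp
    next
      case (right m r r')
      have "Poly_Mapping.keys (frag_of (m, r \<oplus>\<^bsub>R\<^esub> r') - frag_of (m, r)) \<subseteq> UNIV \<times> carrier R"
        using right by (auto dest!: subsetD[OF keys_diff])
      then have "h y = add_pow (P 0) m (gen (r \<oplus>\<^bsub>R\<^esub> r')) \<ominus>\<^bsub>P 0\<^esub> add_pow (P 0) m (gen r) \<ominus>\<^bsub>P 0\<^esub> add_pow (P 0) m (gen r')"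
        using right by (simp add: h_diff h_of)
      also have "\<dots> = \<zero>\<^bsub>P 0\<^esub>"
        using gen[OF right(2)] gen[OF right(3)] right
        by (simp add: gen_add bd.N.add.int_pow_distrib bd.N.M.add_minus_cancel(2))
      finally show ?thesis using right_submoduleD(2)[OF Im] by simp
    next
      case (middle m s r)
      have "h y = add_pow (P 0) (m * augmentation s) (gen r) \<ominus>\<^bsub>P 0\<^esub> add_pow (P 0) m (gen (\<iota> s \<otimes>\<^bsub>R\<^esub> r))"
        using middle by (simp add: h_diff h_of j_closed)
      also have "\<dots> = add_pow (P 0) m (add_pow (P 0) (augmentation s) (gen r) \<ominus>\<^bsub>P 0\<^esub> gen (\<iota> s \<otimes>\<^bsub>R\<^esub> r))"
        using gen middle
        by (simp add: abelian_group_hom.hom_minus[OF bd.N.M.add_pow_hom] bd.N.add.int_pow_pow j_closed mult.commute)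
      finally show ?thesis using step[OF middle(2,3)] bd.N.right_submodule_add_pow[OF Im] by simp
    qed
  qed
  \<comment> \<open>A trivial tensor product has only one coset, so every formal sum lies in the
    subgroup of relations.\<close>
  have kernel: "x \<in> ?K" if x: "x \<in> carrier ?F" for x
  proof -
    interpret F: group ?F by simp
    have K: "?K \<subseteq> carrier ?F" unfolding tensor_kernel_def by (rule F.generate_incl[OF sub])
    have "0 \<in> ?K" unfolding tensor_kernel_def using generate.one[of ?F] by simp
    then have "x \<in> ?K #>\<^bsub>?F\<^esub> x" by (force simp: r_coset_def)
    moreover have "?K #>\<^bsub>?F\<^esub> x \<in> carrier (tensor (group_ring G) ?T N)"
      using F.rcosetsI[OF K x] by (simp add: tensor_def FactGroup_def)
    then have "?K #>\<^bsub>?F\<^esub> x = ?K"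
      using tensor_zero by (simp add: trivial_group_def tensor_def FactGroup_def)
    ultimately show ?thesis by simp
  qed
  have z0: "z [] \<in> carrier R" using z by (simp add: free_rmodule_def carrier_direct_sum)
  \<comment> \<open>The tensor of 1 and z [] is mapped to z, and it is zero.\<close>
  then have "h (frag_of (1, z [])) \<in> ?Im"
    by (intro hom_tensor_kernel[OF sub bd.N.right_module_axioms Im h(1) rel] kernel) auto
  moreover have "h (frag_of (1, z [])) = z"
  proof -
    have "z = single (regular_rmodule R) [] (z [])"
      unfolding single_def regular_rmodule_simps
      using z by (auto simp: free_rmodule_def carrier_direct_sum bar_cells_0)
    also have "\<dots> = gen (z [])" unfolding gen_def by (rule S.single_eq_ract_basis[OF z0])
    finally show ?thesis using h_of[OF z0, of 1] gen[OF z0] by simp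
  qed
  ultimately show ?thesis by simp
qed

end

section \<open>Exactness in positive degrees, splitting, and vanishing of cohomology over R\<close>

context flat_overring
begin

text \<open>On representatives, the inverse of the isomorphism from the tensor product of
  \<open>B.P k\<close> and R to \<open>P k\<close>. It shows that a tensor is zero once its image in
  \<open>P k\<close> is zero.\<close>

definition normal_form :: "('g list \<Rightarrow> 'u) \<Rightarrow> (('g list \<Rightarrow> 'g \<Rightarrow>\<^sub>0 int) \<times> 'u) \<Rightarrow>\<^sub>0 int"
  where "normal_form y = (\<Sum>ys\<in>{ys. y ys \<noteq> \<zero>\<^bsub>R\<^esub>}. frag_of (basis (group_ring G) ys, y ys))"

abbreviation K :: "nat \<Rightarrow> (('g list \<Rightarrow> 'g \<Rightarrow>\<^sub>0 int) \<times> 'u \<Rightarrow>\<^sub>0 int) set"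
  where "K k \<equiv> tensor_kernel (group_ring G) (B.P k) N"

lemma K_closed:
  shows "0 \<in> K k" "\<lbrakk>a \<in> K k; b \<in> K k\<rbrakk> \<Longrightarrow> a + b \<in> K k" "a \<in> K k \<Longrightarrow> - a \<in> K k"
    "\<lbrakk>a \<in> K k; b \<in> K k\<rbrakk> \<Longrightarrow> a - b \<in> K k"
proof -
  interpret subgroup "K k" "free_Abelian_group (carrier (B.P k) \<times> carrier N)"
    by (rule tensor_kernel_subgroup[OF B.right_module_P left_module_N])
  show z: "0 \<in> K k" using one_closed by simp
  show p: "a + b \<in> K k" if "a \<in> K k" "b \<in> K k" for a b using m_closed[OF that] by simp
  show m: "- a \<in> K k" if "a \<in> K k" for a using m_inv_closed[OF that] mem_carrier[OF that] by simp
  show "a \<in> K k \<Longrightarrow> b \<in> K k \<Longrightarrow> a - b \<in> K k" using p[of a "- b"] m[of b] by simp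
qed

lemma K_sum: "(\<And>i. i \<in> I \<Longrightarrow> f i \<in> K k) \<Longrightarrow> sum f I \<in> K k"
  by (induction I rule: infinite_finite_induct) (simp_all add: K_closed)

lemma K_relations:
  "\<lbrakk>x \<in> carrier (B.P k); x' \<in> carrier (B.P k); y \<in> carrier R\<rbrakk> \<Longrightarrow>
    frag_of (x \<oplus>\<^bsub>B.P k\<^esub> x', y) - frag_of (x, y) - frag_of (x', y) \<in> K k"
  "\<lbrakk>x \<in> carrier (B.P k); y \<in> carrier R; y' \<in> carrier R\<rbrakk> \<Longrightarrow>
    frag_of (x, y \<oplus>\<^bsub>R\<^esub> y') - frag_of (x, y) - frag_of (x, y') \<in> K k"
  "\<lbrakk>x \<in> carrier (B.P k); Poly_Mapping.keys s \<subseteq> carrier G; y \<in> carrier R\<rbrakk> \<Longrightarrow>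
    frag_of (ract (B.P k) x s, y) - frag_of (x, \<iota> s \<otimes>\<^bsub>R\<^esub> y) \<in> K k"
proof -
  have rel: "z \<in> K k" if "z \<in> tensor_relations (group_ring G) (B.P k) N" for z
    unfolding tensor_kernel_def using that by (rule generate.incl)
  show "frag_of (x \<oplus>\<^bsub>B.P k\<^esub> x', y) - frag_of (x, y) - frag_of (x', y) \<in> K k"
    if "x \<in> carrier (B.P k)" "x' \<in> carrier (B.P k)" "y \<in> carrier R"
  proof (rule rel)
    show "frag_of (x \<oplus>\<^bsub>B.P k\<^esub> x', y) - frag_of (x, y) - frag_of (x', y) \<in> tensor_relations (group_ring G) (B.P k) N"
      unfolding tensor_relations_def N_simps using that by blast
  qed
  show "frag_of (x, y \<oplus>\<^bsub>R\<^esub> y') - frag_of (x, y) - frag_of (x, y') \<in> K k"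
    if "x \<in> carrier (B.P k)" "y \<in> carrier R" "y' \<in> carrier R"
  proof (rule rel)
    show "frag_of (x, y \<oplus>\<^bsub>R\<^esub> y') - frag_of (x, y) - frag_of (x, y') \<in> tensor_relations (group_ring G) (B.P k) N"
      unfolding tensor_relations_def N_simps using that by blast
  qed
  show "frag_of (ract (B.P k) x s, y) - frag_of (x, \<iota> s \<otimes>\<^bsub>R\<^esub> y) \<in> K k"
    if "x \<in> carrier (B.P k)" "Poly_Mapping.keys s \<subseteq> carrier G" "y \<in> carrier R"
  proof (rule rel)
    have "s \<in> carrier (group_ring G)" using that by simp
    then show "frag_of (ract (B.P k) x s, y) - frag_of (x, \<iota> s \<otimes>\<^bsub>R\<^esub> y) \<in> tensor_relations (group_ring G) (B.P k) N"
      unfolding tensor_relations_def N_simps using that by blast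
  qed
qed

lemma K_zero:
  shows "b \<in> carrier (B.P k) \<Longrightarrow> frag_of (b, \<zero>\<^bsub>R\<^esub>) \<in> K k"
    "r \<in> carrier R \<Longrightarrow> frag_of (\<zero>\<^bsub>B.P k\<^esub>, r) \<in> K k"
proof -
  interpret Q: right_module "group_ring G" "B.P k" by (rule B.right_module_P)
  show "frag_of (b, \<zero>\<^bsub>R\<^esub>) \<in> K k" if "b \<in> carrier (B.P k)"
    using K_closed(3)[OF K_relations(2)[OF that S.zero_closed S.zero_closed]] by simp
  show "frag_of (\<zero>\<^bsub>B.P k\<^esub>, r) \<in> K k" if "r \<in> carrier R"
    using K_closed(3)[OF K_relations(1)[OF Q.M.zero_closed Q.M.zero_closed that]] Q.M.l_zero[OF Q.M.zero_closed]
    by (simp del: B.add_B B.zero_B)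
qed

text \<open>The terms outside the support have second component zero and so lie in
  \<open>K k\<close>.\<close>

lemma normal_form_superset:
  assumes "finite A" "A \<subseteq> bar_cells G k" "{ys. y ys \<noteq> \<zero>\<^bsub>R\<^esub>} \<subseteq> A"
  shows "(\<Sum>ys\<in>A. frag_of (basis (group_ring G) ys, y ys)) - normal_form y \<in> K k"
proof -
  have "(\<Sum>ys\<in>A. frag_of (basis (group_ring G) ys, y ys)) - normal_form y
      = (\<Sum>ys\<in>A - {ys. y ys \<noteq> \<zero>\<^bsub>R\<^esub>}. frag_of (basis (group_ring G) ys, y ys))"
    unfolding normal_form_def
    by (simp only: sum.subset_diff[OF assms(3,1), where g = "\<lambda>ys. frag_of (basis (group_ring G) ys, y ys)"] add_diff_cancel_right')
  also have "\<dots> \<in> K k"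
    using assms(2) by (intro K_sum) (auto intro!: K_zero(1) ZG.basis_closed)
  finally show ?thesis .
qed

lemma normal_form_add:
  assumes y: "y \<in> carrier (P k)" and z: "z \<in> carrier (P k)"
  shows "normal_form (y \<oplus>\<^bsub>P k\<^esub> z) - normal_form y - normal_form z \<in> K k"
proof -
  let ?A = "{ys. y ys \<noteq> \<zero>\<^bsub>R\<^esub>} \<union> {ys. z ys \<noteq> \<zero>\<^bsub>R\<^esub>}"
  let ?s = "\<lambda>x. \<Sum>ys\<in>?A. frag_of (basis (group_ring G) ys, x ys)"
  have A: "finite ?A" "?A \<subseteq> bar_cells G k" and c: "y ys \<in> carrier R" "z ys \<in> carrier R" for ys
    using y z by (auto simp: free_rmodule_def carrier_direct_sum)
  have p: "y \<oplus>\<^bsub>P k\<^esub> z = (\<lambda>ys. y ys \<oplus>\<^bsub>R\<^esub> z ys)" by (simp add: free_rmodule_def)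
  have 1: "?s (y \<oplus>\<^bsub>P k\<^esub> z) - ?s y - ?s z \<in> K k"
    unfolding p sum_subtractf[symmetric]
    using A(2) by (intro K_sum K_relations(2) c ZG.basis_closed) auto
  have 2: "?s (y \<oplus>\<^bsub>P k\<^esub> z) - normal_form (y \<oplus>\<^bsub>P k\<^esub> z) \<in> K k" "?s y - normal_form y \<in> K k"
    "?s z - normal_form z \<in> K k"
    using A by (intro normal_form_superset; auto simp: p)+
  have "(?s (y \<oplus>\<^bsub>P k\<^esub> z) - ?s y - ?s z) - (?s (y \<oplus>\<^bsub>P k\<^esub> z) - normal_form (y \<oplus>\<^bsub>P k\<^esub> z))
      + (?s y - normal_form y) + (?s z - normal_form z) \<in> K k"
    by (rule K_closed(2)[OF K_closed(2)[OF K_closed(4)[OF 1 2(1)] 2(2)] 2(3)])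
  then show ?thesis by (simp add: algebra_simps)
qed

text \<open>For a generator [xs]g the relation in the middle of the tensor moves g over to r, which
  leaves the single term with [xs] and the product \<iota> g r. Everything else is additive modulo
  \<open>K k\<close>.\<close>

lemma normal_form_tensor:
  assumes b: "b \<in> carrier (B.P k)" and r: "r \<in> carrier R"
  shows "frag_of (b, r) - normal_form (ract (P k) (\<lambda>xs. \<iota> (b xs)) r) \<in> K k"
proof -
  interpret P: right_module R "P k" by (rule S.right_module_free)
  interpret Q: right_module "group_ring G" "B.P k" by (rule B.right_module_P)
  from b show ?thesis
  proof (induction rule: B.P_induct)
    case zero
    have "ract (P k) (\<lambda>xs. \<zero>\<^bsub>R\<^esub>) r = (\<lambda>xs. \<zero>\<^bsub>R\<^esub>)"
      using P.ract_zero_left[OF r] by (simp add: free_rmodule_def)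
    then have "normal_form (ract (P k) (\<lambda>xs. \<iota> 0) r) = 0" by (simp add: j_zero normal_form_def)
    then show ?case using K_zero(2)[OF r, of k] by simp
  next
    case (generator xs g)
    let ?b = "basis (group_ring G) xs"
    let ?y = "ract (P k) (\<lambda>ys. \<iota> (ract (B.P k) ?b (frag_of g) ys)) r"
    have g: "Poly_Mapping.keys (frag_of g) \<subseteq> carrier G" "\<iota> (frag_of g) \<in> carrier R"
      using generator by (auto simp: j_closed)
    have bc: "?b \<in> carrier (B.P k)" using generator by (intro ZG.basis_closed)
    have "?y = ract (P k) (basis R xs) (\<iota> (frag_of g) \<otimes>\<^bsub>R\<^esub> r)"
      unfolding scalar_extension_ract[OF bc g(1)] extend_scalars_basis
      using generator g r by (intro P.ract_mult[symmetric] S.basis_closed)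
    also have "\<dots> = single (regular_rmodule R) xs (\<iota> (frag_of g) \<otimes>\<^bsub>R\<^esub> r)"
      using g r by (intro S.single_eq_ract_basis[symmetric]) simp
    finally have y: "?y = (\<lambda>ys. if ys = xs then \<iota> (frag_of g) \<otimes>\<^bsub>R\<^esub> r else \<zero>\<^bsub>R\<^esub>)"
      unfolding single_def regular_rmodule_simps .
    have "frag_of (?b, \<iota> (frag_of g) \<otimes>\<^bsub>R\<^esub> r) - normal_form ?y \<in> K k"
    proof -
      have "{ys. ?y ys \<noteq> \<zero>\<^bsub>R\<^esub>} \<subseteq> {xs}" unfolding y by auto
      then show ?thesis using normal_form_superset[of "{xs}" k ?y] generator(1) by (simp add: y)
    qed
    from K_closed(2)[OF K_relations(3)[OF bc g(1) r] this] show ?case by simp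
  next
    case (minus b c)
    let ?E = "\<lambda>b. ract (P k) (\<lambda>xs. \<iota> (b xs)) r"
    let ?d = "b \<ominus>\<^bsub>B.P k\<^esub> c"
    have d: "?d \<in> carrier (B.P k)" using minus by simp
    have E: "?E b \<in> carrier (P k)" if "b \<in> carrier (B.P k)" for b
      using that r by (intro P.ract_closed scalar_extension_closed)
    have "?E ?d = ?E b \<ominus>\<^bsub>P k\<^esub> ?E c"
      unfolding scalar_extension_minus[OF minus(1,2)]
      using minus r by (intro P.ract_minus scalar_extension_closed)
    then have "?E ?d \<oplus>\<^bsub>P k\<^esub> ?E c = ?E b"
      using E[OF minus(1)] E[OF minus(2)] by (simp add: a_minus_def P.M.a_assoc P.M.l_neg)
    then have 1: "normal_form (?E b) - normal_form (?E ?d) - normal_form (?E c) \<in> K k"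
      using normal_form_add[OF E[OF d] E[OF minus(2)]] by simp
    have "?d \<oplus>\<^bsub>B.P k\<^esub> c = b"
      using minus by (simp add: a_minus_def Q.M.a_assoc Q.M.l_neg del: B.add_B B.zero_B)
    then have 2: "frag_of (b, r) - frag_of (?d, r) - frag_of (c, r) \<in> K k"
      using K_relations(1)[OF d minus(2) r] by simp
    have "(normal_form (?E b) - normal_form (?E ?d) - normal_form (?E c))
        - (frag_of (b, r) - frag_of (?d, r) - frag_of (c, r))
        + (frag_of (b, r) - normal_form (?E b)) - (frag_of (c, r) - normal_form (?E c)) \<in> K k"
      by (rule K_closed(4)[OF K_closed(2)[OF K_closed(4)[OF 1 2] minus(3)] minus(4)])
    then show ?case by (simp add: algebra_simps)
  qed
qed

text \<open>Let \<open>I\<close> be the image of the boundary of the integral complex. A cycle \<open>z\<close> lifts to a chain \<open>c\<close> of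
  \<open>I \<otimes> R\<close> that vanishes in \<open>B.P k \<otimes> R\<close>, hence in \<open>I \<otimes> R\<close> by flatness. As the integral complex is
  exact, lifting along its boundary defines a homomorphism \<open>h\<close> from \<open>I \<otimes> R\<close> to the cokernel of the
  boundary into \<open>P (k + 1)\<close>, and \<open>h\<close> maps the class of \<open>c\<close> to that of \<open>z\<close>.\<close>

lemma bd_exact:
  assumes z: "z \<in> carrier (P (Suc k))" "bd k z = \<zero>\<^bsub>P k\<^esub>"
  shows "z \<in> bd (Suc k) ` carrier (P (Suc (Suc k)))"
proof -
  interpret bd: right_module_hom R "P (Suc k)" "P k" "bd k" by (rule bd_hom)
  interpret bd': right_module_hom R "P (Suc (Suc k))" "P (Suc k)" "bd (Suc k)" by (rule bd_hom)
  interpret bB: right_module_hom "group_ring G" "B.P (Suc k)" "B.P k" "B.bd k" by (rule B.bd_hom)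
  let ?Im = "bd (Suc k) ` carrier (P (Suc (Suc k)))"
  have Im: "right_submodule R (P (Suc k)) ?Im" by (rule bd'.right_submodule_image)
  let ?I = "B.bd k ` carrier (B.P (Suc k))"
  have I: "right_submodule (group_ring G) (B.P k) ?I" by (rule bB.right_submodule_image)
  let ?A = "(B.P k)\<lparr>carrier := ?I\<rparr>"
  have A: "right_module (group_ring G) ?A" by (rule bB.N.right_module_submodule[OF I])
  let ?F = "free_Abelian_group (carrier ?A \<times> carrier N)"
  \<comment> \<open>The element of \<open>P (Suc k)\<close> that corresponds to the tensor of b and
    r.\<close>
  define E where "E b r = ract (P (Suc k)) (\<lambda>xs. \<iota> (b xs)) r" for b r
  have E: "E b r \<in> carrier (P (Suc k))" if "b \<in> carrier (B.P (Suc k))" "r \<in> carrier R" for b r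
    unfolding E_def using that by (intro bd.M.ract_closed scalar_extension_closed)
  have E_minus: "E b r \<ominus>\<^bsub>P (Suc k)\<^esub> E b' r = E (b \<ominus>\<^bsub>B.P (Suc k)\<^esub> b') r"
    if "b \<in> carrier (B.P (Suc k))" "b' \<in> carrier (B.P (Suc k))" "r \<in> carrier R" for b b' r
    unfolding E_def scalar_extension_minus[OF that(1,2)]
    using that by (intro bd.M.ract_minus[symmetric] scalar_extension_closed)
  \<comment> \<open>Modulo boundaries \<open>E b r\<close> depends only on \<open>B.bd k b\<close>
    and r: if b and b' have the same boundary, integral exactness makes their difference the
    boundary of some w, and then the difference of values is the boundary of the element given by w
    and r.\<close>
  have E_cong: "E b r \<ominus>\<^bsub>P (Suc k)\<^esub> E b' r \<in> ?Im"
    if b: "b \<in> carrier (B.P (Suc k))" "b' \<in> carrier (B.P (Suc k))" "B.bd k b = B.bd k b'" and r: "r \<in> carrier R" for b b' r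
  proof -
    have "B.bd k (b \<ominus>\<^bsub>B.P (Suc k)\<^esub> b') = \<zero>\<^bsub>B.P k\<^esub>"
      unfolding bB.ah.hom_minus[OF b(1,2)] b(3) unfolding a_minus_def
      by (rule bB.N.M.r_neg[OF bB.ah.hom_closed[OF b(2)]])
    from B.bar_exact[OF bB.M.M.minus_closed[OF b(1,2)] this]
    obtain w where w: "w \<in> carrier (B.P (Suc (Suc k)))" "B.bd (Suc k) w = b \<ominus>\<^bsub>B.P (Suc k)\<^esub> b'" .
    have eq: "E (b \<ominus>\<^bsub>B.P (Suc k)\<^esub> b') r = ract (P (Suc k)) (bd (Suc k) (\<lambda>xs. \<iota> (w xs))) r"
      unfolding E_def extend_scalars_bd[OF w(1)] w(2) ..
    show ?thesis
      unfolding E_minus[OF b(1,2) r] eq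
      using w(1) r by (intro right_submoduleD(4)[OF Im] imageI scalar_extension_closed)
  qed
  \<comment> \<open>An arbitrary choice of preimages. By \<open>E_cong\<close> it does not matter
    modulo \<open>?Im\<close>, which is why h respects the tensor relations although
    \<open>lift\<close> is not additive.\<close>
  define lift where "lift = inv_into (carrier (B.P (Suc k))) (B.bd k)"
  have lift: "lift x \<in> carrier (B.P (Suc k))" "B.bd k (lift x) = x" if "x \<in> ?I" for x
    unfolding lift_def using that by (simp_all add: inv_into_into f_inv_into_f)
  have "(\<lambda>(x, r). E (lift x) r) ` (carrier ?A \<times> carrier N) \<subseteq> carrier (add_monoid (P (Suc k)))"
    using E lift by auto
  from comm_group.free_Abelian_group_universal[OF bd.M.M.a_comm_group this]
  obtain h where h: "h \<in> hom ?F (add_monoid (P (Suc k)))"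
    "\<And>p. p \<in> carrier ?A \<times> carrier N \<Longrightarrow> h (frag_of p) = (case p of (x, r) \<Rightarrow> E (lift x) r)"
    by blast
  interpret h: group_hom ?F "add_monoid (P (Suc k))" h
    using h(1) by (simp add: group_hom_def group_hom_axioms_def bd.M.M.a_group)
  have h_of: "h (frag_of (x, r)) = E (lift x) r" if "x \<in> ?I" "r \<in> carrier R" for x r
    using h(2)[of "(x, r)"] that by simp
  have h_diff: "h (a - b) = h a \<ominus>\<^bsub>P (Suc k)\<^esub> h b"
    if "Poly_Mapping.keys a \<subseteq> ?I \<times> carrier R" "Poly_Mapping.keys b \<subseteq> ?I \<times> carrier R" for a b
    using hom_free_diff[OF bd.M.right_module_axioms h(1)] that by simp
  have rel: "h y \<in> ?Im" if y: "y \<in> tensor_relations (group_ring G) ?A N" for y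
  proof -
    from y consider
        (left) x x' r where "y = frag_of (x \<oplus>\<^bsub>B.P k\<^esub> x', r) - frag_of (x, r) - frag_of (x', r)"
          "x \<in> ?I" "x' \<in> ?I" "r \<in> carrier R"
      | (right) x r r' where "y = frag_of (x, r \<oplus>\<^bsub>R\<^esub> r') - frag_of (x, r) - frag_of (x, r')"
          "x \<in> ?I" "r \<in> carrier R" "r' \<in> carrier R"
      | (middle) x s r where "y = frag_of (ract (B.P k) x s, r) - frag_of (x, \<iota> s \<otimes>\<^bsub>R\<^esub> r)"
          "x \<in> ?I" "Poly_Mapping.keys s \<subseteq> carrier G" "r \<in> carrier R"
      by (auto simp: tensor_relations_def simp del: B.add_B)
    then show ?thesis
    proof cases
      case (left x x' r)
      have xx: "x \<oplus>\<^bsub>B.P k\<^esub> x' \<in> ?I" using left by (intro right_submoduleD(3)[OF I])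
      have "Poly_Mapping.keys (frag_of (x \<oplus>\<^bsub>B.P k\<^esub> x', r) - frag_of (x, r)) \<subseteq> ?I \<times> carrier R"
        using left xx by (auto dest!: subsetD[OF keys_diff] simp del: B.add_B)
      then have "h y = E (lift (x \<oplus>\<^bsub>B.P k\<^esub> x')) r \<ominus>\<^bsub>P (Suc k)\<^esub> E (lift x) r \<ominus>\<^bsub>P (Suc k)\<^esub> E (lift x') r"
        using left xx by (simp add: h_diff h_of del: B.add_B)
      then have hy: "h y = E (lift (x \<oplus>\<^bsub>B.P k\<^esub> x') \<ominus>\<^bsub>B.P (Suc k)\<^esub> lift x) r \<ominus>\<^bsub>P (Suc k)\<^esub> E (lift x') r"
        unfolding E_minus[OF lift(1)[OF xx] lift(1)[OF left(2)] left(4)] .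
      show ?thesis
        unfolding hy
      proof (rule E_cong)
        show "B.bd k (lift (x \<oplus>\<^bsub>B.P k\<^esub> x') \<ominus>\<^bsub>B.P (Suc k)\<^esub> lift x) = B.bd k (lift x')"
          using lift[OF xx] lift[OF left(2)] lift[OF left(3)] right_submoduleD(1)[OF I] left(2,3)
          by (simp only: bB.ah.hom_minus bB.N.M.add_minus_cancel(1))
      qed (use lift[OF xx] lift[OF left(2)] lift[OF left(3)] left(4) in \<open>simp_all only: bB.M.M.minus_closed\<close>)
    next
      case (right x r r')
      have "Poly_Mapping.keys (frag_of (x, r \<oplus>\<^bsub>R\<^esub> r') - frag_of (x, r)) \<subseteq> ?I \<times> carrier R"
        using right by (auto dest!: subsetD[OF keys_diff])
      then have "h y = E (lift x) (r \<oplus>\<^bsub>R\<^esub> r') \<ominus>\<^bsub>P (Suc k)\<^esub> E (lift x) r \<ominus>\<^bsub>P (Suc k)\<^esub> E (lift x) r'"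
        using right by (simp add: h_diff h_of)
      moreover have "E (lift x) (r \<oplus>\<^bsub>R\<^esub> r') = E (lift x) r \<oplus>\<^bsub>P (Suc k)\<^esub> E (lift x) r'"
        unfolding E_def using lift[OF right(2)] right by (intro bd.M.ract_add_right scalar_extension_closed)
      ultimately have "h y = \<zero>\<^bsub>P (Suc k)\<^esub>"
        using bd.M.M.add_minus_cancel(2)[OF E[OF lift(1)[OF right(2)] right(3)] E[OF lift(1)[OF right(2)] right(4)]]
        by (simp only:)
      then show ?thesis using right_submoduleD(2)[OF Im] by (simp only:)
    next
      case (middle x s r)
      have xs: "ract (B.P k) x s \<in> ?I" using middle by (intro right_submoduleD(4)[OF I]) auto
      have s: "s \<in> carrier (group_ring G)" using middle by simp
      have "h y = E (lift (ract (B.P k) x s)) r \<ominus>\<^bsub>P (Suc k)\<^esub> E (lift x) (\<iota> s \<otimes>\<^bsub>R\<^esub> r)"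
        using middle xs by (simp add: h_diff h_of j_closed)
      moreover have "E (lift x) (\<iota> s \<otimes>\<^bsub>R\<^esub> r) = E (ract (B.P (Suc k)) (lift x) s) r"
        unfolding E_def scalar_extension_ract[OF lift(1)[OF middle(2)] middle(3)]
        using lift(1)[OF middle(2)] middle by (intro bd.M.ract_mult scalar_extension_closed j_closed)
      ultimately have hy: "h y = E (lift (ract (B.P k) x s)) r \<ominus>\<^bsub>P (Suc k)\<^esub> E (ract (B.P (Suc k)) (lift x) s) r"
        by (simp only:)
      show ?thesis
        unfolding hy using lift[OF xs] lift[OF middle(2)] s middle(4)
        by (intro E_cong) (simp_all only: bB.hom_ract bB.M.ract_closed)
    qed
  qed
  have nf0: "normal_form \<zero>\<^bsub>P k\<^esub> = 0" by (simp add: normal_form_def free_rmodule_def)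
  have "z \<in> carrier (direct_sum (bar_cells G (Suc k)) (regular_rmodule R))"
    using z(1) by (simp add: free_rmodule_def)
  \<comment> \<open>This is proved for all chains by additivity, not for cycles only. The chain
    [xs]r contributes the tensor of \<open>B.bd k\<close> of [xs] and r. The last conjunct says that
    c represents \<open>bd k z\<close> in the tensor product of \<open>B.P k\<close> and R.\<close>
  then have "\<exists>c. Poly_Mapping.keys c \<subseteq> ?I \<times> carrier R \<and> h c \<ominus>\<^bsub>P (Suc k)\<^esub> z \<in> ?Im \<and> c - normal_form (bd k z) \<in> K k"
  proof (induction rule: right_module.direct_sum_induct[OF S.right_module_regular, consumes 1, case_names zero single add])
    case zero
    have 0: "(\<lambda>i. \<zero>\<^bsub>regular_rmodule R\<^esub>) = \<zero>\<^bsub>P (Suc k)\<^esub>" by (simp add: free_rmodule_def)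
    show ?case
      unfolding 0 using h.hom_one right_submoduleD(2)[OF Im] K_closed(1)
      by (intro exI[of _ 0]) (simp add: bd.M.M.minus_zero_right bd.ah.hom_zero nf0)
  next
    case (single xs r)
    then have r: "r \<in> carrier R" by simp
    let ?b = "basis (group_ring G) xs"
    have b: "?b \<in> carrier (B.P (Suc k))" using single by (intro ZG.basis_closed)
    then have bI: "B.bd k ?b \<in> ?I" by blast
    have y: "single (regular_rmodule R) xs r = E ?b r"
      unfolding E_def extend_scalars_basis by (rule S.single_eq_ract_basis[OF r])
    have "bd k (E ?b r) = ract (P k) (\<lambda>xs. \<iota> (B.bd k ?b xs)) r"
      unfolding E_def using b r by (simp add: bd.hom_ract scalar_extension_closed extend_scalars_bd)
    then have "frag_of (B.bd k ?b, r) - normal_form (bd k (E ?b r)) \<in> K k"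
      using normal_form_tensor[OF bB.ah.hom_closed[OF b] r] by simp
    moreover have "h (frag_of (B.bd k ?b, r)) \<ominus>\<^bsub>P (Suc k)\<^esub> E ?b r \<in> ?Im"
      unfolding h_of[OF bI r] using lift[OF bI] b r by (intro E_cong)
    ultimately show ?case
      unfolding y using bI r by (intro exI[of _ "frag_of (B.bd k ?b, r)"]) simp
  next
    case (add y y')
    then obtain c c' where c: "Poly_Mapping.keys c \<subseteq> ?I \<times> carrier R" "h c \<ominus>\<^bsub>P (Suc k)\<^esub> y \<in> ?Im" "c - normal_form (bd k y) \<in> K k"
      and c': "Poly_Mapping.keys c' \<subseteq> ?I \<times> carrier R" "h c' \<ominus>\<^bsub>P (Suc k)\<^esub> y' \<in> ?Im" "c' - normal_form (bd k y') \<in> K k"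
      by blast
    have y: "y \<in> carrier (P (Suc k))" "y' \<in> carrier (P (Suc k))" using add by (simp_all add: free_rmodule_def)
    have s: "(\<lambda>i. y i \<oplus>\<^bsub>regular_rmodule R\<^esub> y' i) = y \<oplus>\<^bsub>P (Suc k)\<^esub> y'" by (simp add: free_rmodule_def)
    have hc: "h c \<in> carrier (P (Suc k))" "h c' \<in> carrier (P (Suc k))"
      using h.hom_closed[of c] h.hom_closed[of c'] c(1) c'(1) by simp_all
    have "h (c + c') = h c \<oplus>\<^bsub>P (Suc k)\<^esub> h c'" using h.hom_mult[of c c'] c(1) c'(1) by simp
    then have "h (c + c') \<ominus>\<^bsub>P (Suc k)\<^esub> (y \<oplus>\<^bsub>P (Suc k)\<^esub> y') \<in> ?Im"
      using c(2) c'(2) y hc right_submoduleD(3)[OF Im] by (simp only: bd.M.M.add_minus_add)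
    moreover have "(c - normal_form (bd k y)) + (c' - normal_form (bd k y'))
        - (normal_form (bd k y \<oplus>\<^bsub>P k\<^esub> bd k y') - normal_form (bd k y) - normal_form (bd k y')) \<in> K k"
      using y by (intro K_closed(4)[OF K_closed(2)[OF c(3) c'(3)] normal_form_add]) simp_all
    then have "c + c' - normal_form (bd k (y \<oplus>\<^bsub>P (Suc k)\<^esub> y')) \<in> K k"
      using y by (simp add: algebra_simps)
    moreover have "Poly_Mapping.keys (c + c') \<subseteq> ?I \<times> carrier R"
      using c(1) c'(1) by (auto dest!: subsetD[OF Poly_Mapping.keys_add])
    ultimately show ?case unfolding s by blast
  qed
  \<comment> \<open>For the cycle z the normal form of its boundary is 0, so c itself is a relation
    over \<open>B.P k\<close>.\<close>
  then obtain c where c: "Poly_Mapping.keys c \<subseteq> ?I \<times> carrier R" "h c \<ominus>\<^bsub>P (Suc k)\<^esub> z \<in> ?Im" "c \<in> K k"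
    using z(2) nf0 by auto
  \<comment> \<open>Flatness is applied to the inclusion of \<open>?I\<close>, both modules being
    copied into 'u by e.\<close>
  obtain d :: "'g list \<Rightarrow> 'u" where "inj_on d (bar_cells G k)" by (rule bar_cells_encoding)
  from free_encoding[OF this]
  obtain e :: "('g list \<Rightarrow> 'g \<Rightarrow>\<^sub>0 int) \<Rightarrow> 'u" where e: "inj_on e (carrier (B.P k))" .
  have cA: "c \<in> tensor_kernel (group_ring G) ?A N"
  proof (rule flat_left_module_kernel_transport[OF flat bB.N.right_module_hom_submodule[OF I]])
    show "inj_on e (carrier ?A)" using e by (rule inj_on_subset) auto
    show "inj_on e (carrier (B.P k))" by fact
    show "frag_extend (\<lambda>(a, y). frag_of (a, y)) c \<in> K k"
      using free_map_id[where f = "\<lambda>x. x", OF _ c(1)] c(3) by simp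
  qed (use c(1) in auto)
  have "h c \<in> ?Im"
    by (rule hom_tensor_kernel[OF tensor_relations_subset[OF A left_module_N] bd.M.right_module_axioms Im h(1) _ cA])
      (rule rel)
  \<comment> \<open>Both \<open>h c\<close> and \<open>h c\<close> minus z are boundaries, so z is
    one.\<close>
  then have "h c \<ominus>\<^bsub>P (Suc k)\<^esub> (h c \<ominus>\<^bsub>P (Suc k)\<^esub> z) \<in> ?Im"
    using c(2) by (rule bd.M.right_submodule_minus[OF Im])
  moreover have "h c \<in> carrier (P (Suc k))" using h.hom_closed[of c] c(1) by simp
  ultimately show ?thesis using z(1) by (simp add: bd.M.M.minus_minus_cancel)
qed

text \<open>In degree 0 everything is a cycle: the complex resolves the zero module, so it stays
  exact when ended at \<open>P 0\<close>.\<close>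

definition cycles :: "nat \<Rightarrow> ('g list \<Rightarrow> 'u) set"
  where "cycles k = {z \<in> carrier (P k). case k of 0 \<Rightarrow> True | Suc m \<Rightarrow> bd m z = \<zero>\<^bsub>P m\<^esub>}"

lemma cycles_eq: "cycles k = bd k ` carrier (P (Suc k))"
  using bd_surj bd_exact bd_closed bd_bd by (cases k) (auto simp: cycles_def)

text \<open>An exact complex of free modules that is bounded below splits. The sections are built
  degree by degree, each from a projection r onto the cycles.\<close>

lemma bd_section:
  "\<exists>s. right_module_hom R (P k) (P (Suc k)) s \<and> (\<forall>z\<in>cycles k. bd k (s z) = z)"
proof -
  \<comment> \<open>The values of r are cycles, hence boundaries. As \<open>P k\<close> is free, r
    lifts through \<open>bd k\<close> one basis element at a time.\<close>
  have step: "\<exists>s. right_module_hom R (P k) (P (Suc k)) s \<and> (\<forall>z\<in>cycles k. bd k (s z) = z)"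
    if r: "right_module_hom R (P k) (P k) r" "\<And>z. z \<in> carrier (P k) \<Longrightarrow> r z \<in> cycles k"
      "\<And>z. z \<in> cycles k \<Longrightarrow> r z = z" for k r
  proof -
    have "\<exists>w\<in>carrier (P (Suc k)). bd k w = r (basis R xs)" if "xs \<in> bar_cells G k" for xs
      using r(2)[OF S.basis_closed[OF that]] by (auto simp: cycles_eq)
    then obtain w where w: "w xs \<in> carrier (P (Suc k))" "bd k (w xs) = r (basis R xs)"
      if "xs \<in> bar_cells G k" for xs by metis
    interpret P: right_module R "P (Suc k)" by (rule S.right_module_free)
    let ?s = "linear_ext R (P (Suc k)) w"
    have s: "right_module_hom R (P k) (P (Suc k)) ?s" by (rule P.linear_ext_hom) (rule w)
    have "bd k (?s z) = r z" if "z \<in> carrier (P k)" for z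
      by (rule free_rmodule_hom_eqI[OF right_module_hom_comp[OF s bd_hom] r(1) _ that])
        (simp add: P.linear_ext_basis w)
    then show ?thesis using s r(3) by (auto simp: cycles_def)
  qed
  show ?thesis
  proof (induction k)
    case 0
    show ?case
      by (rule step[of 0 "\<lambda>z. z"]) (auto simp: cycles_def intro: right_module_hom_id S.right_module_free)
  next
    case (Suc k)
    then obtain s where s: "right_module_hom R (P k) (P (Suc k)) s" "\<And>z. z \<in> cycles k \<Longrightarrow> bd k (s z) = z"
      by blast
    interpret s: right_module_hom R "P k" "P (Suc k)" s by (rule s(1))
    interpret bd: right_module_hom R "P (Suc k)" "P k" "bd k" by (rule bd_hom)
    \<comment> \<open>Subtracting \<open>s (bd k z)\<close> from z leaves a cycle, and does not
      change z when z is a cycle already.\<close>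
    let ?r = "\<lambda>z. z \<ominus>\<^bsub>P (Suc k)\<^esub> s (bd k z)"
    have bds: "bd k (s (bd k z)) = bd k z" if "z \<in> carrier (P (Suc k))" for z
      using that s(2) by (simp add: cycles_eq)
    show ?case
    proof (rule step)
      show "right_module_hom R (P (Suc k)) (P (Suc k)) ?r"
        by (rule right_module_homI)
          (simp_all add: s.N.right_module_axioms bd.hom_ract s.hom_ract s.N.ract_minus s.N.ract_closed
            s.N.add_minus_add)
      show "?r z \<in> cycles (Suc k)" if "z \<in> carrier (P (Suc k))" for z
        using that bds by (simp add: cycles_def bd.ah.hom_minus a_minus_def s.M.M.r_neg)
      show "?r z = z" if "z \<in> cycles (Suc k)" for z
        using that s.ah.hom_zero by (simp add: cycles_def s.N.minus_zero_right)
    qed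
  qed
qed

text \<open>The homomorphism \<open>?L\<close> of the cocycle c kills boundaries, hence cycles,
  hence y minus \<open>s (bd m y)\<close> for every chain y. So \<open>?L\<close> factors through
  \<open>bd m\<close>, and e is \<open>?L\<close> composed with the section s.\<close>

lemma cohomology_vanishes:
  assumes M: "right_module R M" and c: "c \<in> carrier (cochains G (Suc m) M)"
    and dc: "coboundary G (Suc m) (restrict_scalars \<iota> M) c = \<one>\<^bsub>cochains G (Suc (Suc m)) M\<^esub>"
  obtains e where "e \<in> carrier (cochains G m M)" "coboundary G m (restrict_scalars \<iota> M) e = c"
proof -
  interpret M: right_module R M by fact
  obtain s where s: "right_module_hom R (P m) (P (Suc m)) s" "\<And>z. z \<in> cycles m \<Longrightarrow> bd m (s z) = z"
    using bd_section by blast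
  interpret s: right_module_hom R "P m" "P (Suc m)" s by (rule s(1))
  interpret bd: right_module_hom R "P (Suc m)" "P m" "bd m" by (rule bd_hom)
  let ?L = "linear_ext R M c"
  have L: "right_module_hom R (P (Suc m)) M ?L"
    by (intro M.linear_ext_hom cochain_closed[OF c])
  interpret L: right_module_hom R "P (Suc m)" M ?L by (rule L)
  define e where "e = (\<lambda>xs\<in>bar_cells G m. ?L (s (basis R xs)))"
  have e: "e \<in> carrier (cochains G m M)"
    by (auto simp: e_def carrier_cochains S.basis_closed)
  have de: "coboundary G m (restrict_scalars \<iota> M) e \<in> carrier (cochains G (Suc m) M)"
    by (rule coboundary_restrict_closed[OF M e])
  have e_ext: "linear_ext R M e z = ?L (s z)" if "z \<in> carrier (P m)" for z
  proof (rule free_rmodule_hom_eqI[OF _ right_module_hom_comp[OF s(1) L] _ that])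
    show "right_module_hom R (P m) M (linear_ext R M e)" by (intro M.linear_ext_hom cochain_closed[OF e])
    fix xs assume xs: "xs \<in> bar_cells G m"
    then show "linear_ext R M e (basis R xs) = ?L (s (basis R xs))"
      using M.linear_ext_cochain[OF e xs] by (simp add: e_def)
  qed
  have L_cycle: "?L y = \<zero>\<^bsub>M\<^esub>" if "y \<in> cycles (Suc m)" for y
  proof -
    from that obtain w where w: "w \<in> carrier (P (Suc (Suc m)))" "y = bd (Suc m) w" by (auto simp: cycles_eq)
    have "?L y = linear_ext R M (coboundary G (Suc m) (restrict_scalars \<iota> M) c) w"
      unfolding w(2) by (rule linear_ext_bd[OF M c w(1)])
    also have "\<dots> = \<zero>\<^bsub>M\<^esub>"
      unfolding dc by (rule linear_ext_zero[OF M w(1)]) (simp add: one_cochains)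
    finally show ?thesis .
  qed
  have "coboundary G m (restrict_scalars \<iota> M) e = c"
  proof (rule PiE_ext[OF _ _])
    show "coboundary G m (restrict_scalars \<iota> M) e \<in> bar_cells G (Suc m) \<rightarrow>\<^sub>E carrier M"
      "c \<in> bar_cells G (Suc m) \<rightarrow>\<^sub>E carrier M"
      using c de by (simp_all add: carrier_cochains)
    fix xs assume xs: "xs \<in> bar_cells G (Suc m)"
    let ?b = "basis R xs"
    have b: "?b \<in> carrier (P (Suc m))" using xs by (rule S.basis_closed)
    have "bd m (s (bd m ?b)) = bd m ?b" using b by (intro s(2)) (simp add: cycles_eq)
    then have "?b \<ominus>\<^bsub>P (Suc m)\<^esub> s (bd m ?b) \<in> cycles (Suc m)"
      using b by (simp add: cycles_def bd.ah.hom_minus a_minus_def s.M.M.r_neg)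
    then have "?L (?b \<ominus>\<^bsub>P (Suc m)\<^esub> s (bd m ?b)) = \<zero>\<^bsub>M\<^esub>" by (rule L_cycle)
    then have "?L (s (bd m ?b)) = ?L ?b" using b M.M.minus_eq_zero[of "?L ?b" "?L (s (bd m ?b))"]
      by (simp add: L.ah.hom_minus)
    have "coboundary G m (restrict_scalars \<iota> M) e xs = linear_ext R M (coboundary G m (restrict_scalars \<iota> M) e) ?b"
      by (rule M.linear_ext_cochain[OF de xs, symmetric])
    also have "\<dots> = linear_ext R M e (bd m ?b)" by (rule linear_ext_bd[symmetric, OF M e b])
    also have "\<dots> = ?L ?b" using b by (simp add: e_ext \<open>?L (s (bd m ?b)) = ?L ?b\<close>)
    also have "\<dots> = c xs" by (rule M.linear_ext_cochain[OF c xs])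
    finally show "coboundary G m (restrict_scalars \<iota> M) e xs = c xs" .
  qed
  with e show ?thesis by (rule that)
qed

end

section \<open>Vanishing of filtered colimits\<close>

lemma hom_carrierD: "\<lbrakk>h \<in> hom G H; x \<in> carrier G\<rbrakk> \<Longrightarrow> h x \<in> carrier H"
  by (auto simp: hom_def)

text \<open>An upper bound of the two codomains gives a square that need not commute; coequalizing
  its two composites repairs this.\<close>

lemma (in filtered_category) span_completion:
  assumes "a \<in> Arr J" "b \<in> Arr J" "Dom J a = Dom J b"
  obtains c d where "c \<in> Arr J" "d \<in> Arr J" "Dom J c = Cod J a" "Dom J d = Cod J b"
    "Cod J c = Cod J d" "Comp J c a = Comp J d b"
proof -
  from upper_bound[OF Cod_in[OF assms(1)] Cod_in[OF assms(2)]] obtain c d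
    where cd: "c \<in> Arr J" "d \<in> Arr J" "Dom J c = Cod J a" "Dom J d = Cod J b" "Cod J c = Cod J d" by blast
  have ca: "Comp J c a \<in> Arr J" "Dom J (Comp J c a) = Dom J a" "Cod J (Comp J c a) = Cod J c"
    using Comp_in[OF assms(1) cd(1) cd(3)] by auto
  have db: "Comp J d b \<in> Arr J" "Dom J (Comp J d b) = Dom J b" "Cod J (Comp J d b) = Cod J d"
    using Comp_in[OF assms(2) cd(2) cd(4)] by auto
  from coequalized[OF ca(1) db(1)] ca db cd(5) assms(3) obtain e
    where e: "e \<in> Arr J" "Dom J e = Cod J c" "Comp J e (Comp J c a) = Comp J e (Comp J d b)" by auto
  show ?thesis
  proof
    show "Comp J e c \<in> Arr J" "Comp J e d \<in> Arr J" "Dom J (Comp J e c) = Cod J a"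
      "Dom J (Comp J e d) = Cod J b" "Cod J (Comp J e c) = Cod J (Comp J e d)"
      using Comp_in[OF cd(1) e(1)] Comp_in[OF cd(2) e(1)] cd e by auto
    show "Comp J (Comp J e c) a = Comp J (Comp J e d) b"
      using Comp_assoc[OF assms(1) cd(1) e(1)] Comp_assoc[OF assms(2) cd(2) e(1)] cd e by simp
  qed
qed

section \<open>Colimits of filtered systems of abelian groups, elementwise\<close>

locale abelian_system = filtered_category J
  for J :: "('o, 'a) small_category" and A :: "'o \<Rightarrow> ('x, 'e) monoid_scheme" and \<alpha> :: "'a \<Rightarrow> 'x \<Rightarrow> 'x" +
  assumes A_group: "i \<in> Obj J \<Longrightarrow> comm_group (A i)"
    and \<alpha>_hom: "a \<in> Arr J \<Longrightarrow> \<alpha> a \<in> hom (A (Dom J a)) (A (Cod J a))"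
    and \<alpha>_Comp: "\<lbrakk>a \<in> Arr J; b \<in> Arr J; Dom J b = Cod J a; x \<in> carrier (A (Dom J a))\<rbrakk> \<Longrightarrow>
        \<alpha> (Comp J b a) x = \<alpha> b (\<alpha> a x)"
begin

lemma \<alpha>_group_hom: "a \<in> Arr J \<Longrightarrow> group_hom (A (Dom J a)) (A (Cod J a)) (\<alpha> a)"
  using A_group[OF Dom_in] A_group[OF Cod_in] \<alpha>_hom
  by (simp add: group_hom_def group_hom_axioms_def comm_group.axioms(2))

abbreviation D where "D \<equiv> sum_group (Obj J) A"

abbreviation relations where
  "relations \<equiv> {sum_inj (Obj J) A (Dom J a) x \<otimes>\<^bsub>D\<^esub> inv\<^bsub>D\<^esub> (sum_inj (Obj J) A (Cod J a) (\<alpha> a x)) | a x.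
          a \<in> Arr J \<and> x \<in> carrier (A (Dom J a))}"

lemma A_grp: "i \<in> Obj J \<Longrightarrow> group (A i)"
  using A_group by (simp add: comm_group.axioms(2))

lemma D_group: "group D"
  by (rule sum_group) (rule A_grp)

lemma carrier_D: "carrier D = {x \<in> \<Pi>\<^sub>E i\<in>Obj J. carrier (A i). finite {i \<in> Obj J. x i \<noteq> \<one>\<^bsub>A i\<^esub>}}"
  by (rule carrier_sum_group) (rule A_grp)

lemma sum_inj_closed:
  assumes "i \<in> Obj J" "x \<in> carrier (A i)" shows "sum_inj (Obj J) A i x \<in> carrier D"
proof -
  have "finite {k \<in> Obj J. sum_inj (Obj J) A i x k \<noteq> \<one>\<^bsub>A k\<^esub>}"
    by (rule finite_subset[of _ "{i}"]) (auto simp: sum_inj_def split: if_splits)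
  moreover have "\<one>\<^bsub>A k\<^esub> \<in> carrier (A k)" if "k \<in> Obj J" for k
    using A_grp[OF that] by (simp add: group.is_monoid)
  ultimately show ?thesis using assms by (auto simp: carrier_D sum_inj_def)
qed

lemma relations_closed: "relations \<subseteq> carrier D"
proof -
  interpret D: group D by (rule D_group)
  have "\<alpha> a x \<in> carrier (A (Cod J a))" if "a \<in> Arr J" "x \<in> carrier (A (Dom J a))" for a x
    using \<alpha>_hom[OF that(1)] that(2) by (rule hom_carrierD)
  then show ?thesis by (auto intro!: D.m_closed D.inv_closed sum_inj_closed Dom_in Cod_in simp del: mult_sum_group inv_sum_group)
qed

text \<open>A cocone over the objects of T alone: the arrows of J between these objects need not
  commute with the arrows a t. Where commutation is wanted, a further arrow out of j is
  chosen.\<close>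

definition cocone :: "'o set \<Rightarrow> 'o \<Rightarrow> ('o \<Rightarrow> 'a) \<Rightarrow> bool"
  where "cocone T j a \<longleftrightarrow> finite T \<and> T \<subseteq> Obj J \<and> j \<in> Obj J \<and> (\<forall>t\<in>T. a t \<in> Arr J \<and> Dom J (a t) = t \<and> Cod J (a t) = j)"

text \<open>The map from the direct sum to \<open>A j\<close> given by the cocone; components
  outside T are dropped.\<close>

definition cocone_map :: "'o set \<Rightarrow> 'o \<Rightarrow> ('o \<Rightarrow> 'a) \<Rightarrow> ('o \<Rightarrow> 'x) \<Rightarrow> 'x"
  where "cocone_map T j a d = finprod (A j) (\<lambda>t. \<alpha> (a t) (d t)) T"

lemma cocone_exists: "finite T \<Longrightarrow> T \<subseteq> Obj J \<Longrightarrow> \<exists>j a. cocone T j a"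
proof (induction T rule: finite_induct)
  case empty
  then show ?case using nonempty by (auto simp: cocone_def)
next
  case (insert i T)
  then obtain j a where a: "cocone T j a" by auto
  then have j: "j \<in> Obj J" by (simp add: cocone_def)
  from upper_bound[OF _ j, of i] insert obtain b c
    where bc: "b \<in> Arr J" "c \<in> Arr J" "Dom J b = i" "Dom J c = j" "Cod J b = Cod J c" by auto
  have "cocone (insert i T) (Cod J b) (\<lambda>t. if t = i then b else Comp J c (a t))"
    using a bc insert Comp_in Cod_in by (auto simp: cocone_def)
  then show ?case by blast
qed

lemma cocone_map_hom:
  assumes "cocone T j a" shows "group_hom D (A j) (cocone_map T j a)"
proof -
  have j: "j \<in> Obj J" and T: "T \<subseteq> Obj J" using assms by (auto simp: cocone_def)
  interpret Aj: comm_group "A j" by (rule A_group[OF j])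
  interpret D: group D by (rule D_group)
  have at: "\<alpha> (a t) \<in> hom (A t) (A j)" if "t \<in> T" for t
    using assms that \<alpha>_hom[of "a t"] by (auto simp: cocone_def)
  have cl: "\<alpha> (a t) (d t) \<in> carrier (A j)" if "t \<in> T" "d \<in> carrier D" for t d
    using hom_carrierD[OF at[OF that(1)]] that T by (auto simp: carrier_D)
  show ?thesis
  proof (unfold_locales, rule homI)
    show "cocone_map T j a d \<in> carrier (A j)" if "d \<in> carrier D" for d
      unfolding cocone_map_def using cl[OF _ that] by (intro Aj.finprod_closed) auto
    show "cocone_map T j a (d \<otimes>\<^bsub>D\<^esub> e) = cocone_map T j a d \<otimes>\<^bsub>A j\<^esub> cocone_map T j a e"
      if "d \<in> carrier D" "e \<in> carrier D" for d e
    proof -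
      have "cocone_map T j a (d \<otimes>\<^bsub>D\<^esub> e) = finprod (A j) (\<lambda>t. \<alpha> (a t) (d t) \<otimes>\<^bsub>A j\<^esub> \<alpha> (a t) (e t)) T"
        unfolding cocone_map_def
      proof (rule Aj.finprod_cong')
        fix t assume t: "t \<in> T"
        then have "d t \<in> carrier (A t)" "e t \<in> carrier (A t)" using that T by (auto simp: carrier_D)
        then show "\<alpha> (a t) ((d \<otimes>\<^bsub>D\<^esub> e) t) = \<alpha> (a t) (d t) \<otimes>\<^bsub>A j\<^esub> \<alpha> (a t) (e t)"
          using t T hom_mult[OF at[OF t]] by auto
      qed (use cl that in auto)
      then show ?thesis
        unfolding cocone_map_def using cl that by (simp add: Aj.finprod_multf Pi_def)
    qed
  qed
qed

lemma cocone_map_sum_inj: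
  assumes "cocone T j a" "i \<in> T" "x \<in> carrier (A i)"
  shows "cocone_map T j a (sum_inj (Obj J) A i x) = \<alpha> (a i) x"
proof -
  have j: "j \<in> Obj J" and T: "T \<subseteq> Obj J" "finite T" using assms by (auto simp: cocone_def)
  interpret Aj: comm_group "A j" by (rule A_group[OF j])
  have at: "group_hom (A t) (A j) (\<alpha> (a t))" if "t \<in> T" for t
    using assms that \<alpha>_group_hom[of "a t"] by (auto simp: cocone_def)
  have x: "\<alpha> (a i) x \<in> carrier (A j)"
    using group_hom.hom_closed[OF at[OF assms(2)] assms(3)] .
  have "cocone_map T j a (sum_inj (Obj J) A i x) = finprod (A j) (\<lambda>t. if i = t then \<alpha> (a i) x else \<one>\<^bsub>A j\<^esub>) T"
    unfolding cocone_map_def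
    by (rule Aj.finprod_cong') (use T x group_hom.hom_one[OF at] in \<open>auto simp: sum_inj_def\<close>)
  also have "\<dots> = \<alpha> (a i) x"
    using Aj.finprod_singleton[OF assms(2) T(2), of "\<lambda>_. \<alpha> (a i) x"] x by auto
  finally show ?thesis .
qed

text \<open>This condition characterises the subgroup generated by the relations; that all cocones over large finite
  sets are considered makes it closed under products.\<close>

definition eventually_null :: "('o \<Rightarrow> 'x) \<Rightarrow> bool"
  where "eventually_null d \<longleftrightarrow> (\<exists>T0. finite T0 \<and> T0 \<subseteq> Obj J \<and>
    (\<forall>T j a. cocone T j a \<and> T0 \<subseteq> T \<longrightarrow>
      (\<exists>b\<in>Arr J. Dom J b = j \<and> \<alpha> b (cocone_map T j a d) = \<one>\<^bsub>A (Cod J b)\<^esub>)))"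

lemma eventually_null_relations:
  assumes "r \<in> relations" shows "eventually_null r"
proof -
  from assms obtain a x where a: "a \<in> Arr J" "x \<in> carrier (A (Dom J a))"
    and r: "r = sum_inj (Obj J) A (Dom J a) x \<otimes>\<^bsub>D\<^esub> inv\<^bsub>D\<^esub> (sum_inj (Obj J) A (Cod J a) (\<alpha> a x))" by blast
  let ?i = "Dom J a" and ?k = "Cod J a"
  have ik: "?i \<in> Obj J" "?k \<in> Obj J" using a Dom_in Cod_in by auto
  have ax: "\<alpha> a x \<in> carrier (A ?k)" using hom_carrierD[OF \<alpha>_hom[OF a(1)] a(2)] .
  have "\<exists>b\<in>Arr J. Dom J b = j \<and> \<alpha> b (cocone_map T j c r) = \<one>\<^bsub>A (Cod J b)\<^esub>"
    if c: "cocone T j c" and T: "{?i, ?k} \<subseteq> T" for T j c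
  proof -
    interpret h: group_hom D "A j" "cocone_map T j c" by (rule cocone_map_hom[OF c])
    have ci: "c ?i \<in> Arr J" "Dom J (c ?i) = ?i" "Cod J (c ?i) = j"
      and ck: "c ?k \<in> Arr J" "Dom J (c ?k) = ?k" "Cod J (c ?k) = j"
      using c T by (auto simp: cocone_def)
    have cka: "Comp J (c ?k) a \<in> Arr J" "Dom J (Comp J (c ?k) a) = ?i" "Cod J (Comp J (c ?k) a) = j"
      using Comp_in[OF a(1) ck(1) ck(2)] ck(3) by auto
    \<comment> \<open>The cocone gives two arrows from \<open>?i\<close> to j, directly and by way
      of a. They may differ, and b makes them equal.\<close>
    from coequalized[OF ci(1) cka(1)] ci cka obtain b
      where b: "b \<in> Arr J" "Dom J b = j" "Comp J b (c ?i) = Comp J b (Comp J (c ?k) a)" by auto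
    interpret b: group_hom "A j" "A (Cod J b)" "\<alpha> b" using \<alpha>_group_hom[OF b(1)] b(2) by simp
    have cix: "\<alpha> (c ?i) x \<in> carrier (A j)" using hom_carrierD[OF \<alpha>_hom[OF ci(1)]] ci a(2) by auto
    have ckx: "\<alpha> (c ?k) (\<alpha> a x) \<in> carrier (A j)" using hom_carrierD[OF \<alpha>_hom[OF ck(1)]] ck ax by auto
    have "\<alpha> b (\<alpha> (c ?i) x) = \<alpha> (Comp J b (c ?i)) x"
      using \<alpha>_Comp[OF ci(1) b(1)] b(2) ci a(2) by simp
    also have "\<dots> = \<alpha> b (\<alpha> (c ?k) (\<alpha> a x))"
      unfolding b(3) using \<alpha>_Comp[OF cka(1) b(1)] b(2) cka \<alpha>_Comp[OF a(1) ck(1) ck(2)] a(2) by simp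
    finally have eq: "\<alpha> b (\<alpha> (c ?i) x) = \<alpha> b (\<alpha> (c ?k) (\<alpha> a x))" .
    have "cocone_map T j c r = \<alpha> (c ?i) x \<otimes>\<^bsub>A j\<^esub> inv\<^bsub>A j\<^esub> (\<alpha> (c ?k) (\<alpha> a x))"
      unfolding r using T ik a ax cocone_map_sum_inj[OF c]
      by (simp add: h.hom_mult h.hom_inv sum_inj_closed del: mult_sum_group inv_sum_group)
    then have "\<alpha> b (cocone_map T j c r) = \<one>\<^bsub>A (Cod J b)\<^esub>"
      using eq cix ckx by (simp add: b.H.r_inv)
    then show ?thesis using b by blast
  qed
  then show ?thesis unfolding eventually_null_def using ik by (intro exI[of _ "{?i, ?k}"]) auto
qed

lemma eventually_null_mult:
  assumes "d \<in> carrier D" "e \<in> carrier D" "eventually_null d" "eventually_null e"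
  shows "eventually_null (d \<otimes>\<^bsub>D\<^esub> e)"
proof -
  from assms(3,4) obtain T1 T2 where T12: "finite T1" "T1 \<subseteq> Obj J" "finite T2" "T2 \<subseteq> Obj J"
    and n1: "\<And>T j a. \<lbrakk>cocone T j a; T1 \<subseteq> T\<rbrakk> \<Longrightarrow> \<exists>b\<in>Arr J. Dom J b = j \<and> \<alpha> b (cocone_map T j a d) = \<one>\<^bsub>A (Cod J b)\<^esub>"
    and n2: "\<And>T j a. \<lbrakk>cocone T j a; T2 \<subseteq> T\<rbrakk> \<Longrightarrow> \<exists>b\<in>Arr J. Dom J b = j \<and> \<alpha> b (cocone_map T j a e) = \<one>\<^bsub>A (Cod J b)\<^esub>"
    unfolding eventually_null_def by metis
  have "\<exists>b\<in>Arr J. Dom J b = j \<and> \<alpha> b (cocone_map T j a (d \<otimes>\<^bsub>D\<^esub> e)) = \<one>\<^bsub>A (Cod J b)\<^esub>"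
    if a: "cocone T j a" and T: "T1 \<union> T2 \<subseteq> T" for T j a
  proof -
    interpret h: group_hom D "A j" "cocone_map T j a" by (rule cocone_map_hom[OF a])
    obtain b1 where b1: "b1 \<in> Arr J" "Dom J b1 = j" "\<alpha> b1 (cocone_map T j a d) = \<one>\<^bsub>A (Cod J b1)\<^esub>" using n1[OF a] T by auto
    obtain b2 where b2: "b2 \<in> Arr J" "Dom J b2 = j" "\<alpha> b2 (cocone_map T j a e) = \<one>\<^bsub>A (Cod J b2)\<^esub>" using n2[OF a] T by auto
    obtain c1 c2 where c: "c1 \<in> Arr J" "c2 \<in> Arr J" "Dom J c1 = Cod J b1" "Dom J c2 = Cod J b2"
      "Cod J c1 = Cod J c2" "Comp J c1 b1 = Comp J c2 b2"
      using span_completion[OF b1(1) b2(1)] b1(2) b2(2) by metis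
    let ?b = "Comp J c1 b1"
    have b: "?b \<in> Arr J" "Dom J ?b = j" "Cod J ?b = Cod J c1" using Comp_in[OF b1(1) c(1) c(3)] b1(2) by auto
    interpret b: group_hom "A j" "A (Cod J ?b)" "\<alpha> ?b" using \<alpha>_group_hom[OF b(1)] b(2) by simp
    have hd: "cocone_map T j a d \<in> carrier (A j)" "cocone_map T j a e \<in> carrier (A j)" using assms by auto
    have "\<alpha> ?b (cocone_map T j a d) = \<one>\<^bsub>A (Cod J ?b)\<^esub>"
      using \<alpha>_Comp[OF b1(1) c(1) c(3)] b1 b hd group_hom.hom_one[OF \<alpha>_group_hom[OF c(1)]] c by simp
    moreover have "\<alpha> ?b (cocone_map T j a e) = \<one>\<^bsub>A (Cod J ?b)\<^esub>"
      using \<alpha>_Comp[OF b2(1) c(2) c(4)] b2 b hd group_hom.hom_one[OF \<alpha>_group_hom[OF c(2)]] c by simp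
    ultimately have "\<alpha> ?b (cocone_map T j a (d \<otimes>\<^bsub>D\<^esub> e)) = \<one>\<^bsub>A (Cod J ?b)\<^esub>"
      using assms hd by (simp add: h.hom_mult b.hom_mult del: mult_sum_group)
    then show ?thesis using b by blast
  qed
  then show ?thesis unfolding eventually_null_def using T12 by (intro exI[of _ "T1 \<union> T2"]) auto
qed

lemma eventually_null_inv:
  assumes "d \<in> carrier D" "eventually_null d"
  shows "eventually_null (inv\<^bsub>D\<^esub> d)"
proof -
  have "\<alpha> b (cocone_map T j a (inv\<^bsub>D\<^esub> d)) = \<one>\<^bsub>A (Cod J b)\<^esub>"
    if a: "cocone T j a" and b: "b \<in> Arr J" "Dom J b = j" "\<alpha> b (cocone_map T j a d) = \<one>\<^bsub>A (Cod J b)\<^esub>" for T j a b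
  proof -
    interpret h: group_hom D "A j" "cocone_map T j a" by (rule cocone_map_hom[OF a])
    interpret b: group_hom "A j" "A (Cod J b)" "\<alpha> b" using \<alpha>_group_hom[OF b(1)] b(2) by simp
    show ?thesis using assms(1) b(3) by (simp add: h.hom_inv b.hom_inv del: inv_sum_group)
  qed
  then show ?thesis using assms(2) unfolding eventually_null_def by meson
qed

lemma eventually_null_one: "eventually_null \<one>\<^bsub>D\<^esub>"
proof -
  have "\<exists>b\<in>Arr J. Dom J b = j \<and> \<alpha> b (cocone_map T j a \<one>\<^bsub>D\<^esub>) = \<one>\<^bsub>A (Cod J b)\<^esub>" if a: "cocone T j a" for T j a
  proof -
    interpret h: group_hom D "A j" "cocone_map T j a" by (rule cocone_map_hom[OF a])
    have j: "j \<in> Obj J" using a by (simp add: cocone_def)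
    interpret b: group_hom "A j" "A j" "\<alpha> (Ident J j)"
      using \<alpha>_group_hom[of "Ident J j"] Ident_in[OF j] by simp
    show ?thesis
      using Ident_in[OF j] by (intro bexI[of _ "Ident J j"]) (simp_all add: h.hom_one del: one_sum_group)
  qed
  then show ?thesis
    unfolding eventually_null_def by (intro exI[of _ "{}"]) (simp del: one_sum_group)
qed

lemma eventually_null_generate:
  assumes "d \<in> generate D relations" shows "eventually_null d"
proof -
  interpret D: group D by (rule D_group)
  note cl = D.generate_in_carrier[OF relations_closed]
  from assms show ?thesis
  proof (induction rule: generate.induct)
    case one
    then show ?case by (rule eventually_null_one)
  next
    case (incl h)
    then show ?case by (rule eventually_null_relations)
  next
    case (inv h)
    then show ?case
      using subsetD[OF relations_closed inv] by (intro eventually_null_inv eventually_null_relations)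
  next
    case (eng h k)
    then show ?case using cl by (intro eventually_null_mult)
  qed
qed

lemma generate_relations_eqI:
  assumes null: "\<And>i x. \<lbrakk>i \<in> Obj J; x \<in> carrier (A i)\<rbrakk> \<Longrightarrow> \<exists>a\<in>Arr J. Dom J a = i \<and> \<alpha> a x = \<one>\<^bsub>A (Cod J a)\<^esub>"
    and d: "d \<in> carrier D"
  shows "d \<in> generate D relations"
proof -
  interpret D: group D by (rule D_group)
  have inj: "sum_inj (Obj J) A i x \<in> generate D relations" if i: "i \<in> Obj J" "x \<in> carrier (A i)" for i x
  proof -
    from null[OF i] obtain a where a: "a \<in> Arr J" "Dom J a = i" "\<alpha> a x = \<one>\<^bsub>A (Cod J a)\<^esub>" by blast
    \<comment> \<open>As x dies along a, the relation that belongs to a and x is the element x in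
      the summand i itself. General elements are products of such elements, by induction on the
      support.\<close>
    have "sum_inj (Obj J) A (Cod J a) \<one>\<^bsub>A (Cod J a)\<^esub> = \<one>\<^bsub>D\<^esub>"
      by (auto simp: sum_inj_def)
    then have "sum_inj (Obj J) A i x = sum_inj (Obj J) A (Dom J a) x \<otimes>\<^bsub>D\<^esub> inv\<^bsub>D\<^esub> (sum_inj (Obj J) A (Cod J a) (\<alpha> a x))"
      using a sum_inj_closed[OF i] by (simp del: mult_sum_group inv_sum_group one_sum_group)
    then have "sum_inj (Obj J) A i x \<in> relations" using a i by blast
    then show ?thesis by (rule generate.incl)
  qed
  have "finite T \<Longrightarrow> \<forall>d\<in>carrier D. {i \<in> Obj J. d i \<noteq> \<one>\<^bsub>A i\<^esub>} = T \<longrightarrow> d \<in> generate D relations" for T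
  proof (induction T rule: finite_induct)
    case empty
    have "d = \<one>\<^bsub>D\<^esub>" if "d \<in> carrier D" "{i \<in> Obj J. d i \<noteq> \<one>\<^bsub>A i\<^esub>} = {}" for d
    proof
      fix i show "d i = \<one>\<^bsub>D\<^esub> i"
        using that PiE_arb[of d "Obj J" _ i] by (cases "i \<in> Obj J") (auto simp: carrier_D)
    qed
    then show ?case using generate.one by blast
  next
    case (insert i T)
    show ?case
    proof (intro ballI impI)
      fix d assume d: "d \<in> carrier D" and supp: "{i \<in> Obj J. d i \<noteq> \<one>\<^bsub>A i\<^esub>} = insert i T"
      then have i: "i \<in> Obj J" "d i \<in> carrier (A i)" by (auto simp: carrier_D)
      interpret Ai: group "A i" using A_grp[OF i(1)] .
      let ?e = "d(i := \<one>\<^bsub>A i\<^esub>)"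
      have supp': "{k \<in> Obj J. ?e k \<noteq> \<one>\<^bsub>A k\<^esub>} = T" using supp insert.hyps by auto
      have e: "?e \<in> carrier D"
        using d i insert.hyps(1) unfolding carrier_D mem_Collect_eq supp' by (auto simp: PiE_iff extensional_def)
      have "?e \<in> generate D relations" using insert.IH e supp' by blast
      then have "?e \<otimes>\<^bsub>D\<^esub> sum_inj (Obj J) A i (d i) \<in> generate D relations"
        using inj[OF i] by (rule generate.eng)
      moreover have "?e \<otimes>\<^bsub>D\<^esub> sum_inj (Obj J) A i (d i) = d"
      proof
        fix k
        show "(?e \<otimes>\<^bsub>D\<^esub> sum_inj (Obj J) A i (d i)) k = d k"
        proof (cases "k \<in> Obj J")
          case True
          interpret Ak: group "A k" using A_grp[OF True] .
          have "d k \<in> carrier (A k)" using d True by (auto simp: carrier_D)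
          then show ?thesis using True by (auto simp: sum_inj_def)
        next
          case False
          then show ?thesis using d PiE_arb[of d "Obj J" _ k] by (auto simp: carrier_D)
        qed
      qed
      ultimately show "d \<in> generate D relations" by simp
    qed
  qed
  then show ?thesis using d by (auto simp: carrier_D)
qed

text \<open>If all of the direct sum is generated by relations, then x in the summand i is
  \<open>eventually_null\<close>, which yields an arrow that kills it. Conversely, elements that die
  are relations, and they generate the direct sum. Colimits enter the rest of the proof only through
  this criterion.\<close>

lemma trivial_colim_iff:
  "trivial_group (colim J A \<alpha>) \<longleftrightarrow>
    (\<forall>i\<in>Obj J. \<forall>x\<in>carrier (A i). \<exists>a\<in>Arr J. Dom J a = i \<and> \<alpha> a x = \<one>\<^bsub>A (Cod J a)\<^esub>)"
  (is "_ \<longleftrightarrow> ?R")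
proof -
  interpret D: group D by (rule D_group)
  let ?K = "generate D relations"
  interpret K: subgroup ?K D by (rule D.generate_is_subgroup[OF relations_closed])
  have comm: "x \<otimes>\<^bsub>D\<^esub> y = y \<otimes>\<^bsub>D\<^esub> x" if "x \<in> carrier D" "y \<in> carrier D" for x y
  proof -
    have "x i \<otimes>\<^bsub>A i\<^esub> y i = y i \<otimes>\<^bsub>A i\<^esub> x i" if "i \<in> Obj J" for i
      using \<open>x \<in> carrier D\<close> \<open>y \<in> carrier D\<close> that comm_monoid.m_comm[OF comm_group.axioms(1)[OF A_group[OF that]]]
      by (auto simp: carrier_D)
    then show ?thesis by (auto intro!: restrict_ext)
  qed
  then interpret cD: comm_group D by (intro D.group_comm_groupI)
  have normal: "?K \<lhd> D" using K.subgroup_axioms by (rule cD.normal_iff_subgroup[THEN iffD2])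
  have colim: "colim J A \<alpha> = D Mod ?K" by (simp add: colim_def Let_def)
  have grp: "group (D Mod ?K)" using normal by (rule normal.factorgroup_is_group)
  show ?thesis
  proof
    assume "trivial_group (colim J A \<alpha>)"
    then have triv: "carrier (D Mod ?K) = {?K}" unfolding colim by (simp add: trivial_group_def FactGroup_def)
    have all: "d \<in> ?K" if "d \<in> carrier D" for d
    proof -
      have "?K #>\<^bsub>D\<^esub> d \<in> carrier (D Mod ?K)" using D.rcosetsI[OF K.subset that] by (simp add: FactGroup_def)
      then have "?K #>\<^bsub>D\<^esub> d = ?K" using triv by simp
      then show ?thesis using that K.subgroup_axioms by (rule D.coset_join1)
    qed
    show ?R
    proof (intro ballI)
      fix i x assume i: "i \<in> Obj J" "x \<in> carrier (A i)"
      have "eventually_null (sum_inj (Obj J) A i x)"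
        by (rule eventually_null_generate[OF all[OF sum_inj_closed[OF i]]])
      then obtain T0 where T0: "finite T0" "T0 \<subseteq> Obj J"
        "\<forall>T j a. cocone T j a \<and> T0 \<subseteq> T \<longrightarrow>
          (\<exists>b\<in>Arr J. Dom J b = j \<and> \<alpha> b (cocone_map T j a (sum_inj (Obj J) A i x)) = \<one>\<^bsub>A (Cod J b)\<^esub>)"
        unfolding eventually_null_def by (elim exE conjE) (rule that)
      \<comment> \<open>i is added to \<open>T0\<close> so that the cocone sees the summand in which
        x lies.\<close>
      obtain j a where a: "cocone (insert i T0) j a"
        using cocone_exists[of "insert i T0"] T0 i by auto
      from T0(3)[rule_format, of "insert i T0" j a] a cocone_map_sum_inj[OF a _ i(2)] obtain b
        where b: "b \<in> Arr J" "Dom J b = j" "\<alpha> b (\<alpha> (a i) x) = \<one>\<^bsub>A (Cod J b)\<^esub>" by auto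
      have ai: "a i \<in> Arr J" "Dom J (a i) = i" "Cod J (a i) = j" using a by (auto simp: cocone_def)
      show "\<exists>a\<in>Arr J. Dom J a = i \<and> \<alpha> a x = \<one>\<^bsub>A (Cod J a)\<^esub>"
        using Comp_in[OF ai(1) b(1)] \<alpha>_Comp[OF ai(1) b(1)] ai b i(2)
        by (intro bexI[of _ "Comp J b (a i)"]) auto
    qed
  next
    assume ?R
    then have "?K = carrier D" using generate_relations_eqI K.subset by blast
    then have "?K #>\<^bsub>D\<^esub> d = ?K" if "d \<in> carrier D" for d
      using that by (intro D.coset_join2[OF _ K.subgroup_axioms]) (simp_all only:)
    then have "carrier (D Mod ?K) = {?K}"
      using D.one_closed unfolding FactGroup_def RCOSETS_def partial_object.simps by blast
    then show "trivial_group (colim J A \<alpha>)"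
      unfolding colim using grp by (simp add: trivial_group_def FactGroup_def)
  qed
qed

end

section \<open>Cohomology groups and the maps between them\<close>

lemma mem_cocycles:
  "c \<in> cocycles G k M \<longleftrightarrow> c \<in> carrier (cochains G k M) \<and> coboundary G k M c = \<one>\<^bsub>cochains G (Suc k) M\<^esub>"
  by (auto simp: cocycles_def kernel_def)

context group_module
begin

lemma cocycles_subgroup: "subgroup (cocycles G k M) (cochains G k M)"
  unfolding cocycles_def by (rule group_hom.subgroup_kernel[OF group_hom_coboundary])

lemma coboundaries_subgroup: "subgroup (coboundaries G k M) (cochains G k M)"
proof (cases k)
  case 0
  interpret comm_group "cochains G 0 M" by (rule comm_group_cochains)
  show ?thesis unfolding 0 coboundaries_def nat.case by (rule triv_subgroup)
next
  case (Suc m)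
  show ?thesis
    unfolding Suc coboundaries_def nat.case by (rule group_hom.img_is_subgroup[OF group_hom_coboundary])
qed

lemma coboundaries_subset: "coboundaries G k M \<subseteq> cocycles G k M"
proof (cases k)
  case 0
  show ?thesis
    using subgroup.one_closed[OF cocycles_subgroup[of 0]] unfolding 0 coboundaries_def nat.case by blast
next
  case (Suc m)
  then show ?thesis by (auto simp: coboundaries_def mem_cocycles coboundary_closed coboundary_coboundary)
qed

abbreviation cocycle_group :: "nat \<Rightarrow> ('g list \<Rightarrow> 'm) monoid"
  where "cocycle_group k \<equiv> (cochains G k M)\<lparr>carrier := cocycles G k M\<rparr>"

lemma comm_group_cocycles: "comm_group (cocycle_group k)"
proof -
  interpret C: comm_group "cochains G k M" by (rule comm_group_cochains)
  interpret Z: subgroup "cocycles G k M" "cochains G k M" by (rule cocycles_subgroup)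
  show ?thesis
    by (rule group.group_comm_groupI[OF Z.subgroup_is_group[OF C.group_axioms]]) (simp add: C.m_comm)
qed

lemma coboundaries_normal: "coboundaries G k M \<lhd> cocycle_group k"
  using group.subgroup_incl[OF comm_group.axioms(2)[OF comm_group_cochains] coboundaries_subgroup cocycles_subgroup coboundaries_subset]
  by (rule comm_group.normal_iff_subgroup[OF comm_group_cocycles, THEN iffD2])

text \<open>The coset is formed in the group of all cochains, as in \<open>cohomology_map\<close>;
  \<open>cohomology_class_eq\<close> identifies it with the coset in the group of cocycles.\<close>

definition cohomology_class :: "nat \<Rightarrow> ('g list \<Rightarrow> 'm) \<Rightarrow> ('g list \<Rightarrow> 'm) set"
  where "cohomology_class k z = coboundaries G k M #>\<^bsub>cochains G k M\<^esub> z"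

lemma cohomology_class_eq: "cohomology_class k z = coboundaries G k M #>\<^bsub>cocycle_group k\<^esub> z"
  by (simp add: cohomology_class_def r_coset_def)

lemma carrier_cohomology: "carrier (cohomology_group G k M) = cohomology_class k ` cocycles G k M"
  by (auto simp: cohomology_group_def FactGroup_def RCOSETS_def cohomology_class_eq)

lemma one_cohomology: "\<one>\<^bsub>cohomology_group G k M\<^esub> = coboundaries G k M"
  by (simp add: cohomology_group_def FactGroup_def)

lemma mult_cohomology:
  assumes "z \<in> cocycles G k M" "w \<in> cocycles G k M"
  shows "cohomology_class k z \<otimes>\<^bsub>cohomology_group G k M\<^esub> cohomology_class k w = cohomology_class k (z \<otimes>\<^bsub>cochains G k M\<^esub> w)"
  using normal.rcos_sum[OF coboundaries_normal, of z k w] assms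
  by (simp add: cohomology_group_def FactGroup_def cohomology_class_eq)

lemma comm_group_cohomology: "comm_group (cohomology_group G k M)"
  unfolding cohomology_group_def
  using comm_group.abelian_FactGroup[OF comm_group_cocycles normal_imp_subgroup[OF coboundaries_normal]] .

lemma cohomology_class_eq_one_iff:
  assumes "z \<in> cocycles G k M"
  shows "cohomology_class k z = \<one>\<^bsub>cohomology_group G k M\<^esub> \<longleftrightarrow> z \<in> coboundaries G k M"
proof -
  interpret comm_group "cochains G k M" by (rule comm_group_cochains)
  have "z \<in> carrier (cochains G k M)" using assms by (simp add: mem_cocycles)
  then show ?thesis
    unfolding cohomology_class_def one_cohomology using coset_join1[OF _ _ coboundaries_subgroup] coset_join2[OF _ coboundaries_subgroup]
    by blast
qed

end

locale group_module_hom = right_module_hom "group_ring G" M N f + G?: group G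
  for G :: "('g, 'b) monoid_scheme" (structure) and M :: "('g \<Rightarrow>\<^sub>0 int, 'm, 'c) rmodule_scheme"
    and N :: "('g \<Rightarrow>\<^sub>0 int, 'n, 'd) rmodule_scheme" and f

sublocale group_module_hom \<subseteq> GM: group_module G M by unfold_locales
sublocale group_module_hom \<subseteq> GN: group_module G N by unfold_locales

context group_module_hom
begin

lemma compose_closed: "c \<in> carrier (cochains G k M) \<Longrightarrow> compose (bar_cells G k) f c \<in> carrier (cochains G k N)"
  by (rule compose_cochain_closed[OF right_module_hom_axioms])

lemma compose_mult:
  assumes "c \<in> carrier (cochains G k M)" "d \<in> carrier (cochains G k M)"
  shows "compose (bar_cells G k) f (c \<otimes>\<^bsub>cochains G k M\<^esub> d)
    = compose (bar_cells G k) f c \<otimes>\<^bsub>cochains G k N\<^esub> compose (bar_cells G k) f d"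
  using cochain_closed[OF assms(1)] cochain_closed[OF assms(2)]
  by (auto simp: compose_def mult_cochains ah.hom_add intro!: restrict_ext)

lemma compose_one: "compose (bar_cells G k) f \<one>\<^bsub>cochains G k M\<^esub> = \<one>\<^bsub>cochains G k N\<^esub>"
  by (auto simp: compose_def one_cochains ah.hom_zero intro!: restrict_ext)

lemma compose_coboundary:
  "c \<in> carrier (cochains G k M) \<Longrightarrow>
    coboundary G k N (compose (bar_cells G k) f c) = compose (bar_cells G (Suc k)) f (coboundary G k M c)"
  by (rule coboundary_compose[OF G.group_axioms right_module_hom_axioms])

lemma compose_cocycle: "c \<in> cocycles G k M \<Longrightarrow> compose (bar_cells G k) f c \<in> cocycles G k N"
  by (simp add: mem_cocycles compose_closed compose_coboundary compose_one)

lemma compose_coboundaries: "c \<in> coboundaries G k M \<Longrightarrow> compose (bar_cells G k) f c \<in> coboundaries G k N"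
  by (cases k) (auto simp: coboundaries_def compose_one compose_coboundary[symmetric] compose_closed)

lemma cohomology_map_class:
  assumes z: "z \<in> cocycles G k M"
  shows "cohomology_map G k M N f (GM.cohomology_class k z) = GN.cohomology_class k (compose (bar_cells G k) f z)"
proof -
  interpret CN: comm_group "cochains G k N" by (rule N.comm_group_cochains)
  interpret BN: subgroup "coboundaries G k N" "cochains G k N" by (rule GN.coboundaries_subgroup)
  have zc: "z \<in> carrier (cochains G k M)" using z by (simp add: mem_cocycles)
  have "GN.cohomology_class k (compose (bar_cells G k) f c) = GN.cohomology_class k (compose (bar_cells G k) f z)"
    if "c \<in> GM.cohomology_class k z" for c
  proof -
    from that obtain b where b: "b \<in> coboundaries G k M" "c = b \<otimes>\<^bsub>cochains G k M\<^esub> z"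
      by (auto simp: GM.cohomology_class_def r_coset_def)
    have bc: "b \<in> carrier (cochains G k M)" using subgroup.mem_carrier[OF GM.coboundaries_subgroup b(1)] .
    have "coboundaries G k N #>\<^bsub>cochains G k N\<^esub> compose (bar_cells G k) f b = coboundaries G k N"
      using CN.coset_join2[OF compose_closed[OF bc] BN.subgroup_axioms compose_coboundaries[OF b(1)]] .
    then show ?thesis
      using CN.coset_mult_assoc[OF BN.subset compose_closed[OF bc] compose_closed[OF zc]]
      by (simp only: b(2) compose_mult[OF bc zc] GN.cohomology_class_def)
  qed
  moreover have "z \<in> GM.cohomology_class k z"
    unfolding GM.cohomology_class_def
    using group.rcos_self[OF comm_group.axioms(2)[OF M.comm_group_cochains] zc GM.coboundaries_subgroup] .
  ultimately have "(\<Union>c\<in>GM.cohomology_class k z. GN.cohomology_class k (compose (bar_cells G k) f c)) = GN.cohomology_class k (compose (bar_cells G k) f z)"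
    by blast
  then show ?thesis by (simp add: cohomology_map_def GN.cohomology_class_def compose_def)
qed

end

section \<open>Systems of modules, of their cohomology groups and of quotients\<close>

lemma cohomology_system:
  fixes J :: "('o, 'a) small_category" and M :: "'o \<Rightarrow> ('g \<Rightarrow>\<^sub>0 int, 'm) rmodule"
  assumes "group G" "filtered_category J" "rmodule_system (group_ring G) J M \<phi>"
  shows "abelian_system J (\<lambda>i. cohomology_group G k (M i)) (\<lambda>a. cohomology_map G k (M (Dom J a)) (M (Cod J a)) (\<phi> a))"
proof -
  interpret J: filtered_category J by fact
  interpret M: rmodule_system "group_ring G" J M \<phi> by fact
  interpret G: group G by fact
  have mod: "group_module G (M i)" if "i \<in> Obj J" for i
    using M.M_module[OF that] by (simp add: group_module_def G.group_axioms)
  have hom: "group_module_hom G (M (Dom J a)) (M (Cod J a)) (\<phi> a)" if "a \<in> Arr J" for a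
    using M.M_module[OF J.Dom_in[OF that]] M.M_module[OF J.Cod_in[OF that]] M.\<phi>_hom[OF that]
    by (simp add: group_module_hom_def right_module_hom_def right_module_hom_axioms_def G.group_axioms)
  show ?thesis
  proof (intro abelian_system.intro abelian_system_axioms.intro J.filtered_category_axioms)
    show "comm_group (cohomology_group G k (M i))" if "i \<in> Obj J" for i
      by (rule group_module.comm_group_cohomology[OF mod[OF that]])
    fix a assume a: "a \<in> Arr J"
    interpret a: group_module_hom G "M (Dom J a)" "M (Cod J a)" "\<phi> a" by (rule hom[OF a])
    show "cohomology_map G k (M (Dom J a)) (M (Cod J a)) (\<phi> a)
        \<in> hom (cohomology_group G k (M (Dom J a))) (cohomology_group G k (M (Cod J a)))"
    proof (rule homI)
      fix x assume "x \<in> carrier (cohomology_group G k (M (Dom J a)))"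
      then obtain z where z: "z \<in> cocycles G k (M (Dom J a))" "x = a.GM.cohomology_class k z"
        by (auto simp: a.GM.carrier_cohomology)
      show "cohomology_map G k (M (Dom J a)) (M (Cod J a)) (\<phi> a) x \<in> carrier (cohomology_group G k (M (Cod J a)))"
        by (simp add: z a.cohomology_map_class a.GN.carrier_cohomology a.compose_cocycle)
      fix y assume "y \<in> carrier (cohomology_group G k (M (Dom J a)))"
      then obtain w where w: "w \<in> cocycles G k (M (Dom J a))" "y = a.GM.cohomology_class k w"
        by (auto simp: a.GM.carrier_cohomology)
      have "z \<otimes>\<^bsub>cochains G k (M (Dom J a))\<^esub> w \<in> cocycles G k (M (Dom J a))"
        using subgroup.m_closed[OF a.GM.cocycles_subgroup z(1) w(1)] .
      then show "cohomology_map G k (M (Dom J a)) (M (Cod J a)) (\<phi> a) (x \<otimes>\<^bsub>cohomology_group G k (M (Dom J a))\<^esub> y)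
        = cohomology_map G k (M (Dom J a)) (M (Cod J a)) (\<phi> a) x \<otimes>\<^bsub>cohomology_group G k (M (Cod J a))\<^esub>
          cohomology_map G k (M (Dom J a)) (M (Cod J a)) (\<phi> a) y"
        using z(1) w(1)
        by (simp add: z(2) w(2) a.GM.mult_cohomology a.GN.mult_cohomology a.cohomology_map_class a.compose_cocycle
            a.compose_mult mem_cocycles[of z] mem_cocycles[of w])
    qed
    fix b x assume b: "b \<in> Arr J" "Dom J b = Cod J a" and x: "x \<in> carrier (cohomology_group G k (M (Dom J a)))"
    interpret b: group_module_hom G "M (Cod J a)" "M (Cod J b)" "\<phi> b" using hom[OF b(1)] b(2) by simp
    have ba: "Comp J b a \<in> Arr J" "Dom J (Comp J b a) = Dom J a" "Cod J (Comp J b a) = Cod J b"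
      using J.Comp_in[OF a b] by auto
    interpret ba: group_module_hom G "M (Dom J a)" "M (Cod J b)" "\<phi> (Comp J b a)" using hom[OF ba(1)] ba by simp
    obtain z where z: "z \<in> cocycles G k (M (Dom J a))" "x = a.GM.cohomology_class k z"
      using x by (auto simp: a.GM.carrier_cohomology)
    have "compose (bar_cells G k) (\<phi> (Comp J b a)) z = compose (bar_cells G k) (\<phi> b) (compose (bar_cells G k) (\<phi> a) z)"
      using z(1) M.\<phi>_Comp[OF a b] cochain_closed[of z G k "M (Dom J a)"]
      by (auto simp: compose_def mem_cocycles intro!: restrict_ext)
    then show "cohomology_map G k (M (Dom J (Comp J b a))) (M (Cod J (Comp J b a))) (\<phi> (Comp J b a)) x
      = cohomology_map G k (M (Dom J b)) (M (Cod J b)) (\<phi> b) (cohomology_map G k (M (Dom J a)) (M (Cod J a)) (\<phi> a) x)"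
      using ba.cohomology_map_class[OF z(1)] a.cohomology_map_class[OF z(1)] b.cohomology_map_class[OF a.compose_cocycle[OF z(1)]]
      by (simp only: ba b(2) z(2))
  qed
qed

text \<open>The elementwise form of a vanishing colimit, see
  \<open>trivial_colim_modules\<close>.\<close>

definition null_system :: "('o, 'a) small_category \<Rightarrow> ('o \<Rightarrow> ('s, 'm) rmodule) \<Rightarrow> ('a \<Rightarrow> 'm \<Rightarrow> 'm) \<Rightarrow> bool"
  where "null_system J M \<phi> \<longleftrightarrow>
    (\<forall>i\<in>Obj J. \<forall>x\<in>carrier (M i). \<exists>a\<in>Arr J. Dom J a = i \<and> \<phi> a x = \<zero>\<^bsub>M (Cod J a)\<^esub>)"

text \<open>The elementwise form of a vanishing colimit of cohomology groups, with classes replaced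
  by cocycles.\<close>

definition null_cohomology ::
  "('g, 'b) monoid_scheme \<Rightarrow> nat \<Rightarrow> ('o, 'a) small_category \<Rightarrow> ('o \<Rightarrow> ('g \<Rightarrow>\<^sub>0 int, 'm) rmodule) \<Rightarrow> ('a \<Rightarrow> 'm \<Rightarrow> 'm) \<Rightarrow> bool"
  where "null_cohomology G k J M \<phi> \<longleftrightarrow>
    (\<forall>i\<in>Obj J. \<forall>z\<in>cocycles G k (M i). \<exists>a\<in>Arr J. Dom J a = i \<and>
      compose (bar_cells G k) (\<phi> a) z \<in> coboundaries G k (M (Cod J a)))"

lemma trivial_colim_modules:
  assumes "filtered_category J" "rmodule_system S J M \<phi>"
  shows "trivial_group (colim J (\<lambda>i. add_monoid (M i)) \<phi>) \<longleftrightarrow> null_system J M \<phi>"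
proof -
  interpret J: filtered_category J by fact
  interpret M: rmodule_system S J M \<phi> by fact
  have ab: "abelian_group (M i)" if "i \<in> Obj J" for i
    using M.M_module[OF that] by (simp add: right_module_def)
  interpret abelian_system J "\<lambda>i. add_monoid (M i)" \<phi>
  proof (intro abelian_system.intro abelian_system_axioms.intro J.filtered_category_axioms)
    show "comm_group (add_monoid (M i))" if "i \<in> Obj J" for i
      using abelian_group.a_comm_group[OF ab[OF that]] .
    show "\<phi> a \<in> hom (add_monoid (M (Dom J a))) (add_monoid (M (Cod J a)))" if "a \<in> Arr J" for a
      using M.\<phi>_hom[OF that] by (simp add: rmodule_hom_def)
  qed (use M.\<phi>_Comp in auto)
  show ?thesis unfolding trivial_colim_iff null_system_def by simp
qed

lemma trivial_colim_cohomology: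
  assumes "group G" "filtered_category J" "rmodule_system (group_ring G) J M \<phi>"
  shows "trivial_group (colim J (\<lambda>i. cohomology_group G k (M i)) (\<lambda>a. cohomology_map G k (M (Dom J a)) (M (Cod J a)) (\<phi> a)))
    \<longleftrightarrow> null_cohomology G k J M \<phi>"
proof -
  interpret G: group G by fact
  interpret J: filtered_category J by fact
  interpret M: rmodule_system "group_ring G" J M \<phi> by fact
  interpret abelian_system J "\<lambda>i. cohomology_group G k (M i)"
    "\<lambda>a. cohomology_map G k (M (Dom J a)) (M (Cod J a)) (\<phi> a)"
    by (rule cohomology_system[OF assms])
  have mod: "group_module G (M i)" if "i \<in> Obj J" for i
    using M.M_module[OF that] by (simp add: group_module_def G.group_axioms)
  have eq: "cohomology_map G k (M i) (M (Cod J a)) (\<phi> a) (group_module.cohomology_class G (M i) k z) = \<one>\<^bsub>cohomology_group G k (M (Cod J a))\<^esub>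
      \<longleftrightarrow> compose (bar_cells G k) (\<phi> a) z \<in> coboundaries G k (M (Cod J a))"
    if "a \<in> Arr J" "Dom J a = i" "z \<in> cocycles G k (M i)" for a i z
  proof -
    interpret a: group_module_hom G "M (Dom J a)" "M (Cod J a)" "\<phi> a"
      using M.M_module[OF J.Dom_in[OF that(1)]] M.M_module[OF J.Cod_in[OF that(1)]] M.\<phi>_hom[OF that(1)]
      by (simp add: group_module_hom_def right_module_hom_def right_module_hom_axioms_def G.group_axioms)
    show ?thesis
      using that(2,3) a.cohomology_map_class[of z k] a.GN.cohomology_class_eq_one_iff[OF a.compose_cocycle, of z k] by simp
  qed
  show ?thesis
    unfolding trivial_colim_iff null_cohomology_def
    by (intro ball_cong refl, unfold group_module.carrier_cohomology[OF mod] ball_simps)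
      (intro ball_cong refl bex_cong conj_cong; simp add: eq)
qed

lemma zero_finitary_cohomology_iff:
  assumes "group G"
  shows "zero_finitary (group_ring G) (cohomology TYPE('u) G k) \<longleftrightarrow>
    (\<forall>(J :: ('u, 'u) small_category) M \<phi>. filtered_category J \<longrightarrow> rmodule_system (group_ring G) J M \<phi> \<longrightarrow>
      null_system J M \<phi> \<longrightarrow> null_cohomology G k J (M :: 'u \<Rightarrow> ('g \<Rightarrow>\<^sub>0 int, 'u) rmodule) \<phi>)"
  unfolding zero_finitary_def cohomology_def fst_conv snd_conv
  using trivial_colim_modules trivial_colim_cohomology[OF assms] by blast

lemma (in rmodule_system) right_module_hom_\<phi>:
  assumes "a \<in> Arr J"
  shows "right_module_hom S (M (Dom J a)) (M (Cod J a)) (\<phi> a)"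
  using M_module[OF Dom_in[OF assms]] M_module[OF Cod_in[OF assms]] \<phi>_hom[OF assms]
  by (simp add: right_module_hom_def right_module_hom_axioms_def)

lemma rmodule_systemI:
  assumes "small_category J" "ring S"
    and "\<And>i. i \<in> Obj J \<Longrightarrow> right_module S (M i)"
    and "\<And>a. a \<in> Arr J \<Longrightarrow> right_module_hom S (M (Dom J a)) (M (Cod J a)) (\<phi> a)"
    and "\<And>i x. \<lbrakk>i \<in> Obj J; x \<in> carrier (M i)\<rbrakk> \<Longrightarrow> \<phi> (Ident J i) x = x"
    and "\<And>a b x. \<lbrakk>a \<in> Arr J; b \<in> Arr J; Dom J b = Cod J a; x \<in> carrier (M (Dom J a))\<rbrakk> \<Longrightarrow>
        \<phi> (Comp J b a) x = \<phi> b (\<phi> a x)"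
  shows "rmodule_system S J M \<phi>"
  using assms by (simp add: rmodule_system_def rmodule_system_axioms_def right_module_hom.f)

text \<open>Since \<psi> maps each \<open>K\<close> into the next, the class of its value does not
  depend on the preimage that \<open>inv_into\<close> picks.\<close>

lemma quotient_system:
  fixes N :: "'o \<Rightarrow> ('s, 'v) rmodule" and q :: "'o \<Rightarrow> 'v \<Rightarrow> 'w"
  assumes N: "rmodule_system S J N \<psi>"
    and q: "\<And>i. i \<in> Obj J \<Longrightarrow> rmodule_quotient S (N i) (K i) (q i)"
    and \<psi>K: "\<And>a x. \<lbrakk>a \<in> Arr J; x \<in> K (Dom J a)\<rbrakk> \<Longrightarrow> \<psi> a x \<in> K (Cod J a)"
  defines "\<phi> \<equiv> \<lambda>a y. q (Cod J a) (\<psi> a (inv_into (carrier (N (Dom J a))) (q (Dom J a)) y))"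
  shows "\<And>a x. \<lbrakk>a \<in> Arr J; x \<in> carrier (N (Dom J a))\<rbrakk> \<Longrightarrow> \<phi> a (q (Dom J a) x) = q (Cod J a) (\<psi> a x)"
    and "rmodule_system S J (\<lambda>i. image_rmodule (q i) (N i)) \<phi>"
proof -
  interpret N: rmodule_system S J N \<psi> by fact
  note hom = N.right_module_hom_\<phi>
  show comm: "\<phi> a (q (Dom J a) x) = q (Cod J a) (\<psi> a x)"
    if a: "a \<in> Arr J" and x: "x \<in> carrier (N (Dom J a))" for a x
  proof -
    interpret d: rmodule_quotient S "N (Dom J a)" "K (Dom J a)" "q (Dom J a)" by (rule q[OF N.Dom_in[OF a]])
    interpret c: rmodule_quotient S "N (Cod J a)" "K (Cod J a)" "q (Cod J a)" by (rule q[OF N.Cod_in[OF a]])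
    interpret \<psi>: right_module_hom S "N (Dom J a)" "N (Cod J a)" "\<psi> a" by (rule hom[OF a])
    show ?thesis
      unfolding \<phi>_def using d.inv_q[OF x] x \<psi>K[OF a, OF d.inv_q(2)[OF x]]
      by (subst c.q_eq_iff) (simp_all add: \<psi>.ah.hom_minus)
  qed
  show "rmodule_system S J (\<lambda>i. image_rmodule (q i) (N i)) \<phi>"
  proof (rule rmodule_systemI[OF N.small_category_axioms N.S.ring_axioms])
    show "right_module S (image_rmodule (q i) (N i))" if "i \<in> Obj J" for i
      using rmodule_quotient.right_module_image[OF q[OF that]] .
    show "\<phi> (Ident J i) y = y" if i: "i \<in> Obj J" and y: "y \<in> carrier (image_rmodule (q i) (N i))" for i y
    proof -
      interpret i: rmodule_quotient S "N i" "K i" "q i" by (rule q[OF i])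
      obtain x where x: "x \<in> carrier (N i)" "y = q i x" using y by auto
      show ?thesis
        using comm[of "Ident J i" x] N.Ident_in[OF i] N.\<phi>_Ident[OF i x(1)] x by simp
    qed
    fix a assume a: "a \<in> Arr J"
    interpret d: rmodule_quotient S "N (Dom J a)" "K (Dom J a)" "q (Dom J a)" by (rule q[OF N.Dom_in[OF a]])
    interpret c: rmodule_quotient S "N (Cod J a)" "K (Cod J a)" "q (Cod J a)" by (rule q[OF N.Cod_in[OF a]])
    interpret \<psi>: right_module_hom S "N (Dom J a)" "N (Cod J a)" "\<psi> a" by (rule hom[OF a])
    show "right_module_hom S (image_rmodule (q (Dom J a)) (N (Dom J a))) (image_rmodule (q (Cod J a)) (N (Cod J a))) (\<phi> a)"
      by (rule right_module_homI)
        (auto simp: d.right_module_image c.right_module_image comm[OF a] d.add_image c.add_image d.ract_image c.ract_image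
          \<psi>.hom_ract d.ract_closed)
    fix b y assume b: "b \<in> Arr J" "Dom J b = Cod J a" and y: "y \<in> carrier (image_rmodule (q (Dom J a)) (N (Dom J a)))"
    obtain x where x: "x \<in> carrier (N (Dom J a))" "y = q (Dom J a) x" using y by auto
    have ba: "Comp J b a \<in> Arr J" "Dom J (Comp J b a) = Dom J a" "Cod J (Comp J b a) = Cod J b"
      using N.Comp_in[OF a b] by auto
    show "\<phi> (Comp J b a) y = \<phi> b (\<phi> a y)"
      using comm[OF ba(1), of x] comm[OF a x(1)] comm[OF b(1), of "\<psi> a x"] x ba(2,3) b(2) N.\<phi>_Comp[OF a b x(1)] \<psi>.ah.hom_closed[OF x(1)]
      by simp
  qed
qed

lemma (in rmodule_quotient) lift_cochain:
  assumes "w \<in> carrier (cochains G k (image_rmodule q M))"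
  obtains v where "v \<in> carrier (cochains G k M)" "w = compose (bar_cells G k) q v"
proof
  let ?v = "\<lambda>xs\<in>bar_cells G k. inv_into (carrier M) q (w xs)"
  have w: "w xs \<in> q ` carrier M" if "xs \<in> bar_cells G k" for xs
    using cochain_closed[OF assms that] by simp
  show "?v \<in> carrier (cochains G k M)"
    unfolding carrier_cochains using inv_into_into[OF w] by (intro restrict_PiE_iff[THEN iffD2] ballI)
  show "w = compose (bar_cells G k) q ?v"
  proof (rule extensionalityI[where A = "bar_cells G k"])
    show "w \<in> extensional (bar_cells G k)" using assms by (simp add: carrier_cochains PiE_def)
    show "compose (bar_cells G k) q ?v \<in> extensional (bar_cells G k)" by simp
    show "w xs = compose (bar_cells G k) q ?v xs" if "xs \<in> bar_cells G k" for xs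
      using that f_inv_into_f[OF w[OF that]] by (simp add: compose_eq)
  qed
qed

text \<open>The property is applied to a quotient system \<open>N/K\<close> whose modules need not live in the type \<open>'u\<close>, as long
  as their cardinalities allow it; \<open>c\<close> is a cocycle of \<open>N/K\<close>.\<close>

lemma zero_finitary_modulo:
  fixes J :: "('u, 'u) small_category" and N :: "'u \<Rightarrow> ('g \<Rightarrow>\<^sub>0 int, 'v) rmodule"
  assumes G: "group G" and fin: "zero_finitary (group_ring G) (cohomology TYPE('u) G k)"
    and J: "filtered_category J" and N: "rmodule_system (group_ring G) J N \<psi>"
    and K: "\<And>i. i \<in> Obj J \<Longrightarrow> right_submodule (group_ring G) (N i) (K i)"
    and \<psi>K: "\<And>a x. \<lbrakk>a \<in> Arr J; x \<in> K (Dom J a)\<rbrakk> \<Longrightarrow> \<psi> a x \<in> K (Cod J a)"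
    and enc: "\<And>i. i \<in> Obj J \<Longrightarrow> \<exists>e :: 'v \<Rightarrow> 'u. inj_on e (carrier (N i))"
    and null: "\<And>i x. \<lbrakk>i \<in> Obj J; x \<in> carrier (N i)\<rbrakk> \<Longrightarrow> \<exists>a\<in>Arr J. Dom J a = i \<and> \<psi> a x \<in> K (Cod J a)"
    and i: "i \<in> Obj J" and c: "c \<in> carrier (cochains G k (N i))"
    and dc: "\<And>xs. xs \<in> bar_cells G (Suc k) \<Longrightarrow> coboundary G k (N i) c xs \<in> K i"
  obtains a d where "a \<in> Arr J" "Dom J a = i" "d \<in> coboundaries G k (N (Cod J a))"
    "\<And>xs. xs \<in> bar_cells G k \<Longrightarrow> \<psi> a (c xs) \<ominus>\<^bsub>N (Cod J a)\<^esub> d xs \<in> K (Cod J a)"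
proof -
  interpret J: filtered_category J by fact
  interpret N: rmodule_system "group_ring G" J N \<psi> by fact
  interpret G: group G by fact
  \<comment> \<open>Each q i takes values in 'u and has the cosets of \<open>K i\<close> as fibres,
    so the quotients form a system inside 'u to which \<open>fin\<close> applies.\<close>
  have "\<exists>q :: 'v \<Rightarrow> 'u. rmodule_quotient (group_ring G) (N i) (K i) q" if i: "i \<in> Obj J" for i
  proof -
    obtain e :: "'v \<Rightarrow> 'u" where "inj_on e (carrier (N i))" using enc[OF i] by blast
    from rmodule_quotient_exists[OF N.M_module[OF i] K[OF i] this]
    obtain q :: "'v \<Rightarrow> 'u" where "rmodule_quotient (group_ring G) (N i) (K i) q" .
    then show ?thesis by blast
  qed
  then obtain q :: "'u \<Rightarrow> 'v \<Rightarrow> 'u" where q: "rmodule_quotient (group_ring G) (N i) (K i) (q i)" if "i \<in> Obj J" for i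
    by metis
  define \<phi> where "\<phi> = (\<lambda>a y. q (Cod J a) (\<psi> a (inv_into (carrier (N (Dom J a))) (q (Dom J a)) y)))"
  let ?M = "\<lambda>i. image_rmodule (q i) (N i)"
  have sys: "\<And>a x. \<lbrakk>a \<in> Arr J; x \<in> carrier (N (Dom J a))\<rbrakk> \<Longrightarrow> \<phi> a (q (Dom J a) x) = q (Cod J a) (\<psi> a x)"
    "rmodule_system (group_ring G) J ?M \<phi>"
    unfolding \<phi>_def
  proof -
    fix a x assume "a \<in> Arr J" "x \<in> carrier (N (Dom J a))"
    then show "q (Cod J a) (\<psi> a (inv_into (carrier (N (Dom J a))) (q (Dom J a)) (q (Dom J a) x))) = q (Cod J a) (\<psi> a x)"
      by (intro quotient_system(1)[where K = K, OF N] q \<psi>K)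
  next
    show "rmodule_system (group_ring G) J ?M (\<lambda>a y. q (Cod J a) (\<psi> a (inv_into (carrier (N (Dom J a))) (q (Dom J a)) y)))"
      by (rule quotient_system(2)[where K = K, OF N]) (rule q, assumption, rule \<psi>K)
  qed
  have qK: "q i x = q i y \<longleftrightarrow> x \<ominus>\<^bsub>N i\<^esub> y \<in> K i" if "i \<in> Obj J" "x \<in> carrier (N i)" "y \<in> carrier (N i)" for i x y
    using rmodule_quotient.q_eq_iff[OF q[OF that(1)] that(2,3)] .
  have q0: "q i x = q i \<zero>\<^bsub>N i\<^esub> \<longleftrightarrow> x \<in> K i" if "i \<in> Obj J" "x \<in> carrier (N i)" for i x
  proof -
    interpret right_module "group_ring G" "N i" by (rule N.M_module[OF that(1)])
    show ?thesis using qK[OF that M.zero_closed] that(2) by (simp add: M.minus_zero_right)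
  qed
  have "null_system J ?M \<phi>"
    unfolding null_system_def
  proof (intro ballI)
    fix i y assume i: "i \<in> Obj J" "y \<in> carrier (?M i)"
    interpret i: rmodule_quotient "group_ring G" "N i" "K i" "q i" by (rule q[OF i(1)])
    obtain x where x: "x \<in> carrier (N i)" "y = q i x" using i(2) by auto
    from null[OF i(1) x(1)] obtain a where a: "a \<in> Arr J" "Dom J a = i" "\<psi> a x \<in> K (Cod J a)" by blast
    interpret c: rmodule_quotient "group_ring G" "N (Cod J a)" "K (Cod J a)" "q (Cod J a)" by (rule q[OF J.Cod_in[OF a(1)]])
    have "\<phi> a y = \<zero>\<^bsub>?M (Cod J a)\<^esub>"
      using sys(1)[OF a(1), of x] x a q0[OF J.Cod_in[OF a(1)]] right_submoduleD(1)[OF K[OF J.Cod_in[OF a(1)]] a(3)] by simp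
    then show "\<exists>a\<in>Arr J. Dom J a = i \<and> \<phi> a y = \<zero>\<^bsub>?M (Cod J a)\<^esub>" using a by blast
  qed
  then have null_coh: "null_cohomology G k J ?M \<phi>"
    using fin[unfolded zero_finitary_cohomology_iff[OF G]] J sys(2) by blast
  interpret i: rmodule_quotient "group_ring G" "N i" "K i" "q i" by (rule q[OF i])
  interpret qi: group_module_hom G "N i" "?M i" "q i"
    using i.q_hom G by (simp add: group_module_hom_def)
  let ?z = "compose (bar_cells G k) (q i) c"
  have "compose (bar_cells G (Suc k)) (q i) (coboundary G k (N i) c) = \<one>\<^bsub>cochains G (Suc k) (?M i)\<^esub>"
    unfolding compose_def one_cochains i.zero_image
  proof (rule restrict_ext)
    fix xs assume "xs \<in> bar_cells G (Suc k)"
    from dc[OF this] show "q i (coboundary G k (N i) c xs) = q i \<zero>\<^bsub>N i\<^esub>"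
      using q0[OF i right_submoduleD(1)[OF K[OF i]]] by blast
  qed
  then have "?z \<in> cocycles G k (?M i)"
    by (simp add: mem_cocycles qi.compose_closed[OF c] qi.compose_coboundary[OF c])
  with null_coh i obtain a where a: "a \<in> Arr J" "Dom J a = i"
    "compose (bar_cells G k) (\<phi> a) ?z \<in> coboundaries G k (?M (Cod J a))"
    unfolding null_cohomology_def by blast
  let ?j = "Cod J a"
  have j: "?j \<in> Obj J" by (rule J.Cod_in[OF a(1)])
  interpret j: rmodule_quotient "group_ring G" "N ?j" "K ?j" "q ?j" by (rule q[OF j])
  interpret qj: group_module_hom G "N ?j" "?M ?j" "q ?j"
    using j.q_hom G by (simp add: group_module_hom_def)
  interpret \<psi>: right_module_hom "group_ring G" "N i" "N ?j" "\<psi> a"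
    using N.right_module_hom_\<phi>[OF a(1)] a(2) by simp
  have \<phi>z: "compose (bar_cells G k) (\<phi> a) ?z xs = q ?j (\<psi> a (c xs))" if "xs \<in> bar_cells G k" for xs
    using sys(1)[OF a(1)] a(2) cochain_closed[OF c that] that by (simp add: compose_eq)
  \<comment> \<open>A coboundary of the quotient comes from a cochain w of the quotient; lifting w
    value by value and taking its coboundary gives d. In degree 0 the only coboundary is the trivial
    cochain.\<close>
  obtain d where d: "d \<in> coboundaries G k (N ?j)" "compose (bar_cells G k) (\<phi> a) ?z = compose (bar_cells G k) (q ?j) d"
  proof (cases k)
    case 0
    have "\<one>\<^bsub>cochains G 0 (N ?j)\<^esub> \<in> coboundaries G k (N ?j)" by (simp add: 0 coboundaries_def)
    moreover have "compose (bar_cells G k) (\<phi> a) ?z = compose (bar_cells G k) (q ?j) \<one>\<^bsub>cochains G 0 (N ?j)\<^esub>"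
      using a(3) qj.compose_one[of 0] by (simp add: 0 coboundaries_def)
    ultimately show ?thesis by (rule that)
  next
    case (Suc m)
    then obtain w where w: "w \<in> carrier (cochains G m (?M ?j))"
      "compose (bar_cells G k) (\<phi> a) ?z = coboundary G m (?M ?j) w"
      using a(3) by (auto simp: coboundaries_def)
    from j.lift_cochain[OF w(1)] obtain v where v: "v \<in> carrier (cochains G m (N ?j))" "w = compose (bar_cells G m) (q ?j) v" .
    have "coboundary G m (N ?j) v \<in> coboundaries G k (N ?j)" using v(1) by (simp add: Suc coboundaries_def)
    moreover have "compose (bar_cells G k) (\<phi> a) ?z = compose (bar_cells G k) (q ?j) (coboundary G m (N ?j) v)"
      unfolding w(2) unfolding v(2) Suc by (rule qj.compose_coboundary[OF v(1)])
    ultimately show ?thesis by (rule that)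
  qed
  show ?thesis
  proof (rule that[OF a(1,2) d(1)])
    fix xs assume xs: "xs \<in> bar_cells G k"
    have "d \<in> carrier (cochains G k (N ?j))" using subgroup.mem_carrier[OF qj.GM.coboundaries_subgroup d(1)] .
    then have dx: "d xs \<in> carrier (N ?j)" using xs by (rule cochain_closed)
    have "q ?j (\<psi> a (c xs)) = q ?j (d xs)"
      using \<phi>z[OF xs] fun_cong[OF d(2), of xs] xs by (simp add: compose_eq)
    then show "\<psi> a (c xs) \<ominus>\<^bsub>N ?j\<^esub> d xs \<in> K ?j"
      using qK[OF j \<psi>.ah.hom_closed[OF cochain_closed[OF c xs]] dx] by simp
  qed
qed

section \<open>Free covers of a system\<close>

lemma rmodule_system_submodule:
  assumes N: "rmodule_system S J N \<psi>"
    and K: "\<And>i. i \<in> Obj J \<Longrightarrow> right_submodule S (N i) (K i)"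
    and \<psi>K: "\<And>a x. \<lbrakk>a \<in> Arr J; x \<in> K (Dom J a)\<rbrakk> \<Longrightarrow> \<psi> a x \<in> K (Cod J a)"
  shows "rmodule_system S J (\<lambda>i. (N i)\<lparr>carrier := K i\<rparr>) \<psi>"
proof -
  interpret N: rmodule_system S J N \<psi> by fact
  note sub = right_module.right_module_submodule[OF N.M_module K]
  show ?thesis
  proof (rule rmodule_systemI[OF N.small_category_axioms N.S.ring_axioms])
    show "right_module S ((N i)\<lparr>carrier := K i\<rparr>)" if "i \<in> Obj J" for i by (rule sub[OF that that])
    show "right_module_hom S ((N (Dom J a))\<lparr>carrier := K (Dom J a)\<rparr>) ((N (Cod J a))\<lparr>carrier := K (Cod J a)\<rparr>) (\<psi> a)"
      if a: "a \<in> Arr J" for a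
    proof -
      interpret right_module_hom S "N (Dom J a)" "N (Cod J a)" "\<psi> a"
        by (rule N.right_module_hom_\<phi>[OF a])
      show ?thesis
        using right_submoduleD(1)[OF K[OF N.Dom_in[OF a]]] \<psi>K[OF a] N.Dom_in[OF a] N.Cod_in[OF a]
        by (intro right_module_homI sub) (auto simp: hom_ract)
    qed
  qed (use right_submoduleD(1)[OF K] N.\<phi>_Ident N.\<phi>_Comp N.Dom_in in auto)
qed

lemma rmodule_system_restrict_scalars:
  assumes N: "rmodule_system S J N \<psi>" and T: "ring T" "j \<in> ring_hom T S"
  shows "rmodule_system T J (\<lambda>i. restrict_scalars j (N i)) \<psi>"
proof -
  interpret N: rmodule_system S J N \<psi> by fact
  show ?thesis
    using N.M_module N.right_module_hom_\<phi> N.\<phi>_Ident N.\<phi>_Comp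
    by (intro rmodule_systemI N.small_category_axioms T right_module_restrict_scalars[OF T] right_module_hom_restrict_scalars[OF T])
      auto
qed

lemma (in right_module) right_module_hom_single:
  assumes "i \<in> I" shows "right_module_hom S M (direct_sum I M) (single M i)"
  by (intro right_module_homI right_module_direct_sum right_module_axioms single_closed[OF assms])
    (auto simp: single_def ract_zero_left fun_eq_iff)

text \<open>The map of direct sums induced by a partial map of the index sets, which is \<open>\<phi>\<close> where \<open>\<phi>\<close> takes values
  in \<open>I'\<close>.\<close>

definition pushforward :: "('s, 'm, 'b) rmodule_scheme \<Rightarrow> 'j set \<Rightarrow> ('i \<Rightarrow> 'j) \<Rightarrow> ('i \<Rightarrow> 'm) \<Rightarrow> 'j \<Rightarrow> 'm"
  where "pushforward V I' \<phi> =
    direct_sum_ext V (direct_sum I' V) (\<lambda>i. if \<phi> i \<in> I' then single V (\<phi> i) else (\<lambda>_ _. \<zero>\<^bsub>V\<^esub>))"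

context
  fixes S :: "('s, 'a) ring_scheme" and V :: "('s, 'm, 'b) rmodule_scheme"
  assumes V: "right_module S V"
begin

interpretation V: right_module S V by (rule V)

lemma pushforward_summand:
  "right_module_hom S V (direct_sum I' V) (if \<phi> i \<in> I' then single V (\<phi> i) else (\<lambda>_ _. \<zero>\<^bsub>V\<^esub>))"
  using V.right_module_hom_single[of "\<phi> i" I'] right_module_hom_zero[OF V right_module_direct_sum[OF V, of I']]
  by simp

lemma pushforward_hom: "right_module_hom S (direct_sum I V) (direct_sum I' V) (pushforward V I' \<phi>)"
  unfolding pushforward_def
  by (intro direct_sum_ext_hom V right_module_direct_sum pushforward_summand)

lemma pushforward_single:
  "x \<in> carrier V \<Longrightarrow> pushforward V I' \<phi> (single V i x) = (if \<phi> i \<in> I' then single V (\<phi> i) x else (\<lambda>_. \<zero>\<^bsub>V\<^esub>))"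
  unfolding pushforward_def
  using direct_sum_ext_single[where i = i and u = "\<lambda>i. if \<phi> i \<in> I' then single V (\<phi> i) else (\<lambda>_ _. \<zero>\<^bsub>V\<^esub>)",
      OF pushforward_summand[where \<phi> = \<phi> and i = i and I' = I']]
  by simp

text \<open>\<chi> has to be the composite as a partial map: an index that \<phi> drops must be
  dropped by \<chi> as well.\<close>

lemma pushforward_pushforward:
  assumes "\<And>i. \<lbrakk>i \<in> I; \<phi> i \<in> I'\<rbrakk> \<Longrightarrow> \<chi> i = \<psi> (\<phi> i)" "\<And>i. \<lbrakk>i \<in> I; \<phi> i \<notin> I'\<rbrakk> \<Longrightarrow> \<chi> i \<notin> I''"
    and f: "f \<in> carrier (direct_sum I V)"
  shows "pushforward V I'' \<chi> f = pushforward V I'' \<psi> (pushforward V I' \<phi> f)"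
proof (rule direct_sum_hom_eqI[OF pushforward_hom right_module_hom_comp[OF pushforward_hom pushforward_hom] V _ f])
  fix i x assume "i \<in> I" "x \<in> carrier V"
  moreover have "pushforward V I'' \<psi> (\<lambda>_. \<zero>\<^bsub>V\<^esub>) = (\<lambda>_. \<zero>\<^bsub>V\<^esub>)"
  proof -
    interpret right_module_hom S "direct_sum I' V" "direct_sum I'' V" "pushforward V I'' \<psi>" by (rule pushforward_hom)
    show ?thesis using ah.hom_zero by simp
  qed
  ultimately show "pushforward V I'' \<chi> (single V i x) = pushforward V I'' \<psi> (pushforward V I' \<phi> (single V i x))"
    using assms(1,2)[of i] by (simp add: pushforward_single)
qed

lemma pushforward_id:
  assumes "\<And>i. i \<in> I \<Longrightarrow> \<phi> i = i" and f: "f \<in> carrier (direct_sum I V)"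
  shows "pushforward V I \<phi> f = f"
  by (rule direct_sum_hom_eqI[OF pushforward_hom right_module_hom_id[OF right_module_direct_sum[OF V]] V _ f])
    (simp add: pushforward_single assms(1))

end

text \<open>The zero element is left out of the index set so that elements that die in the system also die in the direct sums.\<close>

abbreviation nonzero :: "('s, 'm, 'b) rmodule_scheme \<Rightarrow> 'm set"
  where "nonzero M \<equiv> carrier M - {\<zero>\<^bsub>M\<^esub>}"

text \<open>The index sets come from a system over S, the coefficients V from an independent ring W.
  With W the group ring this yields the modules F, with W = R the modules E.\<close>

context
  fixes W :: "('w, 'a) ring_scheme" and V :: "('w, 'v, 'b) rmodule_scheme"
    and S :: "('s, 'c) ring_scheme" and J :: "('o, 'x) small_category" and M :: "'o \<Rightarrow> ('s, 'm) rmodule" and \<phi>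
  assumes V: "right_module W V" and M: "rmodule_system S J M \<phi>"
begin

interpretation M: rmodule_system S J M \<phi> by (rule M)

lemma direct_sum_system:
  "rmodule_system W J (\<lambda>i. direct_sum (nonzero (M i)) V) (\<lambda>a. pushforward V (nonzero (M (Cod J a))) (\<phi> a))"
proof (rule rmodule_systemI[OF M.small_category_axioms])
  show "ring W" using V by (simp add: right_module_def)
  show "right_module W (direct_sum (nonzero (M i)) V)" for i by (rule right_module_direct_sum[OF V])
  show "right_module_hom W (direct_sum (nonzero (M (Dom J a))) V) (direct_sum (nonzero (M (Cod J a))) V)
      (pushforward V (nonzero (M (Cod J a))) (\<phi> a))" for a
    by (rule pushforward_hom[OF V])
  show "pushforward V (nonzero (M (Cod J (Ident J i)))) (\<phi> (Ident J i)) f = f"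
    if "i \<in> Obj J" "f \<in> carrier (direct_sum (nonzero (M i)) V)" for i f
  proof -
    have "Cod J (Ident J i) = i" using M.Ident_in[OF that(1)] by simp
    then show ?thesis
      using M.\<phi>_Ident[OF that(1)] pushforward_id[OF V _ that(2), of "\<phi> (Ident J i)"] by simp
  qed
  fix a b f assume a: "a \<in> Arr J" "b \<in> Arr J" "Dom J b = Cod J a" and f: "f \<in> carrier (direct_sum (nonzero (M (Dom J a))) V)"
  interpret a: right_module_hom S "M (Dom J a)" "M (Cod J a)" "\<phi> a"
    by (rule M.right_module_hom_\<phi>[OF a(1)])
  interpret b: right_module_hom S "M (Cod J a)" "M (Cod J b)" "\<phi> b"
    using M.right_module_hom_\<phi>[OF a(2)] a(3) by simp
  have "Cod J (Comp J b a) = Cod J b" using M.Comp_in[OF a] by simp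
  \<comment> \<open>An element that \<phi> a sends to zero is dropped at once. The composite drops
    it as well, because \<phi> b preserves zero.\<close>
  moreover have "pushforward V (nonzero (M (Cod J b))) (\<phi> (Comp J b a)) f
      = pushforward V (nonzero (M (Cod J b))) (\<phi> b) (pushforward V (nonzero (M (Cod J a))) (\<phi> a) f)"
    using M.\<phi>_Comp[OF a] b.ah.hom_zero
    by (intro pushforward_pushforward[OF V _ _ f]) auto
  ultimately show "pushforward V (nonzero (M (Cod J (Comp J b a)))) (\<phi> (Comp J b a)) f
      = pushforward V (nonzero (M (Cod J b))) (\<phi> b) (pushforward V (nonzero (M (Cod J a))) (\<phi> a) f)" by simp
qed

lemma direct_sum_null:
  assumes J: "filtered_category J" and null: "null_system J M \<phi>"
  shows "null_system J (\<lambda>i. direct_sum (nonzero (M i)) V) (\<lambda>a. pushforward V (nonzero (M (Cod J a))) (\<phi> a))"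
  unfolding null_system_def
proof (intro ballI)
  interpret J: filtered_category J by fact
  interpret V: right_module W V by (rule V)
  interpret D: rmodule_system W J "\<lambda>i. direct_sum (nonzero (M i)) V" "\<lambda>a. pushforward V (nonzero (M (Cod J a))) (\<phi> a)"
    by (rule direct_sum_system)
  let ?p = "\<lambda>a. pushforward V (nonzero (M (Cod J a))) (\<phi> a)"
  fix i f assume i: "i \<in> Obj J" and f: "f \<in> carrier (direct_sum (nonzero (M i)) V)"
  from f show "\<exists>a\<in>Arr J. Dom J a = i \<and> ?p a f = \<zero>\<^bsub>direct_sum (nonzero (M (Cod J a))) V\<^esub>"
  proof (induction rule: V.direct_sum_induct)
    case zero
    interpret right_module_hom W "direct_sum (nonzero (M i)) V" "direct_sum (nonzero (M i)) V" "?p (Ident J i)"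
      using D.right_module_hom_\<phi>[of "Ident J i"] M.Ident_in[OF i] by simp
    show ?case using M.Ident_in[OF i] ah.hom_zero by (intro bexI[of _ "Ident J i"]) auto
  next
    case (single m x)
    then have "m \<in> carrier (M i)" by simp
    with null i obtain a where a: "a \<in> Arr J" "Dom J a = i" "\<phi> a m = \<zero>\<^bsub>M (Cod J a)\<^esub>"
      unfolding null_system_def by blast
    then show ?case using single by (intro bexI[of _ a]) (simp_all add: pushforward_single[OF V])
  next
    case (add f g)
    then obtain a b where a: "a \<in> Arr J" "Dom J a = i" "?p a f = \<zero>\<^bsub>direct_sum (nonzero (M (Cod J a))) V\<^esub>"
      and b: "b \<in> Arr J" "Dom J b = i" "?p b g = \<zero>\<^bsub>direct_sum (nonzero (M (Cod J b))) V\<^esub>" by blast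
    \<comment> \<open>The arrows that kill f and g may differ; completing them to a commutative
      square gives one arrow that kills both.\<close>
    obtain c d where cd: "c \<in> Arr J" "d \<in> Arr J" "Dom J c = Cod J a" "Dom J d = Cod J b"
      "Cod J c = Cod J d" "Comp J c a = Comp J d b"
      using J.span_completion[OF a(1) b(1)] a(2) b(2) by metis
    let ?e = "Comp J c a"
    have e: "?e \<in> Arr J" "Dom J ?e = i" "Cod J ?e = Cod J c" using M.Comp_in[OF a(1) cd(1) cd(3)] a(2) by auto
    interpret c: right_module_hom W "direct_sum (nonzero (M (Cod J a))) V" "direct_sum (nonzero (M (Cod J c))) V" "?p c"
      using D.right_module_hom_\<phi>[OF cd(1)] cd(3) by simp
    interpret d: right_module_hom W "direct_sum (nonzero (M (Cod J b))) V" "direct_sum (nonzero (M (Cod J d))) V" "?p d"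
      using D.right_module_hom_\<phi>[OF cd(2)] cd(4) by simp
    interpret e: right_module_hom W "direct_sum (nonzero (M i)) V" "direct_sum (nonzero (M (Cod J c))) V" "?p ?e"
      using D.right_module_hom_\<phi>[OF e(1)] e by simp
    have "?p ?e f = \<zero>\<^bsub>direct_sum (nonzero (M (Cod J c))) V\<^esub>"
      using D.\<phi>_Comp[OF a(1) cd(1) cd(3)] a add(1) c.ah.hom_zero by simp
    moreover have "?p ?e g = \<zero>\<^bsub>direct_sum (nonzero (M (Cod J c))) V\<^esub>"
      using D.\<phi>_Comp[OF b(1) cd(2) cd(4)] b add(2) d.ah.hom_zero cd(5,6) by simp
    ultimately have "?p ?e (f \<oplus>\<^bsub>direct_sum (nonzero (M i)) V\<^esub> g) = \<zero>\<^bsub>direct_sum (nonzero (M (Cod J c))) V\<^esub>"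
      using e.ah.hom_add[OF add(1,2)] by simp
    then show ?case using e by (intro bexI[of _ ?e]) auto
  qed
qed

end

lemma (in group_module) coboundary_submodule:
  assumes K: "right_submodule (group_ring G) M K" and c: "c \<in> carrier (cochains G k (M\<lparr>carrier := K\<rparr>))"
  shows "coboundary G k (M\<lparr>carrier := K\<rparr>) c = coboundary G k M c"
proof -
  interpret i: group_module_hom G "M\<lparr>carrier := K\<rparr>" M "\<lambda>x. x"
    using right_module_hom_submodule[OF K] by (simp add: group_module_hom_def group_axioms)
  have id: "compose (bar_cells G l) (\<lambda>x. x) d = d" if "d \<in> carrier (cochains G l (M\<lparr>carrier := K\<rparr>))" for l d
    using that unfolding carrier_cochains compose_def by (simp add: PiE_restrict restrict_def[symmetric])
  show ?thesis
    using i.compose_coboundary[OF c] unfolding id[OF c] id[OF i.GM.coboundary_closed[OF c]] by simp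
qed

lemma (in group_module_hom) compose_group_hom:
  "group_hom (cochains G k M) (cochains G k N) (compose (bar_cells G k) f)"
  using compose_closed compose_mult comm_group.axioms(2)[OF M.comm_group_cochains] comm_group.axioms(2)[OF N.comm_group_cochains]
  by (auto simp: group_hom_def group_hom_axioms_def hom_def)

lemma compose_compose_eqI:
  "(\<And>x. x \<in> A \<Longrightarrow> f (g (c x)) = h (k (c x))) \<Longrightarrow> compose A f (compose A g c) = compose A h (compose A k c)"
  by (auto simp: compose_def intro!: restrict_ext)

section \<open>The free covers of the system and the chase\<close>

context flat_overring
begin

context
  fixes J :: "('u, 'u) small_category" and M :: "'u \<Rightarrow> ('g \<Rightarrow>\<^sub>0 int, 'u) rmodule" and \<phi>
  assumes J: "filtered_category J" and M: "rmodule_system (group_ring G) J M \<phi>" and null: "null_system J M \<phi>"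
begin

interpretation J: filtered_category J by (rule J)
interpretation M: rmodule_system "group_ring G" J M \<phi> by (rule M)

abbreviation F where "F i \<equiv> free_rmodule (group_ring G) (nonzero (M i))"

text \<open>The base change of \<open>F i\<close> to R: the free R-module on the same index set,
  seen as a module over the group ring.\<close>

abbreviation E where "E i \<equiv> restrict_scalars \<iota> (free_rmodule R (nonzero (M i)))"

abbreviation pushF where "pushF a \<equiv> pushforward (regular_rmodule (group_ring G)) (nonzero (M (Cod J a))) (\<phi> a)"

abbreviation pushE where "pushE a \<equiv> pushforward (regular_rmodule R) (nonzero (M (Cod J a))) (\<phi> a)"

abbreviation cover where "cover i \<equiv> linear_ext (group_ring G) (M i) (\<lambda>m. m)"

abbreviation incl :: "('u \<Rightarrow> 'g \<Rightarrow>\<^sub>0 int) \<Rightarrow> 'u \<Rightarrow> 'u" where "incl f \<equiv> (\<lambda>m. \<iota> (f m))"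

lemma F_system: "rmodule_system (group_ring G) J F pushF"
  using direct_sum_system[OF ZG.right_module_regular M] unfolding free_rmodule_def .

lemma E_system: "rmodule_system (group_ring G) J E pushE"
  using rmodule_system_restrict_scalars[OF direct_sum_system[OF S.right_module_regular M] ZG.ring_axioms j_hom]
  unfolding free_rmodule_def .

lemma F_null: "null_system J F pushF"
  using direct_sum_null[OF ZG.right_module_regular M J null] unfolding free_rmodule_def .

lemma E_null: "null_system J E pushE"
  using direct_sum_null[OF S.right_module_regular M J null] unfolding free_rmodule_def null_system_def by simp

lemma pushF_hom: "a \<in> Arr J \<Longrightarrow> right_module_hom (group_ring G) (F (Dom J a)) (F (Cod J a)) (pushF a)"
  using rmodule_system.right_module_hom_\<phi>[OF F_system] .

lemma pushE_hom: "a \<in> Arr J \<Longrightarrow> right_module_hom (group_ring G) (E (Dom J a)) (E (Cod J a)) (pushE a)"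
  using rmodule_system.right_module_hom_\<phi>[OF E_system] .

lemma cover_hom: "i \<in> Obj J \<Longrightarrow> right_module_hom (group_ring G) (F i) (M i) (cover i)"
  by (intro right_module.linear_ext_hom M.M_module) auto

lemma incl_hom: "right_module_hom (group_ring G) (F i) (E i) incl"
  by (rule extend_scalars_hom)

lemma incl_inj: "inj_on incl (carrier (F i))"
proof (rule inj_onI, rule ext)
  fix f g m assume "f \<in> carrier (F i)" "g \<in> carrier (F i)" and eq: "incl f = incl g"
  then have "f m \<in> carrier (group_ring G)" "g m \<in> carrier (group_ring G)"
    by (auto simp: free_rmodule_def carrier_direct_sum)
  then show "f m = g m" using fun_cong[OF eq, of m] by (intro inj_onD[OF inj])
qed

lemma pushF_basis:
  "pushF a (basis (group_ring G) m)
    = (if \<phi> a m \<in> nonzero (M (Cod J a)) then basis (group_ring G) (\<phi> a m) else \<zero>\<^bsub>F (Cod J a)\<^esub>)"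
  using pushforward_single[OF ZG.right_module_regular, of "\<one>\<^bsub>group_ring G\<^esub>" "nonzero (M (Cod J a))" "\<phi> a" m]
  unfolding basis_def free_rmodule_def by (simp only: regular_rmodule_simps ZG.one_closed direct_sum_simps)

lemma pushE_basis:
  "pushE a (basis R m) = (if \<phi> a m \<in> nonzero (M (Cod J a)) then basis R (\<phi> a m) else \<zero>\<^bsub>E (Cod J a)\<^esub>)"
  using pushforward_single[OF S.right_module_regular, of "\<one>\<^bsub>R\<^esub>" "nonzero (M (Cod J a))" "\<phi> a" m]
  unfolding basis_def free_rmodule_def by (simp only: regular_rmodule_simps S.one_closed direct_sum_simps restrict_scalars_simps)

lemma cover_pushF:
  assumes a: "a \<in> Arr J" and f: "f \<in> carrier (F (Dom J a))"
  shows "cover (Cod J a) (pushF a f) = \<phi> a (cover (Dom J a) f)"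
proof (rule free_rmodule_hom_eqI[OF _ _ _ f])
  interpret d: right_module "group_ring G" "M (Dom J a)" by (rule M.M_module[OF J.Dom_in[OF a]])
  interpret c: right_module "group_ring G" "M (Cod J a)" by (rule M.M_module[OF J.Cod_in[OF a]])
  interpret cov: right_module_hom "group_ring G" "F (Cod J a)" "M (Cod J a)" "cover (Cod J a)"
    by (rule cover_hom[OF J.Cod_in[OF a]])
  interpret a: right_module_hom "group_ring G" "M (Dom J a)" "M (Cod J a)" "\<phi> a"
    by (rule M.right_module_hom_\<phi>[OF a])
  show "right_module_hom (group_ring G) (F (Dom J a)) (M (Cod J a)) (\<lambda>f. cover (Cod J a) (pushF a f))"
    by (rule right_module_hom_comp[OF pushF_hom[OF a] cov.right_module_hom_axioms])
  show "right_module_hom (group_ring G) (F (Dom J a)) (M (Cod J a)) (\<lambda>f. \<phi> a (cover (Dom J a) f))"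
    by (rule right_module_hom_comp[OF cover_hom[OF J.Dom_in[OF a]] a.right_module_hom_axioms])
  fix m assume "m \<in> nonzero (M (Dom J a))"
  then have m: "m \<in> carrier (M (Dom J a))" by simp
  show "cover (Cod J a) (pushF a (basis (group_ring G) m)) = \<phi> a (cover (Dom J a) (basis (group_ring G) m))"
    unfolding pushF_basis d.linear_ext_basis[where c = "\<lambda>m. m", OF m]
    using c.linear_ext_basis[where c = "\<lambda>m. m", OF a.ah.hom_closed[OF m]] a.ah.hom_closed[OF m] cov.ah.hom_zero
    by auto
qed

lemma incl_pushF:
  assumes a: "a \<in> Arr J" and f: "f \<in> carrier (F (Dom J a))"
  shows "incl (pushF a f) = pushE a (incl f)"
proof (rule free_rmodule_hom_eqI[OF right_module_hom_comp[OF pushF_hom[OF a] incl_hom]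
      right_module_hom_comp[OF incl_hom pushE_hom[OF a]] _ f])
  interpret i: right_module_hom "group_ring G" "F (Cod J a)" "E (Cod J a)" incl by (rule incl_hom)
  fix m
  show "incl (pushF a (basis (group_ring G) m)) = pushE a (incl (basis (group_ring G) m))"
    unfolding extend_scalars_basis pushE_basis pushF_basis
    using i.ah.hom_zero by (auto simp: extend_scalars_basis)
qed

lemma cover_surj:
  assumes i: "i \<in> Obj J" and x: "x \<in> carrier (M i)"
  obtains f where "f \<in> carrier (F i)" "cover i f = x"
proof (cases "x = \<zero>\<^bsub>M i\<^esub>")
  case True
  interpret c: right_module_hom "group_ring G" "F i" "M i" "cover i" by (rule cover_hom[OF i])
  show ?thesis by (rule that[OF c.M.M.zero_closed]) (simp only: True c.ah.hom_zero)
next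
  case False
  have "basis (group_ring G) x \<in> carrier (F i)" using x False by (intro ZG.basis_closed) simp
  moreover have "cover i (basis (group_ring G) x) = x"
    by (rule right_module.linear_ext_basis[OF M.M_module[OF i], where c = "\<lambda>m. m", OF x])
  ultimately show ?thesis by (rule that)
qed

lemma F_encoding: "\<exists>e :: ('u \<Rightarrow> 'g \<Rightarrow>\<^sub>0 int) \<Rightarrow> 'u. inj_on e (carrier (F i))"
  by (rule free_encoding[of "\<lambda>m. m" "nonzero (M i)"]) (simp, rule exI)

lemma E_encoding: "\<exists>e :: ('u \<Rightarrow> 'u) \<Rightarrow> 'u. inj_on e (carrier (E i))"
proof -
  obtain e :: "('u \<Rightarrow> 'u) \<Rightarrow> 'u" where "inj_on e {f. (\<forall>m. f m \<in> carrier R) \<and>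
    (\<forall>m. m \<notin> nonzero (M i) \<longrightarrow> f m = \<zero>\<^bsub>R\<^esub>) \<and> finite {m. f m \<noteq> \<zero>\<^bsub>R\<^esub>}}"
    by (rule finite_support_encoding[OF infinite_UNIV inj_on_id2 inj_on_id2])
  then show ?thesis by (auto simp: free_rmodule_def carrier_direct_sum)
qed

text \<open>The exact sequences of the overview, written as a chase on cochains with n =
  \<open>Suc m\<close>. The hypothesis in degree n + 1 costs an arrow a, the one in degree n - 1 an
  arrow b, and z becomes a coboundary along b after a.\<close>

lemma null_cohomology_Suc:
  assumes fin: "zero_finitary (group_ring G) (cohomology TYPE('u) G m)"
    and fin': "zero_finitary (group_ring G) (cohomology TYPE('u) G (Suc (Suc m)))"
  shows "null_cohomology G (Suc m) J M \<phi>"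
  unfolding null_cohomology_def
proof (intro ballI)
  fix i z assume i: "i \<in> Obj J" and z: "z \<in> cocycles G (Suc m) (M i)"
  let ?n = "Suc m"
  have zc: "z \<in> carrier (cochains G ?n (M i))" "coboundary G ?n (M i) z = \<one>\<^bsub>cochains G (Suc ?n) (M i)\<^esub>"
    using z by (simp_all add: mem_cocycles)
  have cov: "group_module_hom G (F i) (M i) (cover i)" if "i \<in> Obj J" for i
    using cover_hom[OF that] by (simp add: group_module_hom_def G.group_axioms)
  have pF: "group_module_hom G (F (Dom J a)) (F (Cod J a)) (pushF a)" if "a \<in> Arr J" for a
    using pushF_hom[OF that] by (simp add: group_module_hom_def G.group_axioms)
  have pE: "group_module_hom G (E (Dom J a)) (E (Cod J a)) (pushE a)" if "a \<in> Arr J" for a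
    using pushE_hom[OF that] by (simp add: group_module_hom_def G.group_axioms)
  have inc: "group_module_hom G (F i) (E i) incl" for i
    using incl_hom by (simp add: group_module_hom_def G.group_axioms)
  define \<Omega> where "\<Omega> i = {f \<in> carrier (F i). cover i f = \<zero>\<^bsub>M i\<^esub>}" for i
  have \<Omega>: "right_submodule (group_ring G) (F i) (\<Omega> i)" if "i \<in> Obj J" for i
    unfolding \<Omega>_def by (rule right_module_hom.right_submodule_kernel[OF cover_hom[OF that]])
  let ?O = "\<lambda>i. (F i)\<lparr>carrier := \<Omega> i\<rparr>"
  have \<Omega>_push: "pushF a f \<in> \<Omega> (Cod J a)" if a: "a \<in> Arr J" and f: "f \<in> \<Omega> (Dom J a)" for a f
  proof -
    interpret p: group_module_hom G "F (Dom J a)" "F (Cod J a)" "pushF a" by (rule pF[OF a])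
    interpret a: right_module_hom "group_ring G" "M (Dom J a)" "M (Cod J a)" "\<phi> a"
      by (rule M.right_module_hom_\<phi>[OF a])
    have "f \<in> carrier (F (Dom J a))" "cover (Dom J a) f = \<zero>\<^bsub>M (Dom J a)\<^esub>" using f by (simp_all add: \<Omega>_def)
    then show ?thesis
      unfolding \<Omega>_def using cover_pushF[OF a] a.ah.hom_zero p.ah.hom_closed by simp
  qed
  have \<Omega>_system: "rmodule_system (group_ring G) J ?O pushF"
    by (rule rmodule_system_submodule[OF F_system \<Omega> \<Omega>_push])

  interpret ci: group_module_hom G "F i" "M i" "cover i" by (rule cov[OF i])
  \<comment> \<open>A set-theoretic section of the cover. It need not be additive: cochains are
    functions on bar cells, so they can be lifted value by value.\<close>
  define s where "s x = (SOME f. f \<in> carrier (F i) \<and> cover i f = x)" for x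
  have s: "s x \<in> carrier (F i) \<and> cover i (s x) = x" if x: "x \<in> carrier (M i)" for x
  proof -
    obtain f where "f \<in> carrier (F i)" "cover i f = x" by (rule cover_surj[OF i x])
    then show ?thesis unfolding s_def by (intro someI[of "\<lambda>f. f \<in> carrier (F i) \<and> cover i f = x"] conjI)
  qed
  define f where "f = compose (bar_cells G ?n) s z"
  have f: "f \<in> carrier (cochains G ?n (F i))"
    using s cochain_closed[OF zc(1)] by (auto simp: f_def carrier_cochains compose_def)
  have cover_f: "compose (bar_cells G ?n) (cover i) f = z"
  proof -
    have "compose (bar_cells G ?n) (cover i) f = restrict z (bar_cells G ?n)"
      using s cochain_closed[OF zc(1)] by (auto simp: f_def compose_def intro!: restrict_ext)
    then show ?thesis using zc(1) by (simp add: carrier_cochains PiE_restrict)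
  qed
  \<comment> \<open>f is a lift of z as a cochain only. Its coboundary is a cocycle with values in
    \<Omega> and represents the image of z under the connecting homomorphism to degree n +
    1.\<close>
  let ?g = "coboundary G ?n (F i) f"
  have g: "?g \<in> carrier (cochains G (Suc ?n) (F i))" by (rule ci.GM.coboundary_closed[OF f])
  have cg: "compose (bar_cells G (Suc ?n)) (cover i) ?g = \<one>\<^bsub>cochains G (Suc ?n) (M i)\<^esub>"
    using ci.compose_coboundary[OF f] unfolding cover_f zc(2) by simp
  have "cover i (?g xs) = \<zero>\<^bsub>M i\<^esub>" if "xs \<in> bar_cells G (Suc ?n)" for xs
    using fun_cong[OF cg, of xs] that by (simp add: compose_eq one_cochains)
  then have g\<Omega>: "?g \<in> carrier (cochains G (Suc ?n) (?O i))"
    using g cochain_closed[OF g] by (auto simp: carrier_cochains \<Omega>_def PiE_iff)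
  have dg: "coboundary G (Suc ?n) (?O i) ?g xs \<in> {\<zero>\<^bsub>?O i\<^esub>}" if "xs \<in> bar_cells G (Suc (Suc ?n))" for xs
    unfolding ci.GM.coboundary_submodule[OF \<Omega>[OF i] g\<Omega>] ci.GM.coboundary_coboundary[OF f]
    using that by (simp add: one_cochains)

  \<comment> \<open>The hypothesis in degree n + 1. The submodules are zero here, so
    \<open>zero_finitary_modulo\<close> merely moves the modules \<Omega> into 'u.\<close>
  obtain a d where a: "a \<in> Arr J" "Dom J a = i" and d: "d \<in> coboundaries G (Suc ?n) (?O (Cod J a))"
    and ad: "\<And>xs. xs \<in> bar_cells G (Suc ?n) \<Longrightarrow> pushF a (?g xs) \<ominus>\<^bsub>?O (Cod J a)\<^esub> d xs \<in> {\<zero>\<^bsub>?O (Cod J a)\<^esub>}"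
  proof (rule zero_finitary_modulo[where K = "\<lambda>i. {\<zero>\<^bsub>?O i\<^esub>}" and N = ?O and \<psi> = pushF and i = i and c = ?g,
        OF G.group_axioms fin' J \<Omega>_system _ _ _ _ i g\<Omega> dg])
    show "right_submodule (group_ring G) (?O i) {\<zero>\<^bsub>?O i\<^esub>}" if "i \<in> Obj J" for i
      by (rule right_module.right_submodule_zero[OF rmodule_system.M_module[OF \<Omega>_system that]])
    show "pushF a x \<in> {\<zero>\<^bsub>?O (Cod J a)\<^esub>}" if "a \<in> Arr J" "x \<in> {\<zero>\<^bsub>?O (Dom J a)\<^esub>}" for a x
    proof -
      interpret right_module_hom "group_ring G" "F (Dom J a)" "F (Cod J a)" "pushF a" by (rule pushF_hom[OF that(1)])
      show ?thesis using that(2) ah.hom_zero by simp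
    qed
    show "\<exists>e :: ('u \<Rightarrow> 'g \<Rightarrow>\<^sub>0 int) \<Rightarrow> 'u. inj_on e (carrier (?O i))" for i
      using F_encoding[of i] inj_on_subset[of _ "carrier (F i)" "\<Omega> i"] by (auto simp: \<Omega>_def)
    show "\<exists>a\<in>Arr J. Dom J a = i \<and> pushF a x \<in> {\<zero>\<^bsub>?O (Cod J a)\<^esub>}" if "i \<in> Obj J" "x \<in> carrier (?O i)" for i x
      using F_null that unfolding null_system_def by (auto simp: \<Omega>_def)
  qed (assumption, rule that)
  let ?j = "Cod J a"
  have j: "?j \<in> Obj J" by (rule J.Cod_in[OF a(1)])
  interpret cj: group_module_hom G "F ?j" "M ?j" "cover ?j" by (rule cov[OF j])
  interpret pa: group_module_hom G "F i" "F ?j" "pushF a" using pF[OF a(1)] a(2) by simp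
  interpret Oj: right_module "group_ring G" "?O ?j" by (rule rmodule_system.M_module[OF \<Omega>_system j])
  interpret Cj: comm_group "cochains G ?n (F ?j)" by (rule cj.M.comm_group_cochains)
  interpret \<delta>j: group_hom "cochains G ?n (F ?j)" "cochains G (Suc ?n) (F ?j)" "coboundary G ?n (F ?j)"
    by (rule cj.GM.group_hom_coboundary)
  obtain w where w: "w \<in> carrier (cochains G ?n (?O ?j))" "d = coboundary G ?n (?O ?j) w"
    using d by (auto simp: coboundaries_def)
  have w\<Omega>: "w xs \<in> \<Omega> ?j" if "xs \<in> bar_cells G ?n" for xs
    using cochain_closed[OF w(1) that] by simp
  have wF: "w \<in> carrier (cochains G ?n (F ?j))"
    using w(1) by (auto simp: carrier_cochains \<Omega>_def PiE_iff)
  have dw: "d = coboundary G ?n (F ?j) w"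
    unfolding w(2) by (rule cj.GM.coboundary_submodule[OF \<Omega>[OF j] w(1)])
  have "pushF a (?g xs) = d xs" if xs: "xs \<in> bar_cells G (Suc ?n)" for xs
  proof (rule Oj.M.minus_eq_zero)
    show "pushF a (?g xs) \<in> carrier (?O ?j)"
      using \<Omega>_push[OF a(1)] cochain_closed[OF g\<Omega> xs] a(2) by simp
    show "d xs \<in> carrier (?O ?j)"
    proof -
      interpret Oj': group_module G "?O ?j" by unfold_locales
      show ?thesis unfolding w(2) by (rule cochain_closed[OF Oj'.coboundary_closed[OF w(1)] xs])
    qed
  qed (use ad[OF xs] in simp)
  then have push_g: "compose (bar_cells G (Suc ?n)) (pushF a) ?g = d"
  proof -
    assume eq: "\<And>xs. xs \<in> bar_cells G (Suc ?n) \<Longrightarrow> pushF a (?g xs) = d xs"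
    have "compose (bar_cells G (Suc ?n)) (pushF a) ?g = restrict d (bar_cells G (Suc ?n))"
      using eq by (auto simp: compose_def intro!: restrict_ext)
    then show ?thesis
      using cj.GM.coboundary_closed[OF wF] by (simp add: dw carrier_cochains PiE_restrict)
  qed
  let ?pf = "compose (bar_cells G ?n) (pushF a) f"
  have pf: "?pf \<in> carrier (cochains G ?n (F ?j))" by (rule pa.compose_closed[OF f])
  \<comment> \<open>The pushed lift and w have the same coboundary, so h is a cocycle. As w takes
    values in \<Omega>, h still lies over the image of z.\<close>
  define h where "h = ?pf \<otimes>\<^bsub>cochains G ?n (F ?j)\<^esub> inv\<^bsub>cochains G ?n (F ?j)\<^esub> w"
  have h: "h \<in> carrier (cochains G ?n (F ?j))"
    unfolding h_def by (rule Cj.m_closed[OF pf Cj.inv_closed[OF wF]])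
  have dh: "coboundary G ?n (F ?j) h = \<one>\<^bsub>cochains G (Suc ?n) (F ?j)\<^esub>"
    unfolding h_def \<delta>j.hom_mult[OF pf Cj.inv_closed[OF wF]] \<delta>j.hom_inv[OF wF]
      pa.compose_coboundary[OF f] push_g dw[symmetric]
    unfolding dw by (rule \<delta>j.H.r_inv[OF \<delta>j.hom_closed[OF wF]])
  have cover_h: "compose (bar_cells G ?n) (cover ?j) h = compose (bar_cells G ?n) (\<phi> a) z"
  proof -
    interpret cc: group_hom "cochains G ?n (F ?j)" "cochains G ?n (M ?j)" "compose (bar_cells G ?n) (cover ?j)"
      by (rule cj.compose_group_hom)
    have "compose (bar_cells G ?n) (cover ?j) w = \<one>\<^bsub>cochains G ?n (M ?j)\<^esub>"
      using w\<Omega> by (auto simp: compose_def one_cochains \<Omega>_def intro!: restrict_ext)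
    then have "compose (bar_cells G ?n) (cover ?j) h = compose (bar_cells G ?n) (cover ?j) ?pf"
      unfolding h_def cc.hom_mult[OF pf Cj.inv_closed[OF wF]] cc.hom_inv[OF wF]
      using cc.hom_closed[OF pf] by (simp only: cc.H.inv_one cc.H.r_one)
    also have "\<dots> = compose (bar_cells G ?n) (\<phi> a) (compose (bar_cells G ?n) (cover i) f)"
      using cover_pushF[OF a(1)] a(2) cochain_closed[OF f] by (intro compose_compose_eqI) simp
    finally show ?thesis unfolding cover_f .
  qed

  interpret ij: group_module_hom G "F ?j" "E ?j" incl by (rule inc)
  let ?h = "compose (bar_cells G ?n) incl h"
  have hE: "?h \<in> carrier (cochains G ?n (E ?j))" by (rule ij.compose_closed[OF h])
  have dhE: "coboundary G ?n (E ?j) ?h = \<one>\<^bsub>cochains G (Suc ?n) (E ?j)\<^esub>"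
    unfolding ij.compose_coboundary[OF h] dh by (rule ij.compose_one)
  \<comment> \<open>\<open>E ?j\<close> comes from an R-module, so the image of h there bounds.
    Modulo \<open>F ?j\<close> the cochain e is a cocycle, whose image under the connecting
    homomorphism is the class of h.\<close>
  obtain e where e: "e \<in> carrier (cochains G m (E ?j))" "coboundary G m (E ?j) e = ?h"
    using cohomology_vanishes[OF S.right_module_free, of ?h m "nonzero (M ?j)"] hE dhE
    by (auto simp: carrier_cochains one_cochains)
  let ?K = "\<lambda>i. incl ` carrier (F i)"
  have K: "right_submodule (group_ring G) (E i) (?K i)" for i
    by (rule right_module_hom.right_submodule_image[OF incl_hom])
  have de: "coboundary G m (E ?j) e xs \<in> ?K ?j" if "xs \<in> bar_cells G (Suc m)" for xs
    unfolding e(2) using that cochain_closed[OF h that] by (simp add: compose_eq)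
  \<comment> \<open>The hypothesis in degree n - 1, for the quotients of E by F: along b the cochain
    e becomes the coboundary d2 modulo F.\<close>
  obtain b d2 where b: "b \<in> Arr J" "Dom J b = ?j" and d2: "d2 \<in> coboundaries G m (E (Cod J b))"
    and bd2: "\<And>xs. xs \<in> bar_cells G m \<Longrightarrow> pushE b (e xs) \<ominus>\<^bsub>E (Cod J b)\<^esub> d2 xs \<in> ?K (Cod J b)"
  proof (rule zero_finitary_modulo[where K = ?K and N = E and \<psi> = pushE and i = ?j and c = e,
        OF G.group_axioms fin J E_system K _ E_encoding _ j e(1) de])
    show "pushE a x \<in> ?K (Cod J a)" if a: "a \<in> Arr J" and x: "x \<in> ?K (Dom J a)" for a x
    proof -
      obtain y where y: "y \<in> carrier (F (Dom J a))" "x = incl y" using x by blast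
      interpret p: group_module_hom G "F (Dom J a)" "F (Cod J a)" "pushF a" by (rule pF[OF a])
      show ?thesis unfolding y(2) incl_pushF[OF a y(1), symmetric] using p.ah.hom_closed[OF y(1)] by (rule imageI)
    qed
    \<comment> \<open>Elements of E even become zero along some arrow, so they die modulo F.\<close>
    show "\<exists>a\<in>Arr J. Dom J a = i \<and> pushE a x \<in> ?K (Cod J a)" if i: "i \<in> Obj J" and x: "x \<in> carrier (E i)" for i x
    proof -
      obtain a where a: "a \<in> Arr J" "Dom J a = i" "pushE a x = \<zero>\<^bsub>E (Cod J a)\<^esub>"
        using E_null i x unfolding null_system_def by blast
      show ?thesis
        by (rule bexI[OF _ a(1)]) (simp only: a(2,3) right_submoduleD(2)[OF K] simp_thms)
    qed
  qed (assumption, rule that)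
  let ?l = "Cod J b"
  have l: "?l \<in> Obj J" by (rule J.Cod_in[OF b(1)])
  interpret cl: group_module_hom G "F ?l" "M ?l" "cover ?l" by (rule cov[OF l])
  interpret il: group_module_hom G "F ?l" "E ?l" incl by (rule inc)
  interpret pb: group_module_hom G "F ?j" "F ?l" "pushF b" using pF[OF b(1)] b(2) by simp
  interpret qb: group_module_hom G "E ?j" "E ?l" "pushE b" using pE[OF b(1)] b(2) by simp
  interpret El: comm_group "cochains G m (E ?l)" by (rule il.N.comm_group_cochains)
  interpret \<delta>l: group_hom "cochains G m (E ?l)" "cochains G (Suc m) (E ?l)" "coboundary G m (E ?l)"
    by (rule il.GN.group_hom_coboundary)
  have d2c: "d2 \<in> carrier (cochains G m (E ?l))" "coboundary G m (E ?l) d2 = \<one>\<^bsub>cochains G (Suc m) (E ?l)\<^esub>"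
    using subsetD[OF il.GN.coboundaries_subset d2] by (simp_all add: mem_cocycles)
  let ?pe = "compose (bar_cells G m) (pushE b) e"
  have pe: "?pe \<in> carrier (cochains G m (E ?l))" by (rule qb.compose_closed[OF e(1)])
  \<comment> \<open>d2 is a cocycle, so u has the same coboundary as the pushed e; but u takes
    values in the image of F.\<close>
  define u where "u = ?pe \<otimes>\<^bsub>cochains G m (E ?l)\<^esub> inv\<^bsub>cochains G m (E ?l)\<^esub> d2"
  have du: "coboundary G m (E ?l) u = compose (bar_cells G ?n) (pushE b) ?h"
    unfolding u_def \<delta>l.hom_mult[OF pe El.inv_closed[OF d2c(1)]] \<delta>l.hom_inv[OF d2c(1)] d2c(2)
      qb.compose_coboundary[OF e(1)] e(2)
    using qb.compose_closed[OF hE] by (simp only: \<delta>l.H.inv_one \<delta>l.H.r_one)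
  have u_in: "u xs \<in> ?K ?l" if "xs \<in> bar_cells G m" for xs
    using bd2[OF that] that unfolding u_def il.N.inv_cochains[OF d2c(1)]
    by (simp add: mult_cochains compose_eq a_minus_def)
  define v where "v = compose (bar_cells G m) (inv_into (carrier (F ?l)) incl) u"
  have v: "v \<in> carrier (cochains G m (F ?l))"
    using inv_into_into[OF u_in] by (auto simp: v_def carrier_cochains compose_def)
  have incl_v: "compose (bar_cells G m) incl v = u"
  proof -
    have "compose (bar_cells G m) incl v = restrict u (bar_cells G m)"
      using f_inv_into_f[OF u_in] by (auto simp: v_def compose_def intro!: restrict_ext)
    moreover have "u \<in> carrier (cochains G m (E ?l))"
      unfolding u_def by (rule El.m_closed[OF pe El.inv_closed[OF d2c(1)]])
    ultimately show ?thesis by (simp add: carrier_cochains PiE_restrict)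
  qed
  have eq: "compose (bar_cells G ?n) incl (coboundary G m (F ?l) v) = compose (bar_cells G ?n) incl (compose (bar_cells G ?n) (pushF b) h)"
  proof -
    have "compose (bar_cells G ?n) incl (coboundary G m (F ?l) v) = compose (bar_cells G ?n) (pushE b) ?h"
      unfolding il.compose_coboundary[OF v, symmetric] incl_v by (rule du)
    also have "\<dots> = compose (bar_cells G ?n) incl (compose (bar_cells G ?n) (pushF b) h)"
      using incl_pushF[OF b(1)] b(2) cochain_closed[OF h] by (intro compose_compose_eqI) simp
    finally show ?thesis .
  qed
  have ph: "compose (bar_cells G ?n) (pushF b) h \<in> carrier (cochains G ?n (F ?l))" by (rule pb.compose_closed[OF h])
  have dv: "coboundary G m (F ?l) v \<in> carrier (cochains G ?n (F ?l))" by (rule cl.GM.coboundary_closed[OF v])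
  \<comment> \<open>The two cochains agree in E, hence in F because \<open>incl\<close> is
    injective. So the cocycle h becomes a coboundary in F along b, and applying \<open>cover\<close>
    turns this into the claim for z.\<close>
  have "coboundary G m (F ?l) v = compose (bar_cells G ?n) (pushF b) h"
  proof (rule extensionalityI[where A = "bar_cells G ?n"])
    fix xs assume xs: "xs \<in> bar_cells G ?n"
    have "incl (coboundary G m (F ?l) v xs) = incl (compose (bar_cells G ?n) (pushF b) h xs)"
      using fun_cong[OF eq, of xs] unfolding compose_eq[OF xs, of incl] .
    then show "coboundary G m (F ?l) v xs = compose (bar_cells G ?n) (pushF b) h xs"
      using cochain_closed[OF dv xs] cochain_closed[OF ph xs] by (rule inj_onD[OF incl_inj])
  qed (use dv ph in \<open>simp_all add: carrier_cochains PiE_def\<close>)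
  then have "coboundary G m (M ?l) (compose (bar_cells G m) (cover ?l) v)
      = compose (bar_cells G ?n) (cover ?l) (compose (bar_cells G ?n) (pushF b) h)"
    unfolding cl.compose_coboundary[OF v] by simp
  also have "\<dots> = compose (bar_cells G ?n) (\<phi> b) (compose (bar_cells G ?n) (cover ?j) h)"
    using cover_pushF[OF b(1)] b(2) cochain_closed[OF h] by (intro compose_compose_eqI) simp
  also have "\<dots> = compose (bar_cells G ?n) (\<phi> (Comp J b a)) z"
    unfolding cover_h
    using M.\<phi>_Comp[OF a(1) b(1) b(2)] a(2) cochain_closed[OF zc(1)] by (auto simp: compose_def intro!: restrict_ext)
  finally have "compose (bar_cells G ?n) (\<phi> (Comp J b a)) z = coboundary G m (M ?l) (compose (bar_cells G m) (cover ?l) v)" ..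
  then have "compose (bar_cells G ?n) (\<phi> (Comp J b a)) z \<in> coboundaries G ?n (M ?l)"
    using cl.compose_closed[OF v] by (simp add: coboundaries_def)
  then show "\<exists>a\<in>Arr J. Dom J a = i \<and> compose (bar_cells G ?n) (\<phi> a) z \<in> coboundaries G ?n (M (Cod J a))"
    using J.Comp_in[OF a(1) b(1) b(2)] a(2) by (intro bexI[of _ "Comp J b a"]) auto
qed

end

end

theorem lemma3p2:
  fixes G :: "('g, 'b) monoid_scheme"
    and R :: "('u, 'c) ring_scheme"
    and \<iota> :: "('g \<Rightarrow>\<^sub>0 int) \<Rightarrow> 'u"
    and n :: nat
  assumes "group G"
    and "overring (group_ring G) R \<iota>"
    and "flat_left_module TYPE('u) (group_ring G) (as_left_module \<iota> R)"
    and "trivial_group (tensor (group_ring G) trivial_rmodule (as_left_module \<iota> R))"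
    and "n > 0"
    and "zero_finitary (group_ring G) (cohomology TYPE('u) G (n - 1))"
    and "zero_finitary (group_ring G) (cohomology TYPE('u) G (n + 1))"
  shows "zero_finitary (group_ring G) (cohomology TYPE('u) G n)"
  proof -
  obtain m where n: "n = Suc m" using assms(5) by (cases n) auto
  interpret G: group G by fact
  interpret ZG: ring "group_ring G" using assms(2) by (simp add: overring_def)
  interpret R: ring R using assms(2) by (simp add: overring_def)
  interpret flat_overring G R \<iota>
    using assms(2-4) by unfold_locales (auto simp: overring_def)
  show ?thesis
    unfolding n zero_finitary_cohomology_iff[OF assms(1)]
    using null_cohomology_Suc assms(6,7) by (auto simp: n)
qed

end
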